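(* Let $n\ge 1$, $p>1$ and $0<\beta<2$. Let $f:\mathbb{R}\to\mathbb{R}$ satisfy $f(0)=0$ and $$|f(u)-f(v)|\le C|u-v|\left(e^{\lambda|u|^p}+e^{\lambda|v|^p}\right)\quad\text{for all }u,v\in\mathbb{R},$$ for some constants $C>0$ and $\lambda>0$. Given $u_0\in \exp L^p_0(\mathbb{R}^n)$, there exist a time $T=T(u_0)>0$ and a unique mild solution $u\in C([0,T];\exp L^p_0(\mathbb{R}^n))$ to the Cauchy problem $$u_t+(-\Delta)^{\beta/2}u=f(u)\quad (t>0,\ x\in\mathbb{R}^n),\qquad u(0,x)=u_0(x).$$
   Context: All functions are real-valued. For $p\ge 1$, the Orlicz space $\exp L^p(\mathbb{R}^n)$ is the set of $u\in L^1_{loc}(\mathbb{R}^n)$ such that $\int_{\mathbb{R}^n}\left(\exp\left(|u(x)|^p/\lambda^p\right)-1\right)dx<\infty$ for some $\lambda>0$; it is a Banach space with the Luxemburg norm $$\|u\|_{\exp L^p(\mathbb{R}^n)}=\inf\left\{\lambda>0:\ \int_{\mathbb{R}^n}\left(\exp\left(\frac{|u(x)|^p}{\lambda^p}\right)-1\right)dx\le 1\right\}.$$ $\exp L^p_0(\mathbb{R}^n)$ is the closure of $C_0^\infty(\mathbb{R}^n)$ in $\exp L^p(\mathbb{R}^n)$, with the same norm; equivalently, the set of $u\in L^1_{loc}(\mathbb{R}^n)$ with $\int_{\mathbb{R}^n}(\exp(\alpha|u|^p)-1)\,dx<\infty$ for every $\alpha>0$. The fractional heat semigroup is $e^{-t(-\Delta)^{\beta/2}}\varphi=S_\beta(t)*\varphi$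 for $t>0$ (and the identity for $t=0$), where $S_\beta(x,t)=(2\pi)^{-n}\int_{\mathbb{R}^n}e^{ix\cdot\xi-t|\xi|^\beta}\,d\xi$, so that $S_\beta\ge0$ and $\int_{\mathbb{R}^n} S_\beta(x,t)\,dx=1$. Given $u_0\in\exp L^p_0(\mathbb{R}^n)$ and $T>0$, a mild solution on $[0,T]$ is a function $u\in C([0,T];\exp L^p_0(\mathbb{R}^n))$ satisfying $$u(t)=e^{-t(-\Delta)^{\beta/2}}u_0+\int_0^te^{-(t-s)(-\Delta)^{\beta/2}}f(u(s))\,ds.$$ *)

theory Defs
  imports "HOL-Analysis.Analysis"
begin

(* Elements of the function spaces are represented by functions; equality in the spaces
   is equality almost everywhere. *)

definition exp_modular :: "real \<Rightarrow> real \<Rightarrow> ('a::euclidean_space \<Rightarrow> real) \<Rightarrow> ennreal" where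
  "exp_modular p l u = (\<integral>\<^sup>+ x. ennreal (exp (\<bar>u x\<bar> powr p / l powr p) - 1) \<partial>lebesgue)"

(* Local integrability also supplies the Lebesgue measurability of u. *)
definition exp_Lp :: "real \<Rightarrow> ('a::euclidean_space \<Rightarrow> real) set" where
  "exp_Lp p = {u. (\<forall>K. compact K \<longrightarrow> u absolutely_integrable_on K) \<and>
                  (\<exists>l>0. exp_modular p l u < \<infinity>)}"

(* Only meaningful on exp_Lp p: outside it, Inf is taken over the empty set. *)
definition exp_Lp_norm :: "real \<Rightarrow> ('a::euclidean_space \<Rightarrow> real) \<Rightarrow> real" where
  "exp_Lp_norm p u = Inf {l. 0 < l \<and> exp_modular p l u \<le> 1}"

primrec Ck :: "nat \<Rightarrow> ('a::euclidean_space \<Rightarrow> real) \<Rightarrow> bool" where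
  "Ck 0 \<phi> \<longleftrightarrow> continuous_on UNIV \<phi>"
| "Ck (Suc k) \<phi> \<longleftrightarrow> (\<forall>x. \<phi> differentiable (at x)) \<and>
      (\<forall>b\<in>Basis. Ck k (\<lambda>x. frechet_derivative \<phi> (at x) b))"

definition test_functions :: "('a::euclidean_space \<Rightarrow> real) set" where
  "test_functions = {\<phi>. (\<forall>k. Ck k \<phi>) \<and> compact (closure {x. \<phi> x \<noteq> 0})}"

definition exp_Lp0 :: "real \<Rightarrow> ('a::euclidean_space \<Rightarrow> real) set" where
  "exp_Lp0 p = {u \<in> exp_Lp p.
     \<forall>e>0. \<exists>\<phi>\<in>test_functions. exp_Lp_norm p (\<lambda>x. u x - \<phi> x) < e}"

(* The complex integral is real because the phase is odd in xi. *)
definition frac_heat_kernel :: "real \<Rightarrow> real \<Rightarrow> 'a::euclidean_space \<Rightarrow> real" where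
  "frac_heat_kernel \<beta> t x =
     Re (\<integral>\<xi>. exp (\<i> * complex_of_real (x \<bullet> \<xi>) - complex_of_real (t * norm \<xi> powr \<beta>)) \<partial>lebesgue)
       / (2 * pi) ^ DIM('a)"

definition frac_heat_semigroup ::
  "real \<Rightarrow> real \<Rightarrow> ('a::euclidean_space \<Rightarrow> real) \<Rightarrow> 'a \<Rightarrow> real" where
  "frac_heat_semigroup \<beta> t \<phi> =
     (if t = 0 then \<phi>
      else (\<lambda>x. \<integral>y. frac_heat_kernel \<beta> t (x - y) * \<phi> y \<partial>lebesgue))"

definition exp_Lp0_continuous ::
  "real \<Rightarrow> real \<Rightarrow> (real \<Rightarrow> 'a::euclidean_space \<Rightarrow> real) \<Rightarrow> bool" where
  "exp_Lp0_continuous p T u \<longleftrightarrow>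
     (\<forall>t\<in>{0..T}. u t \<in> exp_Lp0 p) \<and>
     (\<forall>t\<in>{0..T}. ((\<lambda>s. exp_Lp_norm p (\<lambda>x. u s x - u t x)) \<longlongrightarrow> 0) (at t within {0..T}))"

(* Duhamel's formula is an identity in the function space, so it is required at every time t
   for almost every x.  The time integral is required to converge absolutely, since the
   integral of a non-integrable function would be 0 by convention. *)
definition mild_solution ::
  "real \<Rightarrow> real \<Rightarrow> (real \<Rightarrow> real) \<Rightarrow> ('a::euclidean_space \<Rightarrow> real) \<Rightarrow> real
     \<Rightarrow> (real \<Rightarrow> 'a \<Rightarrow> real) \<Rightarrow> bool" where
  "mild_solution p \<beta> f u0 T u \<longleftrightarrow>
     exp_Lp0_continuous p T u \<and>
     (\<forall>t\<in>{0..T}. AE x in lebesgue.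
        (\<lambda>s. frac_heat_semigroup \<beta> (t - s) (\<lambda>y. f (u s y)) x) absolutely_integrable_on {0..t} \<and>
        u t x = frac_heat_semigroup \<beta> t u0 x +
          (LINT s:{0..t}|lebesgue. frac_heat_semigroup \<beta> (t - s) (\<lambda>y. f (u s y)) x))"

end

(*
  The kernel is nonnegative because exp(-t |xi|^beta) is a bounded pointwise limit of functions
  exp(g - g(0)) with g a mixture of Gaussians (truncate the Levy measure in
  |xi|^beta = c * integral of (1 - exp(-s |xi|^2)) s^(-1-beta/2) ds), and expanding exp(g) in
  powers shows that these have nonnegative Fourier transforms; a Gaussian regularisation of the
  Fourier integral then gives total mass 1.  Hence the semigroup is a convolution with a
  rescaled probability density: by Jensen's inequality it contracts the Orlicz modular, it maps
  L^q to the bounded functions with norm O(t^(-n/(beta q))), and it is strongly continuous on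
  the closure of the test functions.

  On a small ball of exp L^p around u0 all exponential moments are uniformly bounded, so
  u -> f(u) is Lipschitz from that ball of exp L^p into L^p and L^q for every q = k p.  Taking
  q > n / beta makes the smoothing factor integrable in time, and the Duhamel operator maps such
  right-hand sides into L^p and the bounded functions with a factor that tends to 0 with the
  length of the time interval.  It is thus a contraction, without splitting u0.  Uniqueness
  holds for arbitrary solutions because their range is compact in exp L^p, which makes all
  exponential moments bounded uniformly in time; the estimate is then iterated over short
  intervals of equal length.
*)
theory Submission
  imports Defs "HOL-Probability.Characteristic_Functions" "HOL-Probability.Sinc_Integral"
begin

section \<open>Lebesgue integrals in Euclidean space\<close>

text \<open>The obstacle: \<open>f (u s)\<close> may grow like
  \<open>exp (lam * \<bar>u\<bar> powr p)\<close>, so it need not lie in exp L^p; only its L^r norms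
  with finite r are under control. The way out is that a function whose supremum and L^p norm are
  both at most a small multiple of \<open>l\<close> has modular at most 1 at level \<open>l\<close>,
  because exp y - 1 \<le> e y for 0 \<le> y \<le> 1. The smoothing of the semigroup supplies the
  supremum of the Duhamel term, its contractivity the L^p norm.

  Norm bounds are stated as \<open>exp_modular p l w \<le> 1\<close>, to be read as: the norm of
  \<open>w\<close> is at most \<open>l\<close>. In this form they pass through Fatou's lemma,
  Jensen's inequality and changes on null sets without touching the infimum.

  A curve in the space is a family of classes, so the integrand of Duhamel's formula carries no
  joint measurability in time and space; it is recovered, for Borel representatives, from continuity
  in time. The Duhamel integral is written with the elapsed time as variable, which reduces its
  modulus of continuity in time to that of \<open>u\<close>.\<close>

lemma nn_integral_lborel_affine:
  fixes f :: "'a::euclidean_space \<Rightarrow> ennreal"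
  assumes [measurable]: "f \<in> borel_measurable borel" and c: "c \<noteq> 0"
  shows "(\<integral>\<^sup>+x. f x \<partial>lborel) = ennreal (\<bar>c\<bar> ^ DIM('a)) * (\<integral>\<^sup>+x. f (a + c *\<^sub>R x) \<partial>lborel)"
  by (subst lborel_affine[OF c, of a])
     (simp add: nn_integral_density nn_integral_distr nn_integral_cmult)

lemma integrable_lborel_affine:
  fixes f :: "'a::euclidean_space \<Rightarrow> 'b::{banach, second_countable_topology}"
  assumes f: "integrable lborel f" and c: "c \<noteq> 0"
  shows "integrable lborel (\<lambda>x. f (a + c *\<^sub>R x))"
proof -
  have [measurable]: "f \<in> borel_measurable borel" using f by auto
  have "integrable (density (distr lborel borel (\<lambda>x. a + c *\<^sub>R x)) (\<lambda>_. \<bar>c\<bar>^DIM('a))) f"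
    using f lborel_affine[OF c, of a] by simp
  then have "integrable (distr lborel borel (\<lambda>x. a + c *\<^sub>R x)) (\<lambda>x. \<bar>c\<bar>^DIM('a) *\<^sub>R f x)"
    by (subst (asm) integrable_density) auto
  then have "integrable lborel (\<lambda>x. \<bar>c\<bar>^DIM('a) *\<^sub>R f (a + c *\<^sub>R x))"
    by (simp add: integrable_distr_eq)
  from integrable_scaleR_right[OF this, of "1 / \<bar>c\<bar>^DIM('a)"] show ?thesis using c by simp
qed

lemma integral_lborel_affine:
  fixes f :: "'a::euclidean_space \<Rightarrow> 'b::{banach, second_countable_topology}"
  assumes [measurable]: "f \<in> borel_measurable borel" and c: "c \<noteq> 0"
  shows "(\<integral>x. f x \<partial>lborel) = \<bar>c\<bar> ^ DIM('a) *\<^sub>R (\<integral>x. f (a + c *\<^sub>R x) \<partial>lborel)"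
  by (subst lborel_affine[OF c, of a])
     (simp add: integral_density integral_distr)

lemma integral_lborel_prod:
  fixes f :: "'a::euclidean_space \<Rightarrow> real \<Rightarrow> complex"
  assumes f: "\<And>b. b \<in> Basis \<Longrightarrow> integrable lborel (f b)"
  shows "(\<integral>x. (\<Prod>b\<in>Basis. f b (x \<bullet> b)) \<partial>lborel) = (\<Prod>b\<in>Basis. (\<integral>x. f b x \<partial>lborel))"
proof -
  interpret product_sigma_finite "\<lambda>_::'a. lborel :: real measure" ..
  have [measurable]: "b \<in> Basis \<Longrightarrow> f b \<in> borel_measurable borel" for b using f[of b] by auto
  have "(\<integral>x. (\<Prod>b\<in>Basis. f b (x \<bullet> b)) \<partial>lborel) =
     (\<integral>x. (\<Prod>b\<in>Basis. f b (x b)) \<partial>(\<Pi>\<^sub>M b\<in>(Basis::'a set). (lborel::real measure)))"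
    by (subst lborel_eq) (simp add: integral_distr)
  also have "\<dots> = (\<Prod>b\<in>Basis. (\<integral>x. f b x \<partial>lborel))"
    by (rule product_integral_prod) (use f in auto)
  finally show ?thesis .
qed

section \<open>Integrability of stretched exponentials\<close>

lemma pow_le_fact_exp:
  fixes y :: real assumes "0 \<le> y" shows "y ^ m \<le> fact m * exp y"
proof -
  have "(\<Sum>k\<in>{m}. y ^ k /\<^sub>R fact k) \<le> (\<Sum>k. y ^ k /\<^sub>R fact k)"
    by (rule sum_le_suminf) (use assms summable_exp_generic[of y] in auto)
  then have "y ^ m / fact m \<le> exp y" by (simp add: exp_def divide_inverse mult.commute)
  then show ?thesis by (simp add: field_simps)
qed

lemma nn_integral_exp_powr_real:
  fixes c \<beta> :: real assumes c: "0 < c" and b: "0 < \<beta>"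
  shows "(\<integral>\<^sup>+s. ennreal (exp (-(c * \<bar>s\<bar> powr \<beta>))) \<partial>lborel) < \<infinity>"
proof -
  \<comment> \<open>With \<beta> m \<ge> 2 the m-th power of
    \<open>c * \<bar>s\<bar> powr \<beta>\<close> dominates a multiple of s^2 for |s| > 1, and the
    exponential dominates that power.\<close>
  obtain m :: nat where m: "2 / \<beta> \<le> real m" using real_arch_simple by blast
  \<comment> \<open>The 2 serves |s| \<le> 1, where 1 + s^2 \<le> 2; the other summand serves |s| >
    1, where 1 + s^2 \<le> 2 s^2.\<close>
  define D where "D = 2 + 2 * fact m / c ^ m"
  have D2: "2 \<le> D" using c by (simp add: D_def)
  have bound: "exp (-(c * \<bar>s\<bar> powr \<beta>)) \<le> D * inverse (1 + s\<^sup>2)" for s :: real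
  proof (cases "\<bar>s\<bar> \<le> 1")
    case True
    then have "s\<^sup>2 \<le> 1" by (simp add: abs_square_le_1)
    then have "1 + s\<^sup>2 \<le> D" using D2 by linarith
    then have "1 \<le> D * inverse (1 + s\<^sup>2)" by (simp add: field_simps add_pos_nonneg)
    moreover have "exp (-(c * \<bar>s\<bar> powr \<beta>)) \<le> 1" using c by simp
    ultimately show ?thesis by linarith
  next
    case False
    define y where "y = c * \<bar>s\<bar> powr \<beta>"
    have y0: "0 < y" using False c by (simp add: y_def)
    have "s\<^sup>2 = \<bar>s\<bar> powr 2" using False by (simp add: powr_numeral)
    also have "\<dots> \<le> \<bar>s\<bar> powr (\<beta> * real m)"
      using False m b by (intro powr_mono) (auto simp: field_simps)
    also have "\<dots> = (\<bar>s\<bar> powr \<beta>) ^ m" using False by (simp add: powr_powr[symmetric] powr_realpow)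
    also have "\<dots> = y ^ m / c ^ m" using c by (simp add: y_def power_mult_distrib)
    also have "\<dots> \<le> fact m * exp y / c ^ m" using pow_le_fact_exp[of y m] y0 c by (intro divide_right_mono) auto
    finally have s2: "s\<^sup>2 \<le> fact m / c ^ m * exp y" by simp
    have "1 \<le> s\<^sup>2" using False abs_square_less_1[of s] by linarith
    then have "1 + s\<^sup>2 \<le> 2 * s\<^sup>2" by simp
    also have "\<dots> \<le> 2 * (fact m / c ^ m * exp y)" using s2 by simp
    also have "\<dots> \<le> D * exp y" by (simp add: D_def algebra_simps)
    finally have "exp (- y) * (1 + s\<^sup>2) \<le> D"
      by (simp add: exp_minus field_simps)
    then show ?thesis unfolding y_def[symmetric] by (simp add: field_simps add_pos_nonneg)
  qed
  have int: "integrable lborel (\<lambda>s::real. D * inverse (1 + s\<^sup>2))"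
    using integrable_inverse_1_plus_square by (simp add: set_integrable_def)
  have "(\<integral>\<^sup>+s. ennreal (exp (-(c * \<bar>s\<bar> powr \<beta>))) \<partial>lborel) \<le> (\<integral>\<^sup>+s. ennreal (norm (D * inverse (1 + s\<^sup>2))) \<partial>lborel)"
    by (intro nn_integral_mono ennreal_leI) (use bound abs_ge_self order_trans in \<open>fastforce\<close>)
  also have "\<dots> < \<infinity>" using int unfolding integrable_iff_bounded by simp
  finally show ?thesis .
qed

text \<open>Every coordinate is at most the norm, so \<open>norm \<xi> powr \<beta>\<close> is at
  least the mean over the coordinates of \<open>\<bar>\<xi> \<bullet> b\<bar> powr \<beta>\<close>.
  This gives a majorant that is a product of one-dimensional functions.\<close>

lemma integrable_exp_powr:
  assumes t: "0 < t" and b: "0 < \<beta>"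
  shows "integrable lborel (\<lambda>\<xi>::'a::euclidean_space. exp (-(t * norm \<xi> powr \<beta>)))"
proof -
  define n where "n = real DIM('a)"
  have n: "0 < n" by (simp add: n_def)
  have le: "exp (-(t * norm \<xi> powr \<beta>)) \<le> (\<Prod>b\<in>Basis. exp (-((t/n) * \<bar>\<xi> \<bullet> b\<bar> powr \<beta>)))" for \<xi> :: 'a
  proof -
    have "(\<Sum>b\<in>Basis. \<bar>\<xi> \<bullet> b\<bar> powr \<beta>) \<le> (\<Sum>b\<in>(Basis::'a set). norm \<xi> powr \<beta>)"
      by (intro sum_mono powr_mono2) (use b Basis_le_norm in auto)
    then have "(\<Sum>b\<in>Basis. \<bar>\<xi> \<bullet> b\<bar> powr \<beta>) \<le> n * norm \<xi> powr \<beta>" by (simp add: n_def)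
    then have "(t/n) * (\<Sum>b\<in>Basis. \<bar>\<xi> \<bullet> b\<bar> powr \<beta>) \<le> (t/n) * (n * norm \<xi> powr \<beta>)"
      using t n by (intro mult_left_mono) auto
    then have "(t/n) * (\<Sum>b\<in>Basis. \<bar>\<xi> \<bullet> b\<bar> powr \<beta>) \<le> t * norm \<xi> powr \<beta>" using n by simp
    then show ?thesis
      by (subst exp_sum[symmetric]) (auto simp: sum_negf sum_distrib_left)
  qed
  have "(\<integral>\<^sup>+\<xi>. ennreal (exp (-(t * norm (\<xi>::'a) powr \<beta>))) \<partial>lborel) \<le>
     (\<integral>\<^sup>+\<xi>. (\<Prod>b\<in>(Basis::'a set). ennreal (exp (-((t/n) * \<bar>\<xi> \<bullet> b\<bar> powr \<beta>)))) \<partial>lborel)"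
  proof (intro nn_integral_mono)
    fix \<xi> :: 'a
    show "ennreal (exp (-(t * norm \<xi> powr \<beta>))) \<le> (\<Prod>b\<in>(Basis::'a set). ennreal (exp (-((t/n) * \<bar>\<xi> \<bullet> b\<bar> powr \<beta>))))"
      by (subst prod_ennreal, simp, rule ennreal_leI, rule le)
  qed
  also have "\<dots> = (\<Prod>b\<in>(Basis::'a set). (\<integral>\<^sup>+s. ennreal (exp (-((t/n) * \<bar>s\<bar> powr \<beta>))) \<partial>lborel))"
    by (rule nn_integral_lborel_prod) auto
  also have "\<dots> < \<infinity>" 
    using nn_integral_exp_powr_real[of "t/n" \<beta>] t n b by (simp add: power_less_top_ennreal)
  finally show ?thesis unfolding integrable_iff_bounded by simp
qed

lemma integrable_lborel_product:
  fixes f :: "'a::euclidean_space \<Rightarrow> real" and g :: "'b::euclidean_space \<Rightarrow> real"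
  assumes f: "integrable lborel f" and g: "integrable lborel g"
  shows "integrable (lborel \<Otimes>\<^sub>M lborel) (\<lambda>(x, y). f x * g y)"
proof (rule lborel_pair.Fubini_integrable)
  have [measurable]: "f \<in> borel_measurable borel" "g \<in> borel_measurable borel" using f g by auto
  show "(\<lambda>(x, y). f x * g y) \<in> borel_measurable (lborel \<Otimes>\<^sub>M lborel)" by measurable
  show "integrable lborel (\<lambda>x. \<integral>y. norm (case (x, y) of (x, y) \<Rightarrow> f x * g y) \<partial>lborel)"
    using f by (simp add: abs_mult)
  show "AE x in lborel. integrable lborel (\<lambda>y. case (x, y) of (x, y) \<Rightarrow> f x * g y)"
    using g by simp
qed

section \<open>Positive definiteness\<close>

lemma gaussian_fourier_real:
  fixes d x :: real assumes d: "0 < d"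
  shows "integrable lborel (\<lambda>s. iexp (x * s) * complex_of_real (exp (-(d * s\<^sup>2))))"
    and "(\<integral>s. iexp (x * s) * complex_of_real (exp (-(d * s\<^sup>2))) \<partial>lborel)
          = complex_of_real (sqrt (pi / d) * exp (-(x\<^sup>2 / (4 * d))))"
proof -
  \<comment> \<open>The substitution u = c s turns d s^2 into u^2 / 2, and the integral into the
    characteristic function of the standard normal law at x / c.\<close>
  define c where "c = sqrt (2 * d)"
  have c: "0 < c" "c\<^sup>2 = 2 * d" using d by (auto simp: c_def)
  define g where "g u = iexp ((x / c) * u) * complex_of_real (exp (-(u\<^sup>2 / 2)))" for u
  have gm: "g \<in> borel_measurable borel" unfolding g_def by measurable
  have gd: "g u = sqrt (2 * pi) *\<^sub>R (std_normal_density u *\<^sub>R iexp ((x / c) * u))" for u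
    by (simp add: g_def std_normal_density_def scaleR_conv_of_real)
  have "integrable std_normal_distribution (\<lambda>u. iexp ((x / c) * u))"
    by (intro finite_measure.integrable_const_bound[where B=1] prob_space.finite_measure)
       (auto intro!: prob_space_normal_density)
  then have gi: "integrable lborel g"
    unfolding gd by (subst (asm) integrable_density) (auto intro: integrable_scaleR_right simp del: scaleR_scaleR)
  have "(\<integral>u. g u \<partial>lborel) = sqrt (2 * pi) *\<^sub>R char std_normal_distribution (x / c)"
    unfolding gd char_def by (subst integral_density) (auto simp del: scaleR_scaleR)
  also have "\<dots> = complex_of_real (sqrt (2 * pi) * exp (-((x / c)\<^sup>2 / 2)))"
    by (subst char_std_normal_distribution) (simp add: scaleR_conv_of_real)
  finally have G: "(\<integral>u. g u \<partial>lborel) = complex_of_real (sqrt (2 * pi) * exp (-((x / c)\<^sup>2 / 2)))" .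
  have gc: "g (0 + c *\<^sub>R s) = iexp (x * s) * complex_of_real (exp (-(d * s\<^sup>2)))" for s
    using c by (simp add: g_def power_mult_distrib field_simps)
  show "integrable lborel (\<lambda>s. iexp (x * s) * complex_of_real (exp (-(d * s\<^sup>2))))"
    using integrable_lborel_affine[OF gi, of c 0] c unfolding gc by simp
  have "(\<integral>u. g u \<partial>lborel) = c *\<^sub>R (\<integral>s. iexp (x * s) * complex_of_real (exp (-(d * s\<^sup>2))) \<partial>lborel)"
    using integral_lborel_affine[OF gm, of c 0] c unfolding gc by simp
  then have "(\<integral>s. iexp (x * s) * complex_of_real (exp (-(d * s\<^sup>2))) \<partial>lborel) = (1 / c) *\<^sub>R (\<integral>u. g u \<partial>lborel)"
    using c by simp
  also have "\<dots> = complex_of_real ((sqrt (2 * pi) / c) * exp (-((x / c)\<^sup>2 / 2)))"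
    unfolding G by (simp add: scaleR_conv_of_real)
  also have "sqrt (2 * pi) / c = sqrt (pi / d)"
    by (simp add: c_def real_sqrt_divide[symmetric])
  also have "(x / c)\<^sup>2 / 2 = x\<^sup>2 / (4 * d)" using c by (simp add: power_divide)
  finally show "(\<integral>s. iexp (x * s) * complex_of_real (exp (-(d * s\<^sup>2))) \<partial>lborel)
          = complex_of_real (sqrt (pi / d) * exp (-(x\<^sup>2 / (4 * d))))" .
qed

lemma integrable_gaussian:
  assumes d: "0 < d"
  shows "integrable lborel (\<lambda>\<xi>::'a::euclidean_space. exp (-(d * (norm \<xi>)\<^sup>2)))"
  using integrable_exp_powr[OF d, of 2, where 'a='a] by (simp add: powr_numeral)

lemma integrable_cos_mult:
  fixes x :: "'a::euclidean_space"
  assumes "integrable lborel (h :: 'a \<Rightarrow> real)"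
  shows "integrable lborel (\<lambda>\<xi>. cos (x \<bullet> \<xi>) * h \<xi>)"
  by (rule Bochner_Integration.integrable_bound[OF assms])
     (use assms in \<open>auto simp: abs_mult intro!: mult_left_le_one_le\<close>)

lemma gaussian_fourier:
  fixes x :: "'a::euclidean_space" assumes d: "0 < d"
  shows "(\<integral>\<xi>. cos (x \<bullet> \<xi>) * exp (-(d * (norm \<xi>)\<^sup>2)) \<partial>lborel)
     = sqrt (pi / d) ^ DIM('a) * exp (-((norm x)\<^sup>2 / (4 * d)))"
proof -
  let ?f = "\<lambda>b s. iexp ((x \<bullet> b) * s) * complex_of_real (exp (-(d * s\<^sup>2)))"
  have n2: "(norm y)\<^sup>2 = (\<Sum>b\<in>Basis. (y \<bullet> b)\<^sup>2)" for y :: 'a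
    unfolding power2_norm_eq_inner by (subst euclidean_inner) (simp add: power2_eq_square)
  have gp: "(\<Prod>b\<in>Basis. exp (-(e * (y \<bullet> b)\<^sup>2))) = exp (-(e * (norm y)\<^sup>2))" for y :: 'a and e :: real
    by (subst exp_sum[symmetric]) (simp_all add: n2 sum_negf sum_distrib_left)
  have ip: "(\<Prod>b\<in>Basis. iexp ((x \<bullet> b) * (\<xi> \<bullet> b))) = iexp (x \<bullet> \<xi>)" for \<xi>
    by (subst exp_sum[symmetric]) (simp_all add: euclidean_inner[of x \<xi>] sum_distrib_left)
  have prod: "(\<Prod>b\<in>Basis. ?f b (\<xi> \<bullet> b)) = iexp (x \<bullet> \<xi>) * complex_of_real (exp (-(d * (norm \<xi>)\<^sup>2)))" for \<xi> :: 'a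
    by (subst prod.distrib, subst ip, subst of_real_prod[symmetric], subst gp) (rule refl)
  have "(\<integral>\<xi>. iexp (x \<bullet> \<xi>) * complex_of_real (exp (-(d * (norm \<xi>)\<^sup>2))) \<partial>(lborel::'a measure))
      = (\<Prod>b\<in>(Basis::'a set). complex_of_real (sqrt (pi / d) * exp (-((x \<bullet> b)\<^sup>2 / (4 * d)))))"
    unfolding prod[symmetric]
    by (subst integral_lborel_prod) (use gaussian_fourier_real[OF d] in auto)
  also have "\<dots> = complex_of_real (sqrt (pi / d) ^ DIM('a) * exp (-((norm x)\<^sup>2 / (4 * d))))"
    using gp[of "1 / (4 * d)" x]
    by (subst of_real_prod[symmetric], subst prod.distrib) simp
  finally have E: "(\<integral>\<xi>. iexp (x \<bullet> \<xi>) * complex_of_real (exp (-(d * (norm \<xi>)\<^sup>2))) \<partial>(lborel::'a measure))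
     = complex_of_real (sqrt (pi / d) ^ DIM('a) * exp (-((norm x)\<^sup>2 / (4 * d))))" .
  have "integrable lborel (\<lambda>\<xi>::'a. iexp (x \<bullet> \<xi>) * complex_of_real (exp (-(d * (norm \<xi>)\<^sup>2))))"
    by (rule Bochner_Integration.integrable_bound[OF integrable_gaussian[OF d]]) (auto simp: norm_mult)
  from integral_Re[OF this] show ?thesis unfolding E by (simp add: Re_exp)
qed

text \<open>Nonnegativity of the Fourier transform of a bounded function that may fail to be
  integrable, such as a constant: it is tested on \<open>G\<close> times a Gaussian. All d > 0 are
  demanded at once so that multiplication by a further Gaussian stays in the class. For the radial
  functions considered here the cosine transform is the full Fourier transform.\<close>

definition pos_def_sym :: "('a::euclidean_space \<Rightarrow> real) \<Rightarrow> bool" where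
  "pos_def_sym G \<longleftrightarrow> G \<in> borel_measurable borel \<and> (\<exists>B. \<forall>\<xi>. \<bar>G \<xi>\<bar> \<le> B) \<and>
     (\<forall>x d. 0 < d \<longrightarrow> 0 \<le> (\<integral>\<xi>. cos (x \<bullet> \<xi>) * (exp (-(d * (norm \<xi>)\<^sup>2)) * G \<xi>) \<partial>lborel))"

lemma integrable_gaussian_mult:
  fixes G :: "'a::euclidean_space \<Rightarrow> real"
  assumes d: "0 < d" and [measurable]: "G \<in> borel_measurable borel" and B: "\<And>\<xi>. \<bar>G \<xi>\<bar> \<le> B"
  shows "integrable lborel (\<lambda>\<xi>. exp (-(d * (norm \<xi>)\<^sup>2)) * G \<xi>)"
proof (rule Bochner_Integration.integrable_bound[OF integrable_mult_right[OF integrable_gaussian[OF d], of B]])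
  have "\<bar>G \<xi>\<bar> * exp (-(d * (norm \<xi>)\<^sup>2)) \<le> \<bar>B\<bar> * exp (-(d * (norm \<xi>)\<^sup>2))" for \<xi>
    using B[of \<xi>] by (intro mult_right_mono) auto
  then show "AE \<xi> in lborel. norm (exp (-(d * (norm \<xi>)\<^sup>2)) * G \<xi>) \<le> norm (B * exp (-(d * (norm \<xi>)\<^sup>2)))"
    by (simp add: abs_mult mult.commute)
qed measurable

text \<open>For a fixed test Gaussian the integrals converge by dominated convergence with majorant
  \<open>B\<close> times the Gaussian; hence the bound uniform in k.\<close>

lemma pos_def_sym_LIMSEQ:
  assumes P: "\<And>k::nat. pos_def_sym (G k)" and B: "\<And>k \<xi>. \<bar>G k \<xi>\<bar> \<le> B"
    and lim: "\<And>\<xi>. (\<lambda>k. G k \<xi>) \<longlonglongrightarrow> H \<xi>"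
  shows "pos_def_sym H"
proof -
  have [measurable]: "G k \<in> borel_measurable borel" for k using P by (auto simp: pos_def_sym_def)
  have [measurable]: "H \<in> borel_measurable borel" by (rule borel_measurable_LIMSEQ_real[OF lim]) auto
  have HB: "\<bar>H \<xi>\<bar> \<le> B" for \<xi>
    by (rule LIMSEQ_le_const2[OF tendsto_rabs[OF lim]]) (use B in auto)
  have "0 \<le> (\<integral>\<xi>. cos (x \<bullet> \<xi>) * (exp (-(d * (norm \<xi>)\<^sup>2)) * H \<xi>) \<partial>lborel)" if d: "0 < d" for x d
  proof (rule LIMSEQ_le_const)
    show "(\<lambda>k. \<integral>\<xi>. cos (x \<bullet> \<xi>) * (exp (-(d * (norm \<xi>)\<^sup>2)) * G k \<xi>) \<partial>lborel)
         \<longlonglongrightarrow> (\<integral>\<xi>. cos (x \<bullet> \<xi>) * (exp (-(d * (norm \<xi>)\<^sup>2)) * H \<xi>) \<partial>lborel)"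
    proof (rule integral_dominated_convergence[where w="\<lambda>\<xi>. B * exp (-(d * (norm \<xi>)\<^sup>2))"])
      show "AE \<xi> in lborel. norm (cos (x \<bullet> \<xi>) * (exp (-(d * (norm \<xi>)\<^sup>2)) * G k \<xi>)) \<le> B * exp (-(d * (norm \<xi>)\<^sup>2))" for k
      proof (rule AE_I2)
        fix \<xi> 
        have "\<bar>cos (x \<bullet> \<xi>)\<bar> * (exp (-(d * (norm \<xi>)\<^sup>2)) * \<bar>G k \<xi>\<bar>) \<le> 1 * (exp (-(d * (norm \<xi>)\<^sup>2)) * B)"
          by (intro mult_mono B) auto
        then show "norm (cos (x \<bullet> \<xi>) * (exp (-(d * (norm \<xi>)\<^sup>2)) * G k \<xi>)) \<le> B * exp (-(d * (norm \<xi>)\<^sup>2))"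
          by (simp add: abs_mult mult.commute)
      qed
      show "integrable lborel (\<lambda>\<xi>. B * exp (-(d * (norm \<xi>)\<^sup>2)))"
        by (rule integrable_mult_right[OF integrable_gaussian[OF d]])
      show "AE \<xi> in lborel. (\<lambda>k. cos (x \<bullet> \<xi>) * (exp (-(d * (norm \<xi>)\<^sup>2)) * G k \<xi>))
          \<longlonglongrightarrow> cos (x \<bullet> \<xi>) * (exp (-(d * (norm \<xi>)\<^sup>2)) * H \<xi>)"
        by (intro AE_I2 tendsto_mult tendsto_const lim)
    qed measurable
    show "\<exists>N. \<forall>k\<ge>N. 0 \<le> (\<integral>\<xi>. cos (x \<bullet> \<xi>) * (exp (-(d * (norm \<xi>)\<^sup>2)) * G k \<xi>) \<partial>lborel)"
      using P d by (auto simp: pos_def_sym_def)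
  qed
  then show ?thesis using HB by (auto simp: pos_def_sym_def)
qed

lemma pos_def_sym_const: assumes "0 \<le> c" shows "pos_def_sym (\<lambda>_::'a::euclidean_space. c)"
proof -
  have "0 \<le> (\<integral>\<xi>. cos (x \<bullet> \<xi>) * (exp (-(d * (norm \<xi>)\<^sup>2)) * c) \<partial>lborel)" if "0 < d" for x :: 'a and d
  proof -
    have "(\<integral>\<xi>. cos (x \<bullet> \<xi>) * (exp (-(d * (norm \<xi>)\<^sup>2)) * c) \<partial>lborel) 
      = (\<integral>\<xi>. cos (x \<bullet> \<xi>) * exp (-(d * (norm \<xi>)\<^sup>2)) \<partial>lborel) * c"
      by (simp add: mult.assoc[symmetric])
    then show ?thesis using assms that by (simp add: gaussian_fourier)
  qed
  then show ?thesis by (auto simp: pos_def_sym_def)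
qed

lemma pos_def_sym_cmult: 
  assumes "0 \<le> c" "pos_def_sym G" shows "pos_def_sym (\<lambda>\<xi>. c * G \<xi>)"
proof -
  obtain B where B: "\<And>\<xi>. \<bar>G \<xi>\<bar> \<le> B" using assms by (auto simp: pos_def_sym_def)
  have "\<bar>c * G \<xi>\<bar> \<le> c * B" for \<xi> using B[of \<xi>] assms by (simp add: abs_mult mult_left_mono)
  moreover have "(\<integral>\<xi>. cos (x \<bullet> \<xi>) * (exp (-(d * (norm \<xi>)\<^sup>2)) * (c * G \<xi>)) \<partial>lborel) 
      = c * (\<integral>\<xi>. cos (x \<bullet> \<xi>) * (exp (-(d * (norm \<xi>)\<^sup>2)) * G \<xi>) \<partial>lborel)" for x d
    by (subst integral_mult_right_zero[symmetric]) (simp add: mult_ac)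
  ultimately show ?thesis using assms unfolding pos_def_sym_def
    by (auto intro!: exI[of _ "c * B"])
qed

lemma pos_def_sym_add: 
  assumes "pos_def_sym G" "pos_def_sym H" shows "pos_def_sym (\<lambda>\<xi>. G \<xi> + H \<xi>)"
proof -
  obtain B where B: "\<And>\<xi>. \<bar>G \<xi>\<bar> \<le> B" using assms by (auto simp: pos_def_sym_def)
  obtain B' where B': "\<And>\<xi>. \<bar>H \<xi>\<bar> \<le> B'" using assms by (auto simp: pos_def_sym_def)
  have [measurable]: "G \<in> borel_measurable borel" "H \<in> borel_measurable borel" using assms by (auto simp: pos_def_sym_def)
  have "\<bar>G \<xi> + H \<xi>\<bar> \<le> B + B'" for \<xi> using B[of \<xi>] B'[of \<xi>] by linarith
  moreover have "(\<integral>\<xi>. cos (x \<bullet> \<xi>) * (exp (-(d * (norm \<xi>)\<^sup>2)) * (G \<xi> + H \<xi>)) \<partial>lborel) 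
      = (\<integral>\<xi>. cos (x \<bullet> \<xi>) * (exp (-(d * (norm \<xi>)\<^sup>2)) * G \<xi>) \<partial>lborel)
      + (\<integral>\<xi>. cos (x \<bullet> \<xi>) * (exp (-(d * (norm \<xi>)\<^sup>2)) * H \<xi>) \<partial>lborel)" if "0 < d" for x d
    unfolding distrib_left
    by (intro Bochner_Integration.integral_add integrable_cos_mult integrable_gaussian_mult[OF that _ B] integrable_gaussian_mult[OF that _ B']) auto
  ultimately show ?thesis using assms unfolding pos_def_sym_def
    by (auto intro!: exI[of _ "B + B'"])
qed

lemma pos_def_sym_sum: 
  assumes "\<And>i. i \<in> I \<Longrightarrow> pos_def_sym (G i)" shows "pos_def_sym (\<lambda>\<xi>. \<Sum>i\<in>I. G i \<xi>)"
  using assms by (induction I rule: infinite_finite_induct) (auto intro: pos_def_sym_const pos_def_sym_add)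

text \<open>The Laplace transform of the density \<open>w\<close> at the squared norm, a
  superposition of Gaussians.\<close>

definition gauss_mix :: "(real \<Rightarrow> real) \<Rightarrow> 'a::euclidean_space \<Rightarrow> real" where
  "gauss_mix w \<xi> = (\<integral>s. w s * exp (-(s * (norm \<xi>)\<^sup>2)) \<partial>lborel)"

context
  fixes w :: "real \<Rightarrow> real"
  assumes w: "integrable lborel w" "\<And>s. 0 \<le> w s" "\<And>s. s < 0 \<Longrightarrow> w s = 0"
begin

lemma gauss_mix_integrand_le: "\<bar>w s * exp (-(s * (norm \<xi>)\<^sup>2))\<bar> \<le> w s"
proof (cases "s < 0")
  case False
  then show ?thesis using w(2)[of s] by (simp add: abs_mult mult_left_le)
qed (simp add: w)

lemma gauss_mix_integrable: "integrable lborel (\<lambda>s. w s * exp (-(s * (norm \<xi>)\<^sup>2)))"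
  using gauss_mix_integrand_le w(1) borel_measurable_integrable[OF w(1)]
  by (intro Bochner_Integration.integrable_bound[OF w(1)]) (auto simp: w intro!: AE_I2)

lemma gauss_mix_bounds: "0 \<le> gauss_mix w \<xi>" "gauss_mix w \<xi> \<le> (\<integral>s. w s \<partial>lborel)"
proof -
  show "0 \<le> gauss_mix w \<xi>" unfolding gauss_mix_def by (rule integral_nonneg_AE) (simp add: w)
  show "gauss_mix w \<xi> \<le> (\<integral>s. w s \<partial>lborel)" unfolding gauss_mix_def
    by (intro integral_mono gauss_mix_integrable w(1)) (use gauss_mix_integrand_le abs_le_D1 in blast)
qed

lemma gauss_mix_measurable: "gauss_mix w \<in> borel_measurable borel"
proof -
  have [measurable]: "w \<in> borel_measurable borel" using w by auto
  show ?thesis unfolding gauss_mix_def by measurable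
qed

text \<open>By Fubini the weight \<open>w s\<close> comes outside, and what is left is
  \<open>G\<close> tested against the Gaussian with parameter d + s. By iteration, powers of a
  mixture stay in the class.\<close>

lemma pos_def_sym_gauss_mix:
  fixes G :: "'a::euclidean_space \<Rightarrow> real"
  assumes P: "pos_def_sym G"
  shows "pos_def_sym (\<lambda>\<xi>. gauss_mix w \<xi> * G \<xi>)"
proof -
  obtain B where B: "\<And>\<xi>. \<bar>G \<xi>\<bar> \<le> B" using P by (auto simp: pos_def_sym_def)
  have Gm[measurable]: "G \<in> borel_measurable borel" using P by (auto simp: pos_def_sym_def)
  have wm[measurable]: "w \<in> borel_measurable borel" using w by auto
  have "\<bar>gauss_mix w \<xi> * G \<xi>\<bar> \<le> (\<integral>s. w s \<partial>lborel) * B" for \<xi>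
    unfolding abs_mult using gauss_mix_bounds[of \<xi>] B[of \<xi>] by (intro mult_mono) auto
  moreover have "0 \<le> (\<integral>\<xi>. cos (x \<bullet> \<xi>) * (exp (-(d * (norm \<xi>)\<^sup>2)) * (gauss_mix w \<xi> * G \<xi>)) \<partial>lborel)" if d: "0 < d" for x d
  proof -
    define F where "F = (\<lambda>\<xi> s. cos (x \<bullet> \<xi>) * (exp (-(d * (norm \<xi>)\<^sup>2)) * G \<xi>) * (w s * exp (-(s * (norm \<xi>)\<^sup>2))))"
    have Fi: "integrable (lborel \<Otimes>\<^sub>M lborel) (\<lambda>(\<xi>, s). F \<xi> s)"
    proof (rule Bochner_Integration.integrable_bound)
      show "integrable (lborel \<Otimes>\<^sub>M lborel) (\<lambda>(\<xi>::'a, s). (exp (-(d * (norm \<xi>)\<^sup>2)) * B) * w s)"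
        by (intro integrable_lborel_product integrable_mult_left integrable_gaussian d w)
      show "(\<lambda>(\<xi>, s). F \<xi> s) \<in> borel_measurable (lborel \<Otimes>\<^sub>M lborel)" unfolding F_def by measurable
      show "AE p in lborel \<Otimes>\<^sub>M lborel. norm (case p of (\<xi>, s) \<Rightarrow> F \<xi> s) \<le> norm (case p of (\<xi>::'a, s) \<Rightarrow> (exp (-(d * (norm \<xi>)\<^sup>2)) * B) * w s)"
      proof (intro AE_I2, clarify)
        fix \<xi> s
        have "\<bar>cos (x \<bullet> \<xi>)\<bar> * (exp (-(d * (norm \<xi>)\<^sup>2)) * \<bar>G \<xi>\<bar>) * \<bar>w s * exp (-(s * (norm \<xi>)\<^sup>2))\<bar> \<le> 1 * (exp (-(d * (norm \<xi>)\<^sup>2)) * B) * w s"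
          by (intro mult_mono B gauss_mix_integrand_le) (use B[of \<xi>] in auto)
        then have "\<bar>F \<xi> s\<bar> \<le> (exp (-(d * (norm \<xi>)\<^sup>2)) * B) * w s"
          by (simp add: F_def abs_mult)
        then show "norm (F \<xi> s) \<le> norm ((exp (-(d * (norm \<xi>)\<^sup>2)) * B) * w s)" by simp
      qed
    qed
    have "(\<integral>\<xi>. cos (x \<bullet> \<xi>) * (exp (-(d * (norm \<xi>)\<^sup>2)) * (gauss_mix w \<xi> * G \<xi>)) \<partial>lborel)
       = (\<integral>\<xi>. (\<integral>s. F \<xi> s \<partial>lborel) \<partial>lborel)"
      by (intro Bochner_Integration.integral_cong refl) (simp add: F_def gauss_mix_def)
    also have "\<dots> = (\<integral>s. (\<integral>\<xi>. F \<xi> s \<partial>lborel) \<partial>lborel)"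
      by (rule lborel_pair.Fubini_integral[OF Fi, symmetric])
    also have "0 \<le> \<dots>"
    proof (rule integral_nonneg_AE, intro AE_I2)
      fix s
      have "F \<xi> s = w s * (cos (x \<bullet> \<xi>) * (exp (-((d + s) * (norm \<xi>)\<^sup>2)) * G \<xi>))" for \<xi>
        by (simp add: F_def mult_ac distrib_right exp_diff exp_minus exp_add divide_inverse)
      then have "(\<integral>\<xi>. F \<xi> s \<partial>lborel) = w s * (\<integral>\<xi>. cos (x \<bullet> \<xi>) * (exp (-((d + s) * (norm \<xi>)\<^sup>2)) * G \<xi>) \<partial>lborel)"
        by simp
      also have "0 \<le> \<dots>"
      proof (cases "s < 0")
        case False
        then have "0 < d + s" using d by simp
        then show ?thesis using P w(2)[of s] by (simp add: pos_def_sym_def)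
      qed (simp add: w)
      finally show "0 \<le> (\<integral>\<xi>. F \<xi> s \<partial>lborel)" .
    qed
    finally show ?thesis .
  qed
  moreover have "(\<lambda>\<xi>. gauss_mix w \<xi> * G \<xi>) \<in> borel_measurable borel"
    using gauss_mix_measurable Gm by (intro borel_measurable_times)
  ultimately show ?thesis unfolding pos_def_sym_def by blast
qed

text \<open>The partial sums of the exponential series are nonnegative combinations of powers of the
  mixture, and all lie between 0 and exp of the total mass of \<open>w\<close>, the uniform bound
  that the passage to the limit demands.\<close>

lemma pos_def_sym_exp_gauss_mix: "pos_def_sym (\<lambda>\<xi>::'a::euclidean_space. exp (gauss_mix w \<xi>))"
proof -
  have pw: "pos_def_sym (\<lambda>\<xi>::'a. gauss_mix w \<xi> ^ j)" for j
  proof (induction j)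
    case (Suc j)
    from pos_def_sym_gauss_mix[OF this] show ?case by simp
  qed (simp add: pos_def_sym_const)
  show ?thesis
  proof (rule pos_def_sym_LIMSEQ)
    show "pos_def_sym (\<lambda>\<xi>::'a. \<Sum>j<k. gauss_mix w \<xi> ^ j /\<^sub>R fact j)" for k
      unfolding real_scaleR_def by (intro pos_def_sym_sum pos_def_sym_cmult pw) simp
    show "\<bar>\<Sum>j<k. gauss_mix w \<xi> ^ j /\<^sub>R fact j\<bar> \<le> exp (\<integral>s. w s \<partial>lborel)" for k and \<xi> :: 'a
    proof -
      have "(\<Sum>j<k. gauss_mix w \<xi> ^ j /\<^sub>R fact j) \<le> exp (gauss_mix w \<xi>)" unfolding exp_def
        by (rule sum_le_suminf[OF summable_exp_generic]) (auto intro!: gauss_mix_bounds mult_nonneg_nonneg zero_le_power)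
      also have "\<dots> \<le> exp (\<integral>s. w s \<partial>lborel)" using gauss_mix_bounds by simp
      finally show ?thesis using gauss_mix_bounds(1)[of \<xi>] by (subst abs_of_nonneg) (auto intro: sum_nonneg)
    qed
    show "(\<lambda>k. \<Sum>j<k. gauss_mix w \<xi> ^ j /\<^sub>R fact j) \<longlonglongrightarrow> exp (gauss_mix w \<xi>)" for \<xi> :: 'a
      using exp_converges[of "gauss_mix w \<xi>"] by (simp add: sums_def)
  qed
qed

end

section \<open>The fractional heat kernel\<close>

lemma integrable_lborel_indicator_of_integrable_on:
  fixes f :: "real \<Rightarrow> real"
  assumes f: "f integrable_on S" and nn: "\<And>x. x \<in> S \<Longrightarrow> 0 \<le> f x"
    and [measurable]: "f \<in> borel_measurable borel" "S \<in> sets borel"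
  shows "integrable lborel (\<lambda>x. indicator S x * f x)"
proof -
  have "f absolutely_integrable_on S" by (rule nonnegative_absolutely_integrable_1[OF f nn])
  then have "integrable lebesgue (\<lambda>x. indicator S x * f x)" by (simp add: set_integrable_def)
  then show ?thesis by (subst (asm) integrable_completion) auto
qed

text \<open>The integrand in the Bernstein representation of r^a: 1 - exp (-s r) against the Levy
  density s^(-1-a) of the a-stable subordinator. It is used with r = |\<xi>|^2 and a = \<beta> /
  2.\<close>

definition levy_density :: "real \<Rightarrow> real \<Rightarrow> real \<Rightarrow> real" where
  "levy_density a r s = (if 0 < s then (1 - exp (-(s * r))) * s powr (-1-a) else 0)"

lemma levy_density_measurable [measurable]: "levy_density a r \<in> borel_measurable borel"
  unfolding levy_density_def by measurable

lemma levy_density_nonneg: "0 \<le> r \<Longrightarrow> 0 \<le> levy_density a r s"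
  by (auto simp: levy_density_def)

text \<open>At 0 the factor 1 - exp (-s) \<le> s improves the singularity to s^(-a), integrable
  since a < 1; at infinity s^(-1-a) is integrable since a > 0.\<close>

lemma integrable_levy_density_1:
  assumes a: "0 < a" "a < 1" shows "integrable lborel (levy_density a 1)"
proof (rule Bochner_Integration.integrable_bound)
  have "integrable lborel (\<lambda>s. indicator {0..1} s * s powr (-a))"
    by (rule integrable_lborel_indicator_of_integrable_on) (use a integrable_on_powr_from_0[of "-a" 1] in auto)
  moreover have "integrable lborel (\<lambda>s. indicator {1..} s * s powr (-1-a))"
    by (rule integrable_lborel_indicator_of_integrable_on)
       (use a has_integral_powr_to_inf[of "-1-a" 1] in \<open>auto simp: has_integral_integrable_integral\<close>)
  ultimately show "integrable lborel (\<lambda>s::real. indicator {0..1} s * s powr (-a) + indicator {1..} s * s powr (-1-a))"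
    by (rule Bochner_Integration.integrable_add)
  show "AE s in lborel. norm (levy_density a 1 s) \<le> norm (indicator {0..1} s * s powr (-a) + indicator {1..} s * s powr (-1-a))"
  proof (rule AE_I2)
    fix s :: real
    have nn: "0 \<le> indicator {0..1} s * s powr (-a)" "0 \<le> indicator {1..} s * s powr (-1-a)" by auto
    have "levy_density a 1 s \<le> indicator {0..1} s * s powr (-a) + indicator {1..} s * s powr (-1-a)"
    proof (cases "0 < s")
      case s: True
      show ?thesis
      proof (cases "s \<le> 1")
        case True
        have "1 - exp (-s) \<le> s" using exp_ge_add_one_self[of "-s"] by simp
        then have "levy_density a 1 s \<le> s * s powr (-1-a)"
          using s by (simp add: levy_density_def mult_right_mono)
        also have "s * s powr (-1-a) = s powr (-a)"
          using s powr_add[of s 1 "-1-a"] by simp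
        also have "\<dots> = indicator {0..1} s * s powr (-a)" using s True by simp
        finally show ?thesis using nn by linarith
      next
        case False
        have "levy_density a 1 s \<le> 1 * s powr (-1-a)"
          using s by (simp add: levy_density_def mult_right_mono)
        also have "\<dots> = indicator {1..} s * s powr (-1-a)" using False by simp
        finally show ?thesis using nn by linarith
      qed
    qed (use nn in \<open>simp add: levy_density_def\<close>)
    then show "norm (levy_density a 1 s) \<le> norm (indicator {0..1} s * s powr (-a) + indicator {1..} s * s powr (-1-a))"
      using nn levy_density_nonneg[of 1 a s] by simp
  qed
qed measurable

text \<open>This integral is the normalising constant by which \<open>pos_def_sym_stable\<close>
  divides.\<close>

lemma integral_levy_density_1_pos:
  assumes a: "0 < a" "a < 1" shows "0 < (\<integral>s. levy_density a 1 s \<partial>lborel)"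
proof -
  have nn: "0 \<le> (\<integral>s. levy_density a 1 s \<partial>lborel)"
    by (rule integral_nonneg_AE) (simp add: levy_density_nonneg)
  have "(\<integral>s. levy_density a 1 s \<partial>lborel) \<noteq> 0"
  proof
    assume "(\<integral>s. levy_density a 1 s \<partial>lborel) = 0"
    then have "AE s in lborel. levy_density a 1 s = 0"
      using integral_nonneg_eq_0_iff_AE[OF integrable_levy_density_1[OF a]] by (simp add: levy_density_nonneg)
    then have "AE s in lborel. s \<notin> {1..2::real}"
      by eventually_elim (auto simp: levy_density_def)
    then have "emeasure lborel {1..2::real} = 0"
      by (subst (asm) AE_iff_measurable[of "{1..2::real}"]) auto
    then show False by simp
  qed
  with nn show ?thesis by simp
qed

text \<open>Under s -> r s the power s^(-1-a) contributes r^(1+a) and the Jacobian 1 / r.\<close>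

lemma levy_density_scale:
  assumes a: "0 < a" "a < 1" and r: "0 < r"
  shows "integrable lborel (levy_density a r)"
    and "(\<integral>s. levy_density a r s \<partial>lborel) = r powr a * (\<integral>s. levy_density a 1 s \<partial>lborel)"
proof -
  have eq: "levy_density a r s = r powr (1 + a) * levy_density a 1 (0 + r *\<^sub>R s)" for s
    using r by (auto simp: levy_density_def powr_mult zero_less_mult_iff mult.commute powr_add[symmetric])
  show "integrable lborel (levy_density a r)"
    unfolding eq by (intro integrable_mult_right integrable_lborel_affine integrable_levy_density_1 a) (use r in auto)
  have "(\<integral>s. levy_density a 1 s \<partial>lborel) = r * (\<integral>s. levy_density a 1 (0 + r *\<^sub>R s) \<partial>lborel)"
    using r by (subst integral_lborel_affine[of _ r 0]) auto
  then show "(\<integral>s. levy_density a r s \<partial>lborel) = r powr a * (\<integral>s. levy_density a 1 s \<partial>lborel)"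
    unfolding eq using r by (simp add: powr_add)
qed

lemma pos_def_sym_stable:
  assumes t: "0 < t" and b: "0 < \<beta>" "\<beta> < 2"
  shows "pos_def_sym (\<lambda>\<xi>::'a::euclidean_space. exp (-(t * norm \<xi> powr \<beta>)))"
proof -
  define a where "a = \<beta> / 2"
  have a: "0 < a" "a < 1" using b by (auto simp: a_def)
  define c where "c = (\<integral>s. levy_density a 1 s \<partial>lborel)"
  have c: "0 < c" unfolding c_def by (rule integral_levy_density_1_pos[OF a])
  \<comment> \<open>Staying away from 0 makes the weights integrable, as s^(-1-a) has infinite mass
    there. The intervals exhaust the positive half-line.\<close>
  define I where "I k = {1 / real (Suc k) .. real (Suc k)}" for k
  define w where "w k s = (t / c) * (indicator (I k) s * s powr (-1-a))" for k s
  have Ipos: "s \<in> I k \<Longrightarrow> 0 < s" for s k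
    unfolding I_def by (rule less_le_trans[of 0 "1 / real (Suc k)"]) auto
  have wi: "integrable lborel (w k)" for k
    unfolding w_def
  proof (rule integrable_mult_right, rule Bochner_Integration.integrable_bound[where f="\<lambda>s. indicator (I k) s * (1 / real (Suc k)) powr (-1-a)"])
    show "integrable lborel (\<lambda>s. indicator (I k) s * (1 / real (Suc k)) powr (-1 - a))"
      by (intro integrable_mult_left integrable_real_indicator) (auto simp: I_def emeasure_lborel_Icc_eq)
    show "(\<lambda>s. indicator (I k) s * s powr (-1 - a)) \<in> borel_measurable lborel" unfolding I_def by measurable
    show "AE s in lborel. norm (indicator (I k) s * s powr (-1-a)) \<le> norm (indicator (I k) s * (1 / real (Suc k)) powr (-1-a))"
    proof (rule AE_I2)
      fix s
      have "s powr (-1-a) \<le> (1 / real (Suc k)) powr (-1-a)" if "s \<in> I k"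
        by (rule powr_mono2') (use that a in \<open>auto simp: I_def\<close>)
      then show "norm (indicator (I k) s * s powr (-1-a)) \<le> norm (indicator (I k) s * (1 / real (Suc k)) powr (-1-a))"
        by (auto simp: indicator_def)
    qed
  qed
  have w0: "0 \<le> w k s" for k s using t c by (auto simp: w_def)
  have wneg: "s < 0 \<Longrightarrow> w k s = 0" for k s using Ipos[of s k] by (auto simp: w_def indicator_def)
  note W = wi w0 wneg
  \<comment> \<open>The value at 0 of the mixture is the total mass of its weight, so this is g(0) -
    g(\<xi>), written as a truncated Levy integral.\<close>
  have diff: "(\<integral>s. w k s \<partial>lborel) - gauss_mix (w k) \<xi> = (t / c) * (\<integral>s. indicator (I k) s * levy_density a ((norm \<xi>)\<^sup>2) s \<partial>lborel)" 
    for k and \<xi> :: 'a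
  proof -
    have gi: "integrable lborel (\<lambda>s. w k s * exp (-(s * (norm \<xi>)\<^sup>2)))"
      by (rule gauss_mix_integrable) (fact W)+
    have "(\<integral>s. w k s \<partial>lborel) - gauss_mix (w k) \<xi> = (\<integral>s. w k s - w k s * exp (-(s * (norm \<xi>)\<^sup>2)) \<partial>lborel)"
      unfolding gauss_mix_def using wi gi by (rule Bochner_Integration.integral_diff[symmetric])
    also have "\<dots> = (\<integral>s. (t / c) * (indicator (I k) s * levy_density a ((norm \<xi>)\<^sup>2) s) \<partial>lborel)"
      using Ipos[of _ k] by (intro Bochner_Integration.integral_cong refl)
        (auto simp: w_def levy_density_def indicator_def algebra_simps diff_divide_distrib)
    finally show ?thesis by simp
  qed
  show ?thesis
  proof (rule pos_def_sym_LIMSEQ)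
    show "pos_def_sym (\<lambda>\<xi>::'a. exp (-(\<integral>s. w k s \<partial>lborel)) * exp (gauss_mix (w k) \<xi>))" for k
      by (intro pos_def_sym_cmult pos_def_sym_exp_gauss_mix W) simp
    \<comment> \<open>A mixture is largest at the origin, where it equals the total mass of its
      weight.\<close>
    show "\<bar>exp (-(\<integral>s. w k s \<partial>lborel)) * exp (gauss_mix (w k) \<xi>)\<bar> \<le> 1" for k and \<xi> :: 'a
      using gauss_mix_bounds(2)[OF W, of k \<xi>] by (simp add: exp_add[symmetric])
    show "(\<lambda>k. exp (-(\<integral>s. w k s \<partial>lborel)) * exp (gauss_mix (w k) \<xi>)) \<longlonglongrightarrow> exp (-(t * norm \<xi> powr \<beta>))" for \<xi> :: 'a
    proof -
      let ?r = "(norm \<xi>)\<^sup>2"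
      have "(\<lambda>k. \<integral>s. indicator (I k) s * levy_density a ?r s \<partial>lborel) \<longlonglongrightarrow> norm \<xi> powr \<beta> * c"
      proof (cases "\<xi> = 0")
        case True
        have "levy_density a 0 s = 0" for s by (simp add: levy_density_def)
        then show ?thesis using True by simp
      next
        case False
        then have r: "0 < ?r" by simp
        have "(\<lambda>k. \<integral>s. indicator (I k) s * levy_density a ?r s \<partial>lborel) \<longlonglongrightarrow> (\<integral>s. levy_density a ?r s \<partial>lborel)"
        proof (rule integral_dominated_convergence[where w="levy_density a ?r"])
          show "integrable lborel (levy_density a ?r)" by (rule levy_density_scale[OF a r])
          show "AE s in lborel. norm (indicator (I k) s * levy_density a ?r s) \<le> levy_density a ?r s" for k
            by (auto simp: indicator_def levy_density_nonneg)
          show "AE s in lborel. (\<lambda>k. indicator (I k) s * levy_density a ?r s) \<longlonglongrightarrow> levy_density a ?r s"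
          proof (rule AE_I2)
            fix s :: real
            show "(\<lambda>k. indicator (I k) s * levy_density a ?r s) \<longlonglongrightarrow> levy_density a ?r s"
            proof (cases "0 < s")
              case True
              obtain N :: nat where N: "max s (1 / s) \<le> real N" using real_arch_simple by blast
              have "s \<in> I k" if "N \<le> k" for k
              proof -
                have "max s (1/s) \<le> real (Suc k)" using N that by linarith
                then show ?thesis using True by (simp add: I_def field_simps)
              qed
              then have "eventually (\<lambda>k. indicator (I k) s * levy_density a ?r s = levy_density a ?r s) sequentially"
                by (auto simp: eventually_sequentially intro!: exI[of _ N])
              then show ?thesis by (rule tendsto_eventually)
            qed (simp add: levy_density_def)
          qed
        qed (auto simp: I_def)
        also have "(\<integral>s. levy_density a ?r s \<partial>lborel) = ?r powr a * c"
          unfolding c_def by (rule levy_density_scale[OF a r])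
        also have "?r powr a = norm \<xi> powr \<beta>"
          using False by (simp add: a_def powr_powr powr_numeral[symmetric] del: powr_numeral)
        finally show ?thesis .
      qed
      then have "(\<lambda>k. (t / c) * (\<integral>s. indicator (I k) s * levy_density a ?r s \<partial>lborel)) \<longlonglongrightarrow> (t / c) * (norm \<xi> powr \<beta> * c)"
        by (intro tendsto_intros)
      then have "(\<lambda>k. exp (-((\<integral>s. w k s \<partial>lborel) - gauss_mix (w k) \<xi>))) \<longlonglongrightarrow> exp (-((t / c) * (norm \<xi> powr \<beta> * c)))"
        unfolding diff by (intro tendsto_exp tendsto_minus)
      moreover have "(t / c) * (norm \<xi> powr \<beta> * c) = t * norm \<xi> powr \<beta>" using c by simp
      moreover have "exp (-((\<integral>s. w k s \<partial>lborel) - gauss_mix (w k) \<xi>)) = exp (-(\<integral>s. w k s \<partial>lborel)) * exp (gauss_mix (w k) \<xi>)" for k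
        by (simp add: exp_add[symmetric])
      ultimately show ?thesis by (simp only:)
    qed
  qed
qed

section \<open>Sign, scaling, size and mass of the kernel\<close>

lemma frac_heat_kernel_lborel:
  "frac_heat_kernel \<beta> t (x::'a::euclidean_space) =
     Re (\<integral>\<xi>. exp (\<i> * complex_of_real (x \<bullet> \<xi>) - complex_of_real (t * norm \<xi> powr \<beta>)) \<partial>lborel)
       / (2 * pi) ^ DIM('a)"
  unfolding frac_heat_kernel_def by (subst integral_completion) auto

lemma frac_heat_kernel_measurable [measurable]:
  "(\<lambda>(t, x). frac_heat_kernel \<beta> t (x::'a::euclidean_space)) \<in> borel_measurable (borel \<Otimes>\<^sub>M borel)"
  unfolding frac_heat_kernel_lborel by measurable

lemma frac_heat_kernel_cos:
  assumes "0 < t" "0 < \<beta>"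
  shows "frac_heat_kernel \<beta> t (x::'a::euclidean_space) =
     (\<integral>\<xi>. cos (x \<bullet> \<xi>) * exp (-(t * norm \<xi> powr \<beta>)) \<partial>lborel) / (2 * pi) ^ DIM('a)"
proof -
  have "integrable lborel (\<lambda>\<xi>::'a. exp (\<i> * complex_of_real (x \<bullet> \<xi>) - complex_of_real (t * norm \<xi> powr \<beta>)))"
    by (rule Bochner_Integration.integrable_bound[OF integrable_exp_powr[OF assms]]) auto
  from integral_Re[OF this] show ?thesis
    unfolding frac_heat_kernel_lborel by (simp add: Re_exp mult.commute)
qed

text \<open>Positive definiteness speaks of Gaussian-damped integrals. The damping is removed by
  dominated convergence, with the stable exponential as its own integrable majorant.\<close>

lemma frac_heat_kernel_nonneg:
  assumes t: "0 < t" and b: "0 < \<beta>" "\<beta> < 2"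
  shows "0 \<le> frac_heat_kernel \<beta> t (x::'a::euclidean_space)"
proof -
  let ?g = "\<lambda>\<xi>::'a. exp (-(t * norm \<xi> powr \<beta>))"
  have "0 \<le> (\<integral>\<xi>. cos (x \<bullet> \<xi>) * ?g \<xi> \<partial>lborel)"
  proof (rule LIMSEQ_le_const)
    show "(\<lambda>k. \<integral>\<xi>. cos (x \<bullet> \<xi>) * (exp (-(inverse (real (Suc k)) * (norm \<xi>)\<^sup>2)) * ?g \<xi>) \<partial>lborel)
         \<longlonglongrightarrow> (\<integral>\<xi>. cos (x \<bullet> \<xi>) * ?g \<xi> \<partial>lborel)"
    proof (rule integral_dominated_convergence[where w="?g"])
      show "AE \<xi> in lborel. norm (cos (x \<bullet> \<xi>) * (exp (-(inverse (real (Suc k)) * (norm \<xi>)\<^sup>2)) * ?g \<xi>)) \<le> ?g \<xi>" for k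
      proof (rule AE_I2)
        fix \<xi> :: 'a
        have "\<bar>cos (x \<bullet> \<xi>)\<bar> * (exp (-(inverse (real (Suc k)) * (norm \<xi>)\<^sup>2)) * ?g \<xi>) \<le> 1 * (1 * ?g \<xi>)"
          by (intro mult_mono) auto
        then show "norm (cos (x \<bullet> \<xi>) * (exp (-(inverse (real (Suc k)) * (norm \<xi>)\<^sup>2)) * ?g \<xi>)) \<le> ?g \<xi>"
          by (simp add: abs_mult)
      qed
      show "AE \<xi> in lborel. (\<lambda>k. cos (x \<bullet> \<xi>) * (exp (-(inverse (real (Suc k)) * (norm \<xi>)\<^sup>2)) * ?g \<xi>))
          \<longlonglongrightarrow> cos (x \<bullet> \<xi>) * ?g \<xi>"
      proof (rule AE_I2)
        fix \<xi> :: 'a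
        have "(\<lambda>k. cos (x \<bullet> \<xi>) * (exp (-(inverse (real (Suc k)) * (norm \<xi>)\<^sup>2)) * ?g \<xi>))
          \<longlonglongrightarrow> cos (x \<bullet> \<xi>) * (exp (-(0 * (norm \<xi>)\<^sup>2)) * ?g \<xi>)"
          by (intro tendsto_mult tendsto_const tendsto_exp tendsto_minus LIMSEQ_inverse_real_of_nat)
        then show "(\<lambda>k. cos (x \<bullet> \<xi>) * (exp (-(inverse (real (Suc k)) * (norm \<xi>)\<^sup>2)) * ?g \<xi>))
          \<longlonglongrightarrow> cos (x \<bullet> \<xi>) * ?g \<xi>" by simp
      qed
      show "integrable lborel ?g" by (rule integrable_exp_powr[OF t b(1)])
    qed measurable
    have "0 < inverse (real (Suc k))" for k by simp
    then show "\<exists>N. \<forall>k\<ge>N. 0 \<le> (\<integral>\<xi>. cos (x \<bullet> \<xi>) * (exp (-(inverse (real (Suc k)) * (norm \<xi>)\<^sup>2)) * ?g \<xi>) \<partial>lborel)"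
      using pos_def_sym_stable[OF t b, where 'a='a] unfolding pos_def_sym_def by blast
  qed
  then show ?thesis unfolding frac_heat_kernel_cos[OF t b(1)] by simp
qed

text \<open>The substitution \<xi> -> t^(-1/\<beta>) \<xi> removes t from the exponent; its Jacobian
  is the prefactor.\<close>

lemma frac_heat_kernel_scale:
  assumes t: "0 < t" and b: "0 < \<beta>"
  shows "frac_heat_kernel \<beta> t (x::'a::euclidean_space) =
     t powr (-(real DIM('a) / \<beta>)) * frac_heat_kernel \<beta> 1 (t powr (-(1 / \<beta>)) *\<^sub>R x)"
proof -
  define c where "c = t powr (-(1 / \<beta>))"
  have c: "0 < c" using t by (simp add: c_def)
  have "c powr \<beta> = t powr (-1)" using b t by (simp add: c_def powr_powr)
  then have cb: "c powr \<beta> = inverse t" using t by (simp add: powr_minus)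
  have cn: "c ^ DIM('a) = t powr (-(real DIM('a) / \<beta>))"
    using c t by (simp add: c_def powr_realpow[symmetric] powr_powr)
  have "(\<integral>\<xi>. cos (x \<bullet> \<xi>) * exp (-(t * norm \<xi> powr \<beta>)) \<partial>lborel) =
     c ^ DIM('a) * (\<integral>\<xi>. cos (x \<bullet> (c *\<^sub>R \<xi>)) * exp (-(t * norm (c *\<^sub>R \<xi>) powr \<beta>)) \<partial>lborel)"
    using c by (subst integral_lborel_affine[of _ c 0]) auto
  also have "(\<lambda>\<xi>. cos (x \<bullet> (c *\<^sub>R \<xi>)) * exp (-(t * norm (c *\<^sub>R \<xi>) powr \<beta>)))
      = (\<lambda>\<xi>. cos ((c *\<^sub>R x) \<bullet> \<xi>) * exp (-(1 * norm \<xi> powr \<beta>)))"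
    using c t by (auto simp: powr_mult cb)
  finally show ?thesis
    unfolding frac_heat_kernel_cos[OF t b] frac_heat_kernel_cos[OF zero_less_one b] c_def[symmetric] cn by simp
qed

text \<open>Because |cos| \<le> 1 the integral is largest at x = 0; scaling then gives the rate
  t^(-n/\<beta>), the source of the smoothing estimates.\<close>

lemma frac_heat_kernel_le:
  assumes t: "0 < t" and b: "0 < \<beta>"
  shows "\<bar>frac_heat_kernel \<beta> t (x::'a::euclidean_space)\<bar> \<le> t powr (-(real DIM('a) / \<beta>)) * frac_heat_kernel \<beta> 1 (0::'a)"
proof -
  have "\<bar>frac_heat_kernel \<beta> 1 (y::'a)\<bar> \<le> frac_heat_kernel \<beta> 1 (0::'a)" for y
  proof -
    let ?g = "\<lambda>\<xi>::'a. exp (-(1 * norm \<xi> powr \<beta>))"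
    have i: "integrable lborel ?g" by (rule integrable_exp_powr[OF _ b]) simp
    have "\<bar>\<integral>\<xi>. cos (y \<bullet> \<xi>) * ?g \<xi> \<partial>lborel\<bar> \<le> (\<integral>\<xi>. norm (cos (y \<bullet> \<xi>) * ?g \<xi>) \<partial>lborel)"
      using integral_norm_bound[of lborel "\<lambda>\<xi>. cos (y \<bullet> \<xi>) * ?g \<xi>"] by simp
    also have "\<dots> \<le> (\<integral>\<xi>. ?g \<xi> \<partial>lborel)"
      by (intro integral_mono integrable_norm integrable_cos_mult i) (auto simp: abs_mult)
    finally show ?thesis
      unfolding frac_heat_kernel_cos[OF zero_less_one b] by (simp add: divide_right_mono)
  qed
  then show ?thesis unfolding frac_heat_kernel_scale[OF t b]
    by (simp add: abs_mult mult_left_mono)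
qed

text \<open>Fubini's theorem moves the Gaussian to the frequency side, where it concentrates at 0 as
  d -> 0. The substitution by \<open>sqrt (4 * d)\<close> undoes this concentration, so that d
  survives only inside the stable exponential, which tends to 1.\<close>

lemma frac_heat_kernel_gaussian_integral:
  assumes t: "0 < t" and b: "0 < \<beta>" and d: "0 < d"
  shows "integrable lborel (\<lambda>x::'a::euclidean_space. frac_heat_kernel \<beta> t x * exp (-(d * (norm x)\<^sup>2)))"
    and "(\<integral>x. frac_heat_kernel \<beta> t (x::'a) * exp (-(d * (norm x)\<^sup>2)) \<partial>lborel)
      = (1 / sqrt pi ^ DIM('a)) * (\<integral>\<xi>. exp (-(t * norm (sqrt (4 * d) *\<^sub>R (\<xi>::'a)) powr \<beta>)) * exp (-(norm \<xi>)\<^sup>2) \<partial>lborel)"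
proof -
  let ?n = "DIM('a)"
  let ?K = "frac_heat_kernel \<beta> t :: 'a \<Rightarrow> real"
  let ?g = "\<lambda>\<xi>::'a. exp (-(t * norm \<xi> powr \<beta>))" and ?e = "\<lambda>x::'a. exp (-(d * (norm x)\<^sup>2))"
  have gi: "integrable lborel ?g" by (rule integrable_exp_powr[OF t b])
  have ei: "integrable lborel ?e" by (rule integrable_gaussian[OF d])
  have [measurable]: "frac_heat_kernel \<beta> t \<in> borel_measurable (borel :: 'a measure)"
    using measurable_compose[OF measurable_Pair1' frac_heat_kernel_measurable, of t] by simp
  show "integrable lborel (\<lambda>x::'a. frac_heat_kernel \<beta> t x * ?e x)"
  proof (rule Bochner_Integration.integrable_bound[OF integrable_mult_right[OF ei, of "t powr (-(real DIM('a) / \<beta>)) * frac_heat_kernel \<beta> 1 (0::'a)"]])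
    show "AE x in lborel. norm (frac_heat_kernel \<beta> t x * ?e x) \<le> norm (t powr (-(real DIM('a) / \<beta>)) * frac_heat_kernel \<beta> 1 (0::'a) * ?e x)"
    proof (rule AE_I2)
      fix x :: 'a
      have "\<bar>?K x\<bar> \<le> \<bar>t powr (-(real DIM('a) / \<beta>)) * frac_heat_kernel \<beta> 1 (0::'a)\<bar>"
        by (rule order_trans[OF frac_heat_kernel_le[OF t b] abs_ge_self])
      then show "norm (?K x * ?e x) \<le> norm (t powr (-(real DIM('a) / \<beta>)) * frac_heat_kernel \<beta> 1 (0::'a) * ?e x)"
        unfolding real_norm_def abs_mult[of _ "?e x"] by (rule mult_right_mono) simp
    qed
  qed measurable
  define F where "F = (\<lambda>x \<xi>::'a. cos (x \<bullet> \<xi>) * (?e x * ?g \<xi>))"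
  have Fi: "integrable (lborel \<Otimes>\<^sub>M lborel) (\<lambda>(x, \<xi>). F x \<xi>)"
    by (rule Bochner_Integration.integrable_bound[OF integrable_lborel_product[OF ei gi]])
       (auto simp: F_def abs_mult mult_left_le_one_le)
  have "(\<integral>x. frac_heat_kernel \<beta> t x * ?e x \<partial>lborel) = (\<integral>x. (\<integral>\<xi>. F x \<xi> \<partial>lborel) \<partial>lborel) / (2 * pi) ^ ?n"
  proof -
    have "F x \<xi> = ?e x * (cos (x \<bullet> \<xi>) * ?g \<xi>)" for x \<xi> by (simp add: F_def)
    then have "(\<integral>\<xi>. F x \<xi> \<partial>lborel) = ?e x * (\<integral>\<xi>. cos (x \<bullet> \<xi>) * ?g \<xi> \<partial>lborel)" for x by simp
    then show ?thesis unfolding frac_heat_kernel_cos[OF t b]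
      by (subst integral_divide_zero[symmetric]) (simp add: mult.commute)
  qed
  also have "(\<integral>x. (\<integral>\<xi>. F x \<xi> \<partial>lborel) \<partial>lborel) = (\<integral>\<xi>. (\<integral>x. F x \<xi> \<partial>lborel) \<partial>lborel)"
    by (rule lborel_pair.Fubini_integral[OF Fi, symmetric])
  also have "\<dots> = (\<integral>\<xi>. sqrt (pi / d) ^ ?n * exp (-((norm \<xi>)\<^sup>2 / (4 * d))) * ?g \<xi> \<partial>lborel)"
  proof (intro Bochner_Integration.integral_cong refl)
    fix \<xi> :: 'a
    have "F x \<xi> = (cos (\<xi> \<bullet> x) * ?e x) * ?g \<xi>" for x by (simp add: F_def inner_commute)
    then show "(\<integral>x. F x \<xi> \<partial>lborel) = sqrt (pi / d) ^ ?n * exp (-((norm \<xi>)\<^sup>2 / (4 * d))) * ?g \<xi>"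
      using gaussian_fourier[OF d, of \<xi>] by simp
  qed
  also have "\<dots> = sqrt (pi / d) ^ ?n * (\<integral>\<xi>. exp (-((norm \<xi>)\<^sup>2 / (4 * d))) * ?g \<xi> \<partial>lborel)"
    by (simp add: mult.assoc)
  also have "(\<integral>\<xi>. exp (-((norm \<xi>)\<^sup>2 / (4 * d))) * ?g \<xi> \<partial>lborel)
      = sqrt (4 * d) ^ ?n * (\<integral>\<xi>. exp (-((norm (sqrt (4*d) *\<^sub>R \<xi>))\<^sup>2 / (4 * d))) * ?g (sqrt (4*d) *\<^sub>R \<xi>) \<partial>lborel)"
    using d by (subst integral_lborel_affine[of _ "sqrt (4*d)" 0]) auto
  also have "(\<lambda>\<xi>::'a. exp (-((norm (sqrt (4*d) *\<^sub>R \<xi>))\<^sup>2 / (4 * d))) * ?g (sqrt (4*d) *\<^sub>R \<xi>)) 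
     = (\<lambda>\<xi>. ?g (sqrt (4*d) *\<^sub>R \<xi>) * exp (-(norm \<xi>)\<^sup>2))"
    using d by (auto simp: power_mult_distrib mult.commute)
  also have "sqrt (pi / d) ^ ?n * (sqrt (4 * d) ^ ?n * X) / (2 * pi) ^ ?n = (1 / sqrt pi ^ ?n) * X" for X
  proof -
    have "sqrt (pi / d) * sqrt (4 * d) = 2 * sqrt pi" 
      using d by (simp add: real_sqrt_divide real_sqrt_mult)
    then have "sqrt (pi / d) * sqrt (4 * d) / (2 * pi) = 1 / sqrt pi"
      by (simp add: real_div_sqrt field_simps)
    then have "sqrt (pi / d) ^ ?n * sqrt (4 * d) ^ ?n / (2 * pi) ^ ?n = (1 / sqrt pi) ^ ?n"
      by (simp only: power_mult_distrib[symmetric] power_divide[symmetric])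
    then have "sqrt (pi / d) ^ ?n * sqrt (4 * d) ^ ?n / (2 * pi) ^ ?n * X = 1 / sqrt pi ^ ?n * X"
      by (simp only: power_one_over)
    then show ?thesis by (simp add: mult.assoc)
  qed
  finally show "(\<integral>x. frac_heat_kernel \<beta> t (x::'a) * exp (-(d * (norm x)\<^sup>2)) \<partial>lborel)
      = (1 / sqrt pi ^ DIM('a)) * (\<integral>\<xi>. exp (-(t * norm (sqrt (4 * d) *\<^sub>R (\<xi>::'a)) powr \<beta>)) * exp (-(norm \<xi>)\<^sup>2) \<partial>lborel)" .
qed

text \<open>The limit d -> 0 is taken on both sides of the previous identity: by monotone
  convergence on the kernel side, as the kernel is nonnegative, and by dominated convergence on the
  frequency side, where the limit is the Gaussian integral that cancels the prefactor.\<close>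

lemma nn_integral_frac_heat_kernel:
  assumes t: "0 < t" and b: "0 < \<beta>" "\<beta> < 2"
  shows "(\<integral>\<^sup>+x. ennreal (frac_heat_kernel \<beta> t (x::'a::euclidean_space)) \<partial>lborel) = 1"
proof -
  let ?K = "frac_heat_kernel \<beta> t :: 'a \<Rightarrow> real"
  have [measurable]: "?K \<in> borel_measurable borel"
    using measurable_compose[OF measurable_Pair1' frac_heat_kernel_measurable, of t] by simp
  define d where "d k = inverse (real (Suc k))" for k
  have d: "0 < d k" for k by (simp add: d_def)
  have d0: "d \<longlonglongrightarrow> 0" unfolding d_def by (rule LIMSEQ_inverse_real_of_nat)
  have Kn: "0 \<le> ?K x" for x by (rule frac_heat_kernel_nonneg[OF t b])
  have 1: "(\<lambda>k. \<integral>\<^sup>+x. ennreal (?K x * exp (-(d k * (norm x)\<^sup>2))) \<partial>lborel) \<longlonglongrightarrow> (\<integral>\<^sup>+x. ennreal (?K x) \<partial>lborel)"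
  proof (rule nn_integral_LIMSEQ)
    show "incseq (\<lambda>k x. ennreal (?K x * exp (-(d k * (norm x)\<^sup>2))))"
    proof (rule incseq_SucI, rule le_funI, rule ennreal_leI)
      fix k x
      have "d (Suc k) \<le> d k" by (simp add: d_def)
      then show "?K x * exp (-(d k * (norm x)\<^sup>2)) \<le> ?K x * exp (-(d (Suc k) * (norm x)\<^sup>2))"
        by (intro mult_left_mono Kn) (simp add: mult_right_mono)
    qed
    show "(\<lambda>k. ennreal (?K x * exp (-(d k * (norm x)\<^sup>2)))) \<longlonglongrightarrow> ennreal (?K x)" for x
    proof -
      have "(\<lambda>k. ?K x * exp (-(d k * (norm x)\<^sup>2))) \<longlonglongrightarrow> ?K x * exp (-(0 * (norm x)\<^sup>2))"
        by (intro tendsto_intros d0)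
      then show ?thesis by (intro tendsto_ennrealI) simp
    qed
  qed measurable
  let ?h = "\<lambda>k \<xi>::'a. exp (-(t * norm (sqrt (4 * d k) *\<^sub>R \<xi>) powr \<beta>)) * exp (-(norm \<xi>)\<^sup>2)"
  have ig: "integrable lborel (\<lambda>\<xi>::'a. exp (-(norm \<xi>)\<^sup>2))" using integrable_gaussian[of 1, where 'a='a] by simp
  have "(\<lambda>k. \<integral>\<xi>. ?h k \<xi> \<partial>lborel) \<longlonglongrightarrow> (\<integral>\<xi>. exp (-(norm (\<xi>::'a))\<^sup>2) \<partial>lborel)"
  proof (rule integral_dominated_convergence[where w="\<lambda>\<xi>::'a. exp (-(norm \<xi>)\<^sup>2)"])
    show "AE \<xi> in lborel. norm (?h k \<xi>) \<le> exp (-(norm \<xi>)\<^sup>2)" for k using t by simp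
    show "AE \<xi> in (lborel::'a measure). (\<lambda>k. ?h k \<xi>) \<longlonglongrightarrow> exp (-(norm \<xi>)\<^sup>2)"
    proof (rule AE_I2)
      fix \<xi> :: 'a
      have s0: "(\<lambda>k. norm (sqrt (4 * d k) *\<^sub>R \<xi>)) \<longlonglongrightarrow> 0"
        using tendsto_norm[OF tendsto_scaleR[OF tendsto_real_sqrt[OF tendsto_mult[OF tendsto_const[of 4] d0]] tendsto_const[of \<xi>]]] by simp
      have "(\<lambda>k. norm (sqrt (4 * d k) *\<^sub>R \<xi>) powr \<beta>) \<longlonglongrightarrow> 0 powr \<beta>"
        using b by (intro tendsto_powr2[OF s0 tendsto_const]) auto
      then have "(\<lambda>k. ?h k \<xi>) \<longlonglongrightarrow> exp (-(t * (0 powr \<beta>))) * exp (-(norm \<xi>)\<^sup>2)"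
        by (intro tendsto_mult tendsto_exp tendsto_minus tendsto_const)
      then show "(\<lambda>k. ?h k \<xi>) \<longlonglongrightarrow> exp (-(norm \<xi>)\<^sup>2)" using b by simp
    qed
  qed (use ig in auto)
  moreover have "(\<integral>\<xi>. exp (-(norm (\<xi>::'a))\<^sup>2) \<partial>lborel) = sqrt pi ^ DIM('a)"
    using gaussian_fourier[of 1 "0::'a"] by simp
  ultimately have "(\<lambda>k. (1 / sqrt pi ^ DIM('a)) * (\<integral>\<xi>. ?h k \<xi> \<partial>lborel)) \<longlonglongrightarrow> (1 / sqrt pi ^ DIM('a)) * sqrt pi ^ DIM('a)"
    by (intro tendsto_intros) simp
  then have "(\<lambda>k. \<integral>x. ?K x * exp (-(d k * (norm x)\<^sup>2)) \<partial>lborel) \<longlonglongrightarrow> 1"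
    unfolding frac_heat_kernel_gaussian_integral(2)[OF t b(1) d] by simp
  then have "(\<lambda>k. ennreal (\<integral>x. ?K x * exp (-(d k * (norm x)\<^sup>2)) \<partial>lborel)) \<longlonglongrightarrow> ennreal 1"
    by (rule tendsto_ennrealI)
  moreover have "ennreal (\<integral>x. ?K x * exp (-(d k * (norm x)\<^sup>2)) \<partial>lborel) = (\<integral>\<^sup>+x. ennreal (?K x * exp (-(d k * (norm x)\<^sup>2))) \<partial>lborel)" for k
    by (rule nn_integral_eq_integral[symmetric, OF frac_heat_kernel_gaussian_integral(1)[OF t b(1) d]]) (simp add: Kn)
  ultimately have "(\<lambda>k. \<integral>\<^sup>+x. ennreal (?K x * exp (-(d k * (norm x)\<^sup>2))) \<partial>lborel) \<longlonglongrightarrow> 1" by simp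
  with 1 show ?thesis by (rule LIMSEQ_unique)
qed

section \<open>The fractional heat semigroup\<close>

lemma convex_on_powr_abs:
  assumes r: "1 \<le> (r::real)" shows "convex_on UNIV (\<lambda>x::real. \<bar>x\<bar> powr r)"
proof (rule convex_onI)
  fix t x y :: real assume t: "0 < t" "t < 1"
  let ?u = "1 - t"
  have "\<bar>?u * x + t * y\<bar> \<le> ?u * \<bar>x\<bar> + t * \<bar>y\<bar>"
    using t abs_triangle_ineq[of "?u * x" "t * y"] by (simp add: abs_mult)
  then have "\<bar>?u * x + t * y\<bar> powr r \<le> (?u * \<bar>x\<bar> + t * \<bar>y\<bar>) powr r"
    using r by (intro powr_mono2) auto
  also have "\<dots> \<le> ?u * \<bar>x\<bar> powr r + t * \<bar>y\<bar> powr r"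
  proof -
    have le: "a powr r \<le> a" if "0 < a" "a < 1" for a :: real
      using powr_mono'[of 1 r a] r that by simp
    \<comment> \<open>Convexity of the power is applied to positive arguments; if one argument
      vanishes, the claim is \<open>a powr r \<le> a\<close> for the weight a of the other.\<close>
    consider "x = 0" | "y = 0" | "x \<noteq> 0" "y \<noteq> 0" by blast
    then show ?thesis
    proof cases
      case 1 then show ?thesis using t le[of t] r by (auto simp: powr_mult intro!: mult_right_mono)
    next
      case 2 then show ?thesis using t le[of ?u] r by (auto simp: powr_mult intro!: mult_right_mono)
    next
      case 3
      then show ?thesis using convex_onD[OF powr_convex[OF r], of t "\<bar>x\<bar>" "\<bar>y\<bar>"] t by simp
    qed
  qed
  finally show "\<bar>?u *\<^sub>R x + t *\<^sub>R y\<bar> powr r \<le> ?u * \<bar>x\<bar> powr r + t * \<bar>y\<bar> powr r" by simp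
qed simp

lemma convex_on_exp_powr_abs:
  assumes r: "1 \<le> (r::real)" and c: "0 \<le> c" shows "convex_on UNIV (\<lambda>x::real. exp (\<bar>x\<bar> powr r / c) - 1)"
proof (rule convex_onI)
  fix t x y :: real assume t: "0 < t" "t < 1"
  have "\<bar>(1 - t) *\<^sub>R x + t *\<^sub>R y\<bar> powr r \<le> (1 - t) * \<bar>x\<bar> powr r + t * \<bar>y\<bar> powr r"
    using convex_onD[OF convex_on_powr_abs[OF r], of t x y] t by simp
  then have "\<bar>(1 - t) *\<^sub>R x + t *\<^sub>R y\<bar> powr r / c \<le> ((1 - t) * \<bar>x\<bar> powr r + t * \<bar>y\<bar> powr r) / c"
    using c by (rule divide_right_mono)
  also have "\<dots> = (1 - t) *\<^sub>R (\<bar>x\<bar> powr r / c) + t *\<^sub>R (\<bar>y\<bar> powr r / c)" by (simp add: add_divide_distrib)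
  finally have "exp (\<bar>(1 - t) *\<^sub>R x + t *\<^sub>R y\<bar> powr r / c) \<le> exp ((1 - t) *\<^sub>R (\<bar>x\<bar> powr r / c) + t *\<^sub>R (\<bar>y\<bar> powr r / c))"
    by simp
  also have "\<dots> \<le> (1 - t) * exp (\<bar>x\<bar> powr r / c) + t * exp (\<bar>y\<bar> powr r / c)"
    using convex_onD[OF exp_convex, of t "\<bar>x\<bar> powr r / c" "\<bar>y\<bar> powr r / c"] t by simp
  finally show "exp (\<bar>(1 - t) *\<^sub>R x + t *\<^sub>R y\<bar> powr r / c) - 1
     \<le> (1 - t) * (exp (\<bar>x\<bar> powr r / c) - 1) + t * (exp (\<bar>y\<bar> powr r / c) - 1)"
    by (simp add: algebra_simps)
qed simp

text \<open>The bridge from Lebesgue measurable functions to Borel representatives and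
  \<open>lborel\<close>, where Fubini's theorem is applied: at nonzero times the semigroup sees only
  the class of its argument.\<close>

lemma frac_heat_semigroup_AE_eq:
  fixes \<phi> \<psi> :: "'a::euclidean_space \<Rightarrow> real"
  assumes t: "t \<noteq> 0" and [measurable]: "\<psi> \<in> borel_measurable borel" and eq: "AE x in lborel. \<phi> x = \<psi> x"
  shows "frac_heat_semigroup \<beta> t \<phi> x = (\<integral>y. frac_heat_kernel \<beta> t (x - y) * \<psi> y \<partial>lborel)"
proof -
  have [measurable]: "frac_heat_kernel \<beta> t \<in> borel_measurable (borel :: 'a measure)"
    using measurable_compose[OF measurable_Pair1' frac_heat_kernel_measurable, of t] by simp
  have 1: "(\<lambda>y. frac_heat_kernel \<beta> t (x - y) * \<psi> y) \<in> borel_measurable lborel" by measurable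
  then have 2: "(\<lambda>y. frac_heat_kernel \<beta> t (x - y) * \<psi> y) \<in> borel_measurable lebesgue"
    by (rule measurable_completion)
  have e: "AE y in lebesgue. frac_heat_kernel \<beta> t (x - y) * \<phi> y = frac_heat_kernel \<beta> t (x - y) * \<psi> y"
    using AE_completion[OF eq] by eventually_elim simp
  have 3: "(\<lambda>y. frac_heat_kernel \<beta> t (x - y) * \<phi> y) \<in> borel_measurable lebesgue"
    by (rule borel_measurable_AE[OF 2]) (use AE_completion[OF eq] in \<open>eventually_elim, simp\<close>)
  have "frac_heat_semigroup \<beta> t \<phi> x = (\<integral>y. frac_heat_kernel \<beta> t (x - y) * \<psi> y \<partial>lebesgue)"
    using t unfolding frac_heat_semigroup_def by (simp) (rule integral_cong_AE[OF 3 2 e])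
  then show ?thesis using 1 by (simp add: integral_completion)
qed

text \<open>If the right-hand side is finite, \<open>G (X y)\<close> is integrable for the
  probability measure with density \<open>w\<close>, and Jensen's inequality applies; otherwise
  there is nothing to show.\<close>

lemma jensen_nn_integral:
  fixes w X :: "'a::euclidean_space \<Rightarrow> real"
  assumes [measurable]: "w \<in> borel_measurable borel" "X \<in> borel_measurable borel" "G \<in> borel_measurable borel"
    and k0: "\<And>y. 0 \<le> w y" and k1: "(\<integral>\<^sup>+y. ennreal (w y) \<partial>lborel) = 1"
    and int: "integrable lborel (\<lambda>y. w y * X y)"
    and G: "convex_on UNIV G" "\<And>z::real. 0 \<le> G z"
  shows "ennreal (G (\<integral>y. w y * X y \<partial>lborel)) \<le> (\<integral>\<^sup>+y. ennreal (w y) * ennreal (G (X y)) \<partial>lborel)"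
proof (cases "(\<integral>\<^sup>+y. ennreal (w y) * ennreal (G (X y)) \<partial>lborel) < \<infinity>")
  case True
  define M where "M = density lborel (\<lambda>y. ennreal (w y))"
  interpret M: prob_space M
    by (rule prob_spaceI) (simp add: M_def emeasure_density k1)
  have ekG: "ennreal (w y) * ennreal (G (X y)) = ennreal (norm (w y * G (X y)))" for y
    using k0 G by (simp add: ennreal_mult)
  have kG: "integrable lborel (\<lambda>y. w y * G (X y))"
    by (rule integrableI_bounded) (use True in \<open>simp_all add: ekG\<close>)
  have X: "integrable M X" unfolding M_def by (subst integrable_density) (use int k0 in auto)
  have GX: "integrable M (\<lambda>y. G (X y))" unfolding M_def by (subst integrable_density) (use kG k0 in auto)
  have "G (M.expectation X) \<le> M.expectation (\<lambda>y. G (X y))"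
    by (rule M.jensens_inequality[OF X, of UNIV]) (use GX G in auto)
  moreover have "M.expectation X = (\<integral>y. w y * X y \<partial>lborel)"
    unfolding M_def using k0 by (subst integral_density) auto
  moreover have "M.expectation (\<lambda>y. G (X y)) = (\<integral>y. w y * G (X y) \<partial>lborel)"
    unfolding M_def using k0 by (subst integral_density) auto
  moreover have "ennreal (\<integral>y. w y * G (X y) \<partial>lborel) = (\<integral>\<^sup>+y. ennreal (w y) * ennreal (G (X y)) \<partial>lborel)"
    by (subst nn_integral_eq_integral[symmetric, OF kG]) (use k0 G in \<open>auto simp: ennreal_mult\<close>)
  ultimately show ?thesis by (metis ennreal_leI)
qed (simp add: not_less top_unique)

locale frac_heat =
  fixes \<beta> :: real assumes b: "0 < \<beta>" "\<beta> < 2"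
begin

abbreviation heat :: "real \<Rightarrow> ('a::euclidean_space \<Rightarrow> real) \<Rightarrow> 'a \<Rightarrow> real" where
  "heat \<equiv> frac_heat_semigroup \<beta>"

abbreviation ker :: "real \<Rightarrow> 'a::euclidean_space \<Rightarrow> real" where
  "ker \<equiv> frac_heat_kernel \<beta>"

lemma kernel_measurable [measurable]: "ker t \<in> borel_measurable borel"
  using measurable_compose[OF measurable_Pair1' frac_heat_kernel_measurable, of t] by simp

lemma nn_integral_kernel_diff:
  assumes t: "0 < t"
  shows "(\<integral>\<^sup>+y. ennreal (ker t ((x::'a) - y)) \<partial>lborel) = 1"
    and "(\<integral>\<^sup>+x. ennreal (ker t (x - (y::'a::euclidean_space))) \<partial>lborel) = 1"
  using nn_integral_lborel_affine[of "\<lambda>z. ennreal (ker t z)" "-1" x]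
    nn_integral_lborel_affine[of "\<lambda>z. ennreal (ker t z)" 1 "-y"]
    nn_integral_frac_heat_kernel[OF t b, where 'a='a] by simp_all

lemma semigroup_eq_lborel:
  assumes "t \<noteq> 0" "\<phi> \<in> borel_measurable borel"
  shows "heat t \<phi> x = (\<integral>y. ker t (x - y) * \<phi> y \<partial>lborel)"
  by (rule frac_heat_semigroup_AE_eq) (use assms in auto)

lemma convolution_measurable:
  fixes \<phi> :: "'a::euclidean_space \<Rightarrow> real"
  assumes [measurable]: "\<phi> \<in> borel_measurable borel"
  shows "(\<lambda>(t, x). \<integral>y. ker t (x - y) * \<phi> y \<partial>lborel) \<in> borel_measurable (borel \<Otimes>\<^sub>M borel)"
  unfolding frac_heat_kernel_lborel by measurable

lemma semigroup_measurable:
  assumes [measurable]: "\<phi> \<in> borel_measurable borel"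
  shows "heat t \<phi> \<in> borel_measurable borel"
proof (cases "t = 0")
  case False
  then show ?thesis unfolding semigroup_eq_lborel[OF False assms, abs_def] by measurable
qed (simp add: frac_heat_semigroup_def)

text \<open>From \<bar>\<phi>\<bar> \<le> 1 + \<bar>\<phi>\<bar>^r: the constant 1 is paid for by
  the unit mass of the kernel, the power by the supremum of the kernel.\<close>

lemma convolution_integrable:
  fixes \<phi> :: "'a::euclidean_space \<Rightarrow> real"
  assumes t: "0 < t" and [measurable]: "\<phi> \<in> borel_measurable borel" and r: "1 \<le> r"
    and fin: "(\<integral>\<^sup>+y. ennreal (\<bar>\<phi> y\<bar> powr r) \<partial>lborel) < \<infinity>"
  shows "integrable lborel (\<lambda>y. ker t (x - y) * \<phi> y)"
proof (rule integrableI_bounded)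
  let ?B = "t powr (-(real DIM('a) / \<beta>)) * ker 1 (0::'a)"
  have "(\<integral>\<^sup>+y. ennreal (norm (ker t (x - y) * \<phi> y)) \<partial>lborel)
    \<le> (\<integral>\<^sup>+y. ennreal (ker t (x - y)) + ennreal ?B * ennreal (\<bar>\<phi> y\<bar> powr r) \<partial>lborel)"
  proof (rule nn_integral_mono)
    fix y
    let ?k = "ker t (x - y)"
    have k: "0 \<le> ?k" "?k \<le> ?B"
      using frac_heat_kernel_nonneg[OF t b, of "x - y"] frac_heat_kernel_le[OF t b(1), of "x - y"] by auto
    have "\<bar>\<phi> y\<bar> \<le> 1 + \<bar>\<phi> y\<bar> powr r"
      using powr_mono[of 1 r "\<bar>\<phi> y\<bar>"] r by (cases "\<bar>\<phi> y\<bar> \<le> 1") (auto intro: add_increasing2)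
    then have "?k * \<bar>\<phi> y\<bar> \<le> ?k * (1 + \<bar>\<phi> y\<bar> powr r)" using k by (intro mult_left_mono)
    also have "\<dots> \<le> ?k + ?B * \<bar>\<phi> y\<bar> powr r" using k by (simp add: distrib_left mult_right_mono)
    finally have "norm (?k * \<phi> y) \<le> ?k + ?B * \<bar>\<phi> y\<bar> powr r" using k by (simp add: abs_mult)
    then have "ennreal (norm (?k * \<phi> y)) \<le> ennreal (?k + ?B * \<bar>\<phi> y\<bar> powr r)" by (rule ennreal_leI)
    also have "\<dots> = ennreal ?k + ennreal ?B * ennreal (\<bar>\<phi> y\<bar> powr r)"
      using k by (simp add: ennreal_plus ennreal_mult)
    finally show "ennreal (norm (?k * \<phi> y)) \<le> ennreal ?k + ennreal ?B * ennreal (\<bar>\<phi> y\<bar> powr r)" .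
  qed
  also have "\<dots> = 1 + ennreal ?B * (\<integral>\<^sup>+y. ennreal (\<bar>\<phi> y\<bar> powr r) \<partial>lborel)"
    by (simp add: nn_integral_add nn_integral_cmult nn_integral_kernel_diff[OF t])
  also have "\<dots> < \<infinity>" using fin by (simp add: ennreal_mult_less_top)
  finally show "(\<integral>\<^sup>+y. ennreal (norm (ker t (x - y) * \<phi> y)) \<partial>lborel) < \<infinity>" .
qed measurable

lemma semigroup_jensen:
  fixes \<phi> :: "'a::euclidean_space \<Rightarrow> real"
  assumes t: "0 < t" and [measurable]: "\<phi> \<in> borel_measurable borel"
    and int: "integrable lborel (\<lambda>y. ker t (x - y) * \<phi> y)"
    and G: "convex_on UNIV G" "\<And>z. 0 \<le> G z" and [measurable]: "G \<in> borel_measurable borel"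
  shows "ennreal (G (heat t \<phi> x)) \<le> (\<integral>\<^sup>+y. ennreal (ker t (x - y)) * ennreal (G (\<phi> y)) \<partial>lborel)"
  using jensen_nn_integral[of "\<lambda>y. ker t (x - y)" \<phi> G] t int G
  by (simp add: semigroup_eq_lborel frac_heat_kernel_nonneg[OF t b] nn_integral_kernel_diff[OF t])

lemma nn_integral_convolution:
  fixes g :: "'a::euclidean_space \<Rightarrow> ennreal"
  assumes t: "0 < t" and [measurable]: "g \<in> borel_measurable borel"
  shows "(\<integral>\<^sup>+x. \<integral>\<^sup>+y. ennreal (ker t (x - y)) * g y \<partial>lborel \<partial>lborel) = (\<integral>\<^sup>+y. g y \<partial>lborel)"
proof -
  have "(\<integral>\<^sup>+x. \<integral>\<^sup>+y. ennreal (ker t (x - y)) * g y \<partial>lborel \<partial>lborel)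
    = (\<integral>\<^sup>+y. \<integral>\<^sup>+x. ennreal (ker t (x - y)) * g y \<partial>lborel \<partial>lborel)"
    by (rule lborel_pair.Fubini'[symmetric]) measurable
  also have "\<dots> = (\<integral>\<^sup>+y. g y \<partial>lborel)"
    by (intro nn_integral_cong) (simp add: nn_integral_multc nn_integral_kernel_diff[OF t])
  finally show ?thesis .
qed

text \<open>Pointwise Jensen, then Tonelli, as the kernel has unit mass in x as well. The moment of
  order r guarantees that the convolution converges.\<close>

lemma nn_integral_semigroup_convex:
  fixes \<phi> :: "'a::euclidean_space \<Rightarrow> real"
  assumes t: "0 \<le> t" and [measurable]: "\<phi> \<in> borel_measurable borel" and r: "1 \<le> r"
    and fin: "(\<integral>\<^sup>+y. ennreal (\<bar>\<phi> y\<bar> powr r) \<partial>lborel) < \<infinity>"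
    and G: "convex_on UNIV G" "\<And>z. 0 \<le> G z" and [measurable]: "G \<in> borel_measurable borel"
  shows "(\<integral>\<^sup>+x. ennreal (G (heat t \<phi> x)) \<partial>lborel) \<le> (\<integral>\<^sup>+y. ennreal (G (\<phi> y)) \<partial>lborel)"
proof (cases "t = 0")
  case False
  with t have t: "0 < t" by simp
  have "(\<integral>\<^sup>+x. ennreal (G (heat t \<phi> x)) \<partial>lborel) \<le> 
     (\<integral>\<^sup>+x. \<integral>\<^sup>+y. ennreal (ker t (x - y)) * ennreal (G (\<phi> y)) \<partial>lborel \<partial>lborel)"
    by (intro nn_integral_mono semigroup_jensen[OF t _ convolution_integrable[OF t _ r fin] G]) auto
  also have "\<dots> = (\<integral>\<^sup>+y. ennreal (G (\<phi> y)) \<partial>lborel)"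
    by (rule nn_integral_convolution[OF t]) measurable
  finally show ?thesis .
qed (simp add: frac_heat_semigroup_def)

text \<open>Jensen with the r-th power followed by the supremum bound of the kernel. The r-th root
  gives smoothing from L^r to bounded functions at rate t^(-n/(\<beta> r)).\<close>

lemma semigroup_powr_le:
  fixes \<phi> :: "'a::euclidean_space \<Rightarrow> real"
  assumes t: "0 < t" and [measurable]: "\<phi> \<in> borel_measurable borel" and r: "1 \<le> r"
    and fin: "(\<integral>\<^sup>+y. ennreal (\<bar>\<phi> y\<bar> powr r) \<partial>lborel) \<le> ennreal A" and A: "0 \<le> A"
  shows "\<bar>heat t \<phi> x\<bar> powr r \<le> t powr (-(real DIM('a) / \<beta>)) * ker 1 (0::'a) * A"
proof -
  let ?B = "t powr (-(real DIM('a) / \<beta>)) * ker 1 (0::'a)"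
  have B: "0 \<le> ?B" using frac_heat_kernel_nonneg[OF zero_less_one b, of "0::'a"] by simp
  have f: "(\<integral>\<^sup>+y. ennreal (\<bar>\<phi> y\<bar> powr r) \<partial>lborel) < \<infinity>" using fin by (rule order.strict_trans1) simp
  have "ennreal (\<bar>heat t \<phi> x\<bar> powr r) 
     \<le> (\<integral>\<^sup>+y. ennreal (ker t (x - y)) * ennreal (\<bar>\<phi> y\<bar> powr r) \<partial>lborel)"
    by (rule semigroup_jensen[OF t _ convolution_integrable[OF t _ r f] convex_on_powr_abs[OF r]]) auto
  also have "\<dots> \<le> (\<integral>\<^sup>+y. ennreal ?B * ennreal (\<bar>\<phi> y\<bar> powr r) \<partial>lborel)"
    using frac_heat_kernel_le[OF t b(1), where 'a='a]
    by (intro nn_integral_mono mult_right_mono ennreal_leI) (auto intro: order_trans[OF abs_ge_self])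
  also have "\<dots> = ennreal ?B * (\<integral>\<^sup>+y. ennreal (\<bar>\<phi> y\<bar> powr r) \<partial>lborel)" by (rule nn_integral_cmult) measurable
  also have "\<dots> \<le> ennreal ?B * ennreal A" using fin by (intro mult_left_mono) auto
  also have "\<dots> = ennreal (?B * A)" using B A by (simp add: ennreal_mult)
  finally show ?thesis using B A by (subst (asm) ennreal_le_iff) auto
qed

lemma semigroup_diff:
  fixes \<phi> \<psi> :: "'a::euclidean_space \<Rightarrow> real"
  assumes t: "0 < t" and m: "\<phi> \<in> borel_measurable borel" "\<psi> \<in> borel_measurable borel"
    and r: "1 \<le> r" "1 \<le> s" and fin: "(\<integral>\<^sup>+y. ennreal (\<bar>\<phi> y\<bar> powr r) \<partial>lborel) < \<infinity>"
    "(\<integral>\<^sup>+y. ennreal (\<bar>\<psi> y\<bar> powr s) \<partial>lborel) < \<infinity>"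
  shows "heat t (\<lambda>y. \<phi> y - \<psi> y) x = heat t \<phi> x - heat t \<psi> x"
proof -
  have d: "(\<lambda>y. \<phi> y - \<psi> y) \<in> borel_measurable borel" using m by measurable
  show ?thesis
    using convolution_integrable[OF t m(1) r(1) fin(1), of x] convolution_integrable[OF t m(2) r(2) fin(2), of x] t
    by (simp add: semigroup_eq_lborel m d right_diff_distrib)
qed

text \<open>The substitution y = x - t^(1/\<beta>) z moves the time from the kernel into the
  argument of \<phi>, so that continuity in time becomes continuity of \<phi>.\<close>

lemma semigroup_rescaled:
  fixes \<phi> :: "'a::euclidean_space \<Rightarrow> real"
  assumes t: "0 < t" and [measurable]: "\<phi> \<in> borel_measurable borel"
  shows "heat t \<phi> x = (\<integral>z. ker 1 z * \<phi> (x - t powr (1 / \<beta>) *\<^sub>R z) \<partial>lborel)"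
proof -
  let ?c = "t powr (1 / \<beta>)"
  have c: "0 < ?c" using t by simp
  have cn: "?c ^ DIM('a) * t powr (-(real DIM('a) / \<beta>)) = 1"
    using t by (simp add: powr_realpow[symmetric] powr_powr powr_add[symmetric])
  have cc: "t powr (-(1 / \<beta>)) * ?c = 1" using t by (simp add: powr_add[symmetric])
  have "heat t \<phi> x = (\<integral>y. ker t (x - y) * \<phi> y \<partial>lborel)"
    using t by (simp add: semigroup_eq_lborel)
  also have "\<dots> = \<bar>-?c\<bar> ^ DIM('a) *\<^sub>R (\<integral>z. ker t (x - (x + (-?c) *\<^sub>R z)) * \<phi> (x + (-?c) *\<^sub>R z) \<partial>lborel)"
    by (rule integral_lborel_affine) (use c in auto)
  also have "\<dots> = (\<integral>z. ?c ^ DIM('a) * (ker t (?c *\<^sub>R z) * \<phi> (x - ?c *\<^sub>R z)) \<partial>lborel)"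
    using c by simp
  also have "\<dots> = (\<integral>z. ker 1 z * \<phi> (x - ?c *\<^sub>R z) \<partial>lborel)"
  proof (intro Bochner_Integration.integral_cong refl)
    fix z :: 'a
    have "ker t (?c *\<^sub>R z) = t powr (-(real DIM('a) / \<beta>)) * ker 1 z"
      unfolding frac_heat_kernel_scale[OF t b(1), of "?c *\<^sub>R z"] by (simp only: scaleR_scaleR cc scaleR_one)
    then show "?c ^ DIM('a) * (ker t (?c *\<^sub>R z) * \<phi> (x - ?c *\<^sub>R z)) = ker 1 z * \<phi> (x - ?c *\<^sub>R z)"
      using cn by (simp add: mult.assoc[symmetric])
  qed
  finally show ?thesis .
qed

end

section \<open>The exponential modular\<close>

lemma exp_modular_lborel:
  "exp_modular p l u = (\<integral>\<^sup>+ x. ennreal (exp (\<bar>u x\<bar> powr p / l powr p) - 1) \<partial>lborel)"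
  unfolding exp_modular_def by (rule nn_integral_completion)

lemma exp_modular_cong_AE:
  assumes "AE x in lborel. u x = v x" shows "exp_modular p l u = exp_modular p l v"
  unfolding exp_modular_lborel by (rule nn_integral_cong_AE) (use assms in \<open>eventually_elim, simp\<close>)

lemma exp_modular_uminus: "exp_modular p l (\<lambda>x. u x - v x) = exp_modular p l (\<lambda>x. v x - u x)"
  unfolding exp_modular_lborel by (simp add: abs_minus_commute)

lemma borel_imp_lebesgue: "u \<in> borel_measurable borel \<Longrightarrow> u \<in> borel_measurable lebesgue"
  by (rule measurable_completion) simp

lemma exp_modular_antimono:
  assumes "0 \<le> p" "0 < l" "l \<le> l'" shows "exp_modular p l' u \<le> exp_modular p l u"
  unfolding exp_modular_def
  by (intro nn_integral_mono ennreal_leI diff_right_mono) (use assms in \<open>simp add: divide_left_mono powr_mono2\<close>)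

text \<open>At twice the level the sum is no worse than the larger of the two summands. Cruder than
  \<open>exp_modular_triangle\<close>, but valid for modulars of any size.\<close>

lemma exp_modular_add:
  assumes [measurable]: "u \<in> borel_measurable lebesgue" "v \<in> borel_measurable lebesgue" and p: "0 \<le> p" and l: "0 < l"
  shows "exp_modular p (2 * l) (\<lambda>x. u x + v x) \<le> exp_modular p l u + exp_modular p l v"
proof -
  have "exp (\<bar>a + b\<bar> powr p / (2 * l) powr p) - 1 \<le> (exp (\<bar>a\<bar> powr p / l powr p) - 1) + (exp (\<bar>b\<bar> powr p / l powr p) - 1)" for a b :: real
  proof -
    have "\<bar>a + b\<bar> powr p \<le> (2 * max \<bar>a\<bar> \<bar>b\<bar>) powr p" by (rule powr_mono2) (use p in auto)
    also have "\<dots> = 2 powr p * max \<bar>a\<bar> \<bar>b\<bar> powr p" by (simp add: powr_mult)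
    finally have "\<bar>a + b\<bar> powr p / (2 * l) powr p \<le> max \<bar>a\<bar> \<bar>b\<bar> powr p / l powr p"
      using l by (simp add: powr_mult field_simps)
    then have "exp (\<bar>a + b\<bar> powr p / (2 * l) powr p) \<le> exp (max \<bar>a\<bar> \<bar>b\<bar> powr p / l powr p)" by simp
    also have "\<dots> - 1 \<le> (exp (\<bar>a\<bar> powr p / l powr p) - 1) + (exp (\<bar>b\<bar> powr p / l powr p) - 1)"
      by (cases "\<bar>a\<bar> \<le> \<bar>b\<bar>") (simp_all add: max_def)
    finally show ?thesis by simp
  qed
  then have "exp_modular p (2 * l) (\<lambda>x. u x + v x) \<le> (\<integral>\<^sup>+ x. ennreal (exp (\<bar>u x\<bar> powr p / l powr p) - 1) + ennreal (exp (\<bar>v x\<bar> powr p / l powr p) - 1) \<partial>lebesgue)"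
    unfolding exp_modular_def by (intro nn_integral_mono) (simp add: ennreal_plus[symmetric] ennreal_leI del: ennreal_plus)
  also have "\<dots> = exp_modular p l u + exp_modular p l v"
    unfolding exp_modular_def by (rule nn_integral_add) measurable
  finally show ?thesis .
qed

text \<open>The quotient (a + b) / (l + k) is the convex combination of a / l and b / k with weights
  l / (l + k) and k / (l + k), and the modular integrand is convex. This is the triangle inequality
  of the Luxemburg norm in modular form.\<close>

lemma exp_modular_triangle:
  assumes m[measurable]: "u \<in> borel_measurable lebesgue" "v \<in> borel_measurable lebesgue"
    and p: "1 \<le> p" and l: "0 < l" "0 < k"
    and u: "exp_modular p l u \<le> 1" and v: "exp_modular p k v \<le> 1"
  shows "exp_modular p (l + k) (\<lambda>x. u x + v x) \<le> 1"
proof -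
  let ?G = "\<lambda>z::real. exp (\<bar>z\<bar> powr p / 1) - 1"
  let ?s = "k / (l + k)"
  have s: "0 \<le> ?s" "?s \<le> 1" "1 - ?s = l / (l + k)" using l by (auto simp: field_simps)
  have G: "exp (\<bar>a\<bar> powr p / j powr p) - 1 = ?G (a / j)" if "0 < j" for a j :: real
    using that by (simp add: powr_divide)
  have en: "ennreal ((1 - j) * A + j * B) = ennreal (1 - j) * ennreal A + ennreal j * ennreal B"
    if "0 \<le> j" "j \<le> 1" "0 \<le> A" "0 \<le> B" for j A B :: real
    using that by (simp add: ennreal_plus ennreal_mult)
  have pw: "?G ((a + b) / (l + k)) \<le> (1 - ?s) * ?G (a / l) + ?s * ?G (b / k)" for a b :: real
  proof -
    have "(a + b) / (l + k) = (1 - ?s) *\<^sub>R (a / l) + ?s *\<^sub>R (b / k)"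
      using l unfolding s by (simp add: add_divide_distrib)
    then show ?thesis
      using convex_onD[OF convex_on_exp_powr_abs[OF p zero_le_one] s(1,2), of "a / l" "b / k"] by simp
  qed
  have "exp_modular p (l + k) (\<lambda>x. u x + v x) 
    \<le> (\<integral>\<^sup>+ x. ennreal (1 - ?s) * ennreal (?G (u x / l)) + ennreal ?s * ennreal (?G (v x / k)) \<partial>lebesgue)"
    unfolding exp_modular_def
  proof (rule nn_integral_mono)
    fix x
    have "ennreal (exp (\<bar>u x + v x\<bar> powr p / (l + k) powr p) - 1) \<le> ennreal ((1 - ?s) * ?G (u x / l) + ?s * ?G (v x / k))"
      using G[of "l + k" "u x + v x"] pw[of "u x" "v x"] l by (intro ennreal_leI) simp
    also have "\<dots> = ennreal (1 - ?s) * ennreal (?G (u x / l)) + ennreal ?s * ennreal (?G (v x / k))"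
      by (rule en) (use s(1,2) in auto)
    finally show "ennreal (exp (\<bar>u x + v x\<bar> powr p / (l + k) powr p) - 1) \<le> \<dots>" .
  qed
  also have "\<dots> = ennreal (1 - ?s) * exp_modular p l u + ennreal ?s * exp_modular p k v"
    unfolding exp_modular_def G[OF l(1)] G[OF l(2)]
    by (subst nn_integral_add, measurable) (subst (1 2) nn_integral_cmult, measurable)
  also have "\<dots> \<le> ennreal (1 - ?s) * 1 + ennreal ?s * 1"
    by (intro add_mono mult_left_mono u v) auto
  also have "\<dots> = 1" using s by (simp add: ennreal_plus[symmetric] del: ennreal_plus)
  finally show ?thesis .
qed

text \<open>Convexity of exp on the segment from 0 to y: dividing the exponent y by c^p \<ge> c
  divides exp y - 1 by at least c.\<close>

lemma exp_modular_scale: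
  assumes p: "1 \<le> p" and l: "0 < l" and c: "1 \<le> c" and [measurable]: "u \<in> borel_measurable lebesgue"
  shows "exp_modular p (c * l) u \<le> ennreal (1 / c) * exp_modular p l u"
proof -
  have pw: "exp (\<bar>a\<bar> powr p / (c * l) powr p) - 1 \<le> (1 / c) * (exp (\<bar>a\<bar> powr p / l powr p) - 1)" for a :: real
  proof -
    let ?y = "\<bar>a\<bar> powr p / l powr p"
    have "c \<le> c powr p" using powr_mono[of 1 p c] p c by simp
    then have "\<bar>a\<bar> powr p / (c * l) powr p \<le> (1 / c) * ?y"
      using c l by (simp add: powr_mult field_simps mult_right_mono)
    also have "\<dots> = (1 - 1/c) *\<^sub>R 0 + (1/c) *\<^sub>R ?y" by simp
    finally have "exp (\<bar>a\<bar> powr p / (c * l) powr p) \<le> exp ((1 - 1/c) *\<^sub>R 0 + (1/c) *\<^sub>R ?y)" by simp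
    also have "\<dots> \<le> (1 - 1/c) * exp 0 + (1/c) * exp ?y"
      using c by (intro convex_onD[OF exp_convex]) auto
    finally show ?thesis by (simp add: algebra_simps)
  qed
  have "exp_modular p (c * l) u \<le> (\<integral>\<^sup>+ x. ennreal (1 / c) * ennreal (exp (\<bar>u x\<bar> powr p / l powr p) - 1) \<partial>lebesgue)"
    unfolding exp_modular_def
    by (intro nn_integral_mono, subst ennreal_mult[symmetric]) (use c pw in \<open>auto intro!: ennreal_leI\<close>)
  also have "\<dots> = ennreal (1 / c) * exp_modular p l u"
    unfolding exp_modular_def by (rule nn_integral_cmult) measurable
  finally show ?thesis .
qed

lemma exp_modular_le_1_exists:
  assumes p: "1 \<le> p" and l: "0 < l" and u: "u \<in> borel_measurable lebesgue" and fin: "exp_modular p l u \<le> ennreal K"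
  shows "exp_modular p (max 1 K * l) u \<le> 1"
proof -
  have "exp_modular p (max 1 K * l) u \<le> ennreal (1 / max 1 K) * exp_modular p l u"
    by (rule exp_modular_scale[OF p l _ u]) simp
  also have "\<dots> \<le> ennreal (1 / max 1 K) * ennreal (max 1 K)"
    by (intro mult_left_mono order_trans[OF fin] ennreal_leI) auto
  also have "\<dots> = 1" by (simp add: ennreal_mult[symmetric])
  finally show ?thesis .
qed

lemma exp_Lp_norm_le:
  assumes "0 < l" "exp_modular p l u \<le> 1" shows "exp_Lp_norm p u \<le> l"
  unfolding exp_Lp_norm_def using assms by (intro cInf_lower bdd_belowI[of _ 0]) auto

lemma exp_Lp_norm_nonneg:
  assumes "0 < l" "exp_modular p l u \<le> 1" shows "0 \<le> exp_Lp_norm p u"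
  unfolding exp_Lp_norm_def using assms by (intro cInf_greatest) auto

text \<open>Finiteness at some level makes the set under the infimum nonempty; the strict inequality
  then yields an admissible level below \<open>e\<close>, and modulars decrease in the
  level.\<close>

lemma exp_modular_le_1_of_norm:
  assumes p: "1 \<le> p" and u: "u \<in> borel_measurable lebesgue" and l: "0 < l" "exp_modular p l u < \<infinity>"
    and n: "exp_Lp_norm p u < e"
  shows "0 < e" "exp_modular p e u \<le> 1"
proof -
  obtain K where K: "exp_modular p l u = ennreal K" using l(2) by (cases "exp_modular p l u") auto
  have "max 1 K * l \<in> {l. 0 < l \<and> exp_modular p l u \<le> 1}"
    using exp_modular_le_1_exists[OF p l(1) u, of K] K l by simp
  then obtain j where j: "0 < j" "exp_modular p j u \<le> 1" "j < e"
    using n unfolding exp_Lp_norm_def by (subst (asm) cInf_less_iff) (auto intro: bdd_belowI[of _ 0])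
  then show "0 < e" by simp
  show "exp_modular p e u \<le> 1" using exp_modular_antimono[of p j e u] j p by auto
qed

lemma exp_modular_bounded_support_le:
  fixes u :: "'a::euclidean_space \<Rightarrow> real"
  assumes p: "0 \<le> p" and M: "\<And>x. \<bar>u x\<bar> \<le> M" and R: "\<And>x. R < norm x \<Longrightarrow> u x = 0"
  shows "exp_modular p l u \<le> ennreal ((exp (M powr p / l powr p) - 1) * measure lborel (cball (0::'a) R))"
proof -
  have "exp_modular p l u \<le> (\<integral>\<^sup>+ x. ennreal (exp (M powr p / l powr p) - 1) * indicator (cball (0::'a) R) x \<partial>lborel)"
    unfolding exp_modular_lborel
  proof (rule nn_integral_mono)
    fix x
    show "ennreal (exp (\<bar>u x\<bar> powr p / l powr p) - 1) \<le> ennreal (exp (M powr p / l powr p) - 1) * indicator (cball (0::'a) R) x"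
      by (cases "R < norm x") (auto simp: R indicator_def intro!: ennreal_leI divide_right_mono powr_mono2 p M)
  qed
  also have "\<dots> = ennreal (exp (M powr p / l powr p) - 1) * emeasure lborel (cball (0::'a) R)"
    by (rule nn_integral_cmult_indicator) simp
  also have "emeasure lborel (cball (0::'a) R) = ennreal (measure lborel (cball (0::'a) R))"
    using emeasure_lborel_cball_finite[of "0::'a" R] by (simp add: emeasure_eq_ennreal_measure less_top)
  also have "ennreal (exp (M powr p / l powr p) - 1) * ennreal (measure lborel (cball (0::'a) R))
      = ennreal ((exp (M powr p / l powr p) - 1) * measure lborel (cball (0::'a) R))"
    by (subst ennreal_mult) auto
  finally show ?thesis .
qed

text \<open>The 1 is split off because it is integrated over a compact set only, while the rest is
  the modular integrand.\<close>

lemma abs_le_exp_powr: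
  fixes a :: real assumes "1 \<le> p" shows "\<bar>a\<bar> \<le> 1 + (exp (\<bar>a\<bar> powr p) - 1)"
proof -
  have "\<bar>a\<bar> \<le> max 1 (\<bar>a\<bar> powr p)"
    using powr_mono[of 1 p "\<bar>a\<bar>"] assms by (cases "\<bar>a\<bar> \<le> 1") auto
  also have "\<dots> \<le> exp (\<bar>a\<bar> powr p)" 
    by (rule max.boundedI, simp) (use exp_ge_add_one_self[of "\<bar>a\<bar> powr p"] in linarith)
  finally show ?thesis by simp
qed

subsection \<open>Smooth functions\<close>

lemma Ck_imp_continuous: "Ck k \<phi> \<Longrightarrow> continuous_on UNIV \<phi>"
  by (cases k) (auto intro!: continuous_at_imp_continuous_on differentiable_imp_continuous_within)

lemma Ck_SucD: "Ck (Suc k) \<phi> \<Longrightarrow> Ck k \<phi>"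
proof (induction k arbitrary: \<phi>)
  case 0
  from Ck_imp_continuous[OF 0] show ?case by simp
qed auto

lemma Ck_const: "Ck k (\<lambda>_::'a::euclidean_space. c)"
  by (induction k arbitrary: c) (auto simp: frechet_derivative_const)

lemma Ck_bounded_linear:
  fixes f :: "'a::euclidean_space \<Rightarrow> real" assumes "bounded_linear f" shows "Ck k f"
proof (cases k)
  case 0 then show ?thesis using assms by (simp add: linear_continuous_on)
next
  case (Suc j)
  have d: "(f has_derivative f) (at x)" for x using assms by (rule bounded_linear_imp_has_derivative)
  have "frechet_derivative f (at x) = f" for x using frechet_derivative_at[OF d] by simp
  then show ?thesis using d by (auto simp: Suc Ck_const differentiable_def)
qed

lemma Ck_add: "Ck k f \<Longrightarrow> Ck k g \<Longrightarrow> Ck k (\<lambda>x. f x + g x)"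
proof (induction k arbitrary: f g)
  case 0 then show ?case by (auto intro: continuous_on_add)
next
  case (Suc k)
  have df: "(f has_derivative frechet_derivative f (at x)) (at x)" "(g has_derivative frechet_derivative g (at x)) (at x)" for x
    using Suc.prems by (auto simp: frechet_derivative_works[symmetric])
  have d: "((\<lambda>x. f x + g x) has_derivative (\<lambda>b. frechet_derivative f (at x) b + frechet_derivative g (at x) b)) (at x)" for x
    by (intro has_derivative_add df)
  have "frechet_derivative (\<lambda>x. f x + g x) (at x) = (\<lambda>b. frechet_derivative f (at x) b + frechet_derivative g (at x) b)" for x
    using frechet_derivative_at[OF d] by simp
  moreover have "(\<lambda>x. f x + g x) differentiable (at x)" for x
    using d unfolding differentiable_def by blast
  ultimately show ?case using Suc by auto
qed

lemma Ck_mult: "Ck k f \<Longrightarrow> Ck k g \<Longrightarrow> Ck k (\<lambda>x. f x * g x)"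
proof (induction k arbitrary: f g)
  case 0 then show ?case by (auto intro: continuous_on_mult)
next
  case (Suc k)
  have df: "(f has_derivative frechet_derivative f (at x)) (at x)" "(g has_derivative frechet_derivative g (at x)) (at x)" for x
    using Suc.prems by (auto simp: frechet_derivative_works[symmetric])
  have d: "((\<lambda>x. f x * g x) has_derivative (\<lambda>b. f x * frechet_derivative g (at x) b + frechet_derivative f (at x) b * g x)) (at x)" for x
    by (rule has_derivative_mult[OF df])
  have e: "frechet_derivative (\<lambda>x. f x * g x) (at x) = (\<lambda>b. f x * frechet_derivative g (at x) b + frechet_derivative f (at x) b * g x)" for x
    using frechet_derivative_at[OF d] by simp
  have "Ck k f" "Ck k g" using Suc.prems Ck_SucD by blast+
  then have "Ck k (\<lambda>x. f x * frechet_derivative g (at x) b + frechet_derivative f (at x) b * g x)" if "b \<in> Basis" for b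
    using Suc.prems that by (intro Ck_add Suc.IH) auto
  then show ?case using d by (auto simp: differentiable_def e)
qed

lemma Ck_real_polynomial_function:
  fixes q :: "'a::euclidean_space \<Rightarrow> real" shows "real_polynomial_function q \<Longrightarrow> Ck k q"
  by (induction rule: real_polynomial_function.induct) (auto intro: Ck_bounded_linear Ck_const Ck_add Ck_mult)

text \<open>The classical function exp (-1/s), extended by 0, with the quotients by s^m that its
  derivatives produce: the linear span of the family is closed under differentiation.\<close>

definition flat_exp :: "nat \<Rightarrow> real \<Rightarrow> real" where
  "flat_exp m s = (if 0 < s then exp (-(1 / s)) / s ^ m else 0)"

text \<open>The term of order m + 2 of the exponential series at 1/s beats s^(-m) with s^2 to spare;
  the square makes the derivative at the origin vanish.\<close>

lemma flat_exp_le: "\<bar>flat_exp m s\<bar> \<le> fact (m + 2) * s\<^sup>2"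
proof (cases "0 < s")
  case True
  have "(1 / s) ^ (m + 2) \<le> fact (m + 2) * exp (1 / s)"
    by (rule pow_le_fact_exp) (use True in simp)
  then have "exp (-(1 / s)) * (1 / s) ^ (m + 2) \<le> exp (-(1 / s)) * (fact (m + 2) * exp (1 / s))"
    by (rule mult_left_mono) simp
  also have "\<dots> = fact (m + 2)" by (simp add: exp_minus)
  finally have "exp (-(1 / s)) * (1 / s) ^ (m + 2) \<le> fact (m + 2)" .
  then have "s\<^sup>2 * (exp (-(1 / s)) * (1 / s) ^ (m + 2)) \<le> s\<^sup>2 * fact (m + 2)"
    by (rule mult_left_mono) simp
  moreover have "s\<^sup>2 * (exp (-(1 / s)) * (1 / s) ^ (m + 2)) = flat_exp m s"
    using True by (simp add: flat_exp_def power_divide power_add power2_eq_square)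
  moreover have "0 \<le> flat_exp m s" using True by (simp add: flat_exp_def)
  ultimately show ?thesis by (simp add: mult.commute)
qed (simp add: flat_exp_def)

lemma flat_exp_has_derivative:
  "(flat_exp m has_real_derivative flat_exp (m + 2) s + (- real m) * flat_exp (m + 1) s) (at s)"
proof -
  consider "0 < s" | "s < 0" | "s = 0" by linarith
  then show ?thesis
  proof cases
    case 1
    have "((\<lambda>s. exp (-(1 / s)) / s ^ m) has_real_derivative flat_exp (m + 2) s + (- real m) * flat_exp (m + 1) s) (at s)"
      using 1 by (auto intro!: derivative_eq_intros simp: flat_exp_def)
        (cases m; simp add: field_simps power2_eq_square power_add)
    then show ?thesis
      by (rule has_field_derivative_transform_within_open[of _ _ _ "{0<..}"]) (use 1 in \<open>auto simp: flat_exp_def\<close>)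
  next
    case 2
    have "((\<lambda>_. 0) has_real_derivative 0) (at s)" by simp
    then have "(flat_exp m has_real_derivative 0) (at s)"
      by (rule has_field_derivative_transform_within_open[of _ _ _ "{..<0}"]) (use 2 in \<open>auto simp: flat_exp_def\<close>)
    then show ?thesis using 2 by (simp add: flat_exp_def)
  next
    case 3
    have "((\<lambda>y. (flat_exp m y - flat_exp m 0) / (y - 0)) \<longlongrightarrow> 0) (at 0)"
    proof (rule Lim_null_comparison)
      show "\<forall>\<^sub>F y in at 0. norm ((flat_exp m y - flat_exp m 0) / (y - 0)) \<le> fact (m + 2) * \<bar>y\<bar>"
      proof (rule always_eventually, rule allI)
        fix y :: real
        show "norm ((flat_exp m y - flat_exp m 0) / (y - 0)) \<le> fact (m + 2) * \<bar>y\<bar>"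
          using flat_exp_le[of m y] by (cases "y = 0") (auto simp: flat_exp_def[of m 0] abs_divide divide_simps power2_eq_square abs_mult[symmetric] mult.assoc)
      qed
      show "((\<lambda>y::real. fact (m + 2) * \<bar>y\<bar>) \<longlongrightarrow> 0) (at 0)" using tendsto_mult[OF tendsto_const[of "fact (m + 2) :: real"] tendsto_rabs[OF tendsto_ident_at[of "0::real" UNIV]]] by simp
    qed
    then show ?thesis using 3 by (simp add: has_field_derivative_iff flat_exp_def)
  qed
qed

text \<open>The chain rule raises m by 1 and by 2, so the induction on k treats all m
  simultaneously.\<close>

lemma Ck_flat_exp:
  fixes q :: "'a::euclidean_space \<Rightarrow> real"
  assumes q: "\<And>k. Ck k q" shows "Ck k (\<lambda>x. flat_exp m (q x))"
proof (induction k arbitrary: m)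
  have D: "((\<lambda>x. flat_exp m (q x)) has_derivative
      (\<lambda>b. (flat_exp (m + 2) (q x) + (- real m) * flat_exp (m + 1) (q x)) * frechet_derivative q (at x) b)) (at x)" for x m
  proof -
    have "(q has_derivative frechet_derivative q (at x)) (at x)"
      using q[of "Suc 0"] by (auto simp: frechet_derivative_works[symmetric])
    then show ?thesis
      using has_derivative_compose[OF _ flat_exp_has_derivative[unfolded has_field_derivative_def], of q "frechet_derivative q (at x)" x UNIV m] by simp
  qed
  {
    case 0
    have "(\<lambda>x. flat_exp m (q x)) differentiable (at x)" for x using D[of m x] by (auto simp: differentiable_def)
    then show ?case by (auto intro!: differentiable_imp_continuous_on simp: differentiable_on_def)
  next
    case (Suc k)
    have e: "frechet_derivative (\<lambda>x. flat_exp m (q x)) (at x) = 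
       (\<lambda>b. (flat_exp (m + 2) (q x) + (- real m) * flat_exp (m + 1) (q x)) * frechet_derivative q (at x) b)" for x
      using frechet_derivative_at[OF D] by simp
    have "Ck k (\<lambda>x. (flat_exp (m + 2) (q x) + (- real m) * flat_exp (m + 1) (q x)) * frechet_derivative q (at x) b)" if "b \<in> Basis" for b
      using that q[of "Suc k"] by (intro Ck_mult Ck_add Ck_const Suc.IH) auto
    then show ?case using D[of m] by (auto simp: differentiable_def e)
  }
qed

section \<open>Test functions and their closure\<close>

lemma test_functions_D:
  fixes \<phi> :: "'a::euclidean_space \<Rightarrow> real"
  assumes "\<phi> \<in> test_functions"
  obtains R M where "continuous_on UNIV \<phi>" "0 < R" "0 < M" "\<And>x. R < norm x \<Longrightarrow> \<phi> x = 0" "\<And>x. \<bar>\<phi> x\<bar> \<le> M"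
proof -
  have "Ck 0 \<phi>" and cp: "compact (closure {x. \<phi> x \<noteq> 0})" using assms by (auto simp: test_functions_def)
  then have c: "continuous_on UNIV \<phi>" by simp
  obtain R where R: "0 < R" "\<And>x. x \<in> closure {x. \<phi> x \<noteq> 0} \<Longrightarrow> norm x \<le> R"
    using compact_imp_bounded[OF cp] unfolding bounded_pos by blast
  have R0: "\<phi> x = 0" if "R < norm x" for x
    using R(2)[of x] that closure_subset[of "{x. \<phi> x \<noteq> 0}"] by fastforce
  have "bounded (\<phi> ` cball 0 R)"
    by (intro compact_imp_bounded compact_continuous_image continuous_on_subset[OF c]) auto
  then obtain M where M: "0 < M" "\<And>x. x \<in> cball 0 R \<Longrightarrow> \<bar>\<phi> x\<bar> \<le> M" unfolding bounded_pos by auto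
  have "\<bar>\<phi> x\<bar> \<le> M" for x using M R0[of x] by (cases "norm x \<le> R") auto
  with c R(1) M(1) R0 show thesis by (rule that)
qed

lemma exp_modular_test_finite:
  assumes "\<phi> \<in> test_functions" "0 \<le> p" shows "exp_modular p l \<phi> < \<infinity>"
proof -
  obtain R M where "\<And>x. R < norm x \<Longrightarrow> \<phi> x = 0" "\<And>x. \<bar>\<phi> x\<bar> \<le> M"
    using test_functions_D[OF assms(1)] by metis
  then have "exp_modular p l \<phi> \<le> ennreal ((exp (M powr p / l powr p) - 1) * measure lborel (cball (0::'a) R))"
    by (intro exp_modular_bounded_support_le assms(2))
  also have "\<dots> < \<infinity>" by simp
  finally show ?thesis .
qed

lemma test_functions_borel: "\<phi> \<in> test_functions \<Longrightarrow> \<phi> \<in> borel_measurable borel"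
  by (erule test_functions_D) (rule borel_measurable_continuous_onI)

lemma exp_Lp_measurable:
  assumes "u \<in> exp_Lp p" shows "u \<in> borel_measurable lebesgue"
proof (rule borel_measurable_LIMSEQ_real)
  show "(\<lambda>x. indicator (cball 0 (real n)) x * u x) \<in> borel_measurable lebesgue" for n
    using assms by (auto simp: exp_Lp_def set_integrable_def dest: spec[of _ "cball 0 (real n)"])
  show "(\<lambda>n. indicator (cball 0 (real n)) x * u x) \<longlonglongrightarrow> u x" for x
  proof (rule tendsto_eventually)
    obtain N :: nat where "norm x \<le> real N" using real_arch_simple by blast
    then show "\<forall>\<^sub>F n in sequentially. indicator (cball 0 (real n)) x * u x = u x"
      by (auto simp: eventually_sequentially intro!: exI[of _ N])
  qed
qed

lemma exp_Lp0_approx: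
  assumes u: "u \<in> exp_Lp0 p" and p: "1 \<le> p" and e: "0 < e"
  shows "\<exists>\<phi>\<in>test_functions. exp_modular p e (\<lambda>x. u x - \<phi> x) \<le> 1"
proof -
  have uL: "u \<in> exp_Lp p" using u by (simp add: exp_Lp0_def)
  have [measurable]: "u \<in> borel_measurable lebesgue" by (rule exp_Lp_measurable[OF uL])
  obtain l where l: "0 < l" "exp_modular p l u < \<infinity>" using uL by (auto simp: exp_Lp_def)
  obtain \<phi> where \<phi>: "\<phi> \<in> test_functions" "exp_Lp_norm p (\<lambda>x. u x - \<phi> x) < e"
    using u e by (auto simp: exp_Lp0_def)
  have [measurable]: "\<phi> \<in> borel_measurable lebesgue" by (intro borel_imp_lebesgue test_functions_borel \<phi>)
  have "exp_modular p l (\<lambda>x. - \<phi> x) = exp_modular p l \<phi>" by (simp add: exp_modular_def)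
  then have "exp_modular p (2 * l) (\<lambda>x. u x + (- \<phi> x)) < \<infinity>"
    using exp_modular_add[of u "\<lambda>x. - \<phi> x" p l] exp_modular_test_finite[OF \<phi>(1), of p l] l p
    by (auto intro: order.strict_trans1)
  then have "exp_modular p e (\<lambda>x. u x - \<phi> x) \<le> 1"
    by (intro exp_modular_le_1_of_norm(2)[OF p _ _ _ \<phi>(2), of "2 * l"]) (use l in auto)
  with \<phi> show ?thesis by blast
qed

text \<open>In u = (u - \<phi>) + \<phi> the first summand is small at the given level and a test
  function \<phi> has finite modulars at all levels. With \<open>exp_Lp0_I\<close> this describes
  the closure by exponential moments.\<close>

lemma exp_Lp0_modular_finite:
  assumes u: "u \<in> exp_Lp0 p" and p: "1 \<le> p" and l: "0 < l"
  shows "exp_modular p l u < \<infinity>"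
proof -
  obtain \<phi> where \<phi>: "\<phi> \<in> test_functions" "exp_modular p (l / 2) (\<lambda>x. u x - \<phi> x) \<le> 1"
    using exp_Lp0_approx[OF u p, of "l / 2"] l by auto
  have [measurable]: "\<phi> \<in> borel_measurable lebesgue" "u \<in> borel_measurable lebesgue"
    using u by (auto intro: borel_imp_lebesgue test_functions_borel \<phi> exp_Lp_measurable simp: exp_Lp0_def)
  have "exp_modular p (2 * (l / 2)) (\<lambda>x. (u x - \<phi> x) + \<phi> x) \<le> exp_modular p (l / 2) (\<lambda>x. u x - \<phi> x) + exp_modular p (l / 2) \<phi>"
    by (rule exp_modular_add) (use l p in auto)
  also have "\<dots> < \<infinity>" using \<phi> exp_modular_test_finite[OF \<phi>(1), of p "l / 2"] p
    by (auto intro: order.strict_trans1)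
  finally show ?thesis by simp
qed

section \<open>Density of test functions\<close>

lemma exp_modular_tendsto_0:
  fixes u :: "nat \<Rightarrow> 'a::euclidean_space \<Rightarrow> real"
  assumes p: "0 < p" and l: "0 < l" and [measurable]: "\<And>k. u k \<in> borel_measurable lebesgue" "w \<in> borel_measurable lebesgue"
    and le: "\<And>k x. \<bar>u k x\<bar> \<le> \<bar>w x\<bar>" and w: "exp_modular p l w < \<infinity>"
    and lim: "AE x in lebesgue. (\<lambda>k. u k x) \<longlonglongrightarrow> 0" and e: "0 < (e::real)"
  shows "\<exists>k. exp_modular p l (u k) \<le> ennreal e"
proof -
  have "(\<lambda>k. exp_modular p l (u k)) \<longlonglongrightarrow> (\<integral>\<^sup>+x. 0 \<partial>(lebesgue::'a measure))"
    unfolding exp_modular_def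
  proof (rule nn_integral_dominated_convergence[where w="\<lambda>x. ennreal (exp (\<bar>w x\<bar> powr p / l powr p) - 1)"])
    show "AE x in lebesgue. ennreal (exp (\<bar>u k x\<bar> powr p / l powr p) - 1) \<le> ennreal (exp (\<bar>w x\<bar> powr p / l powr p) - 1)" for k
      by (intro AE_I2 ennreal_leI diff_right_mono) (use p le in \<open>simp add: divide_right_mono powr_mono2\<close>)
    show "(\<integral>\<^sup>+ x. ennreal (exp (\<bar>w x\<bar> powr p / l powr p) - 1) \<partial>lebesgue) < \<infinity>" using w by (simp add: exp_modular_def)
    show "AE x in lebesgue. (\<lambda>k. ennreal (exp (\<bar>u k x\<bar> powr p / l powr p) - 1)) \<longlonglongrightarrow> 0"
      using lim
    proof eventually_elim
      case (elim x)
      have "(\<lambda>k. \<bar>u k x\<bar> powr p) \<longlonglongrightarrow> 0 powr p"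
        using tendsto_rabs_zero[OF elim] p by (intro tendsto_powr2[OF _ tendsto_const]) auto
      then have "(\<lambda>k. exp (\<bar>u k x\<bar> powr p / l powr p) - 1) \<longlonglongrightarrow> exp (0 powr p / l powr p) - 1"
        using l by (intro tendsto_diff tendsto_exp tendsto_divide tendsto_const) auto
      from tendsto_ennrealI[OF this] show ?case using p by simp
    qed
  qed measurable
  then have "\<forall>\<^sub>F k in sequentially. exp_modular p l (u k) < ennreal e"
    using e by (intro order_tendstoD(2)) auto
  then obtain k where "exp_modular p l (u k) < ennreal e" by (auto simp: eventually_sequentially)
  then show ?thesis by (auto intro: less_imp_le)
qed

lemma truncation_approx:
  fixes u :: "'a::euclidean_space \<Rightarrow> real"
  assumes p: "0 < p" and l: "0 < l" and [measurable]: "u \<in> borel_measurable lebesgue"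
    and fin: "exp_modular p l u < \<infinity>" and e: "0 < e"
  obtains N :: nat and w where "w \<in> borel_measurable lebesgue" "\<And>x. \<bar>w x\<bar> \<le> real N" "\<And>x. real N < norm x \<Longrightarrow> w x = 0"
    "exp_modular p l (\<lambda>x. u x - w x) \<le> ennreal e"
proof -
  define w where "w N x = indicator (cball 0 (real N)) x * (if \<bar>u x\<bar> \<le> real N then u x else 0)" for N :: nat and x
  have [measurable]: "w N \<in> borel_measurable lebesgue" for N
  proof -
    have "(\<lambda>y::real. if \<bar>y\<bar> \<le> real N then y else 0) \<in> borel_measurable borel" by measurable
    from measurable_compose[OF _ this, of u lebesgue]
    show ?thesis unfolding w_def by (intro borel_measurable_times borel_measurable_indicator) auto
  qed
  have "\<exists>N. exp_modular p l (\<lambda>x. u x - w N x) \<le> ennreal e"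
  proof (rule exp_modular_tendsto_0[OF p l, of "\<lambda>N x. u x - w N x" u])
    show "\<bar>u x - w N x\<bar> \<le> \<bar>u x\<bar>" for N x by (auto simp: w_def indicator_def)
    show "AE x in lebesgue. (\<lambda>N. u x - w N x) \<longlonglongrightarrow> 0"
    proof (rule AE_I2)
      fix x
      obtain M :: nat where M: "max (norm x) \<bar>u x\<bar> \<le> real M" using real_arch_simple by blast
      have "u x - w N x = 0" if "M \<le> N" for N
        using M that by (auto simp: w_def indicator_def)
      then show "(\<lambda>N. u x - w N x) \<longlonglongrightarrow> 0"
        by (intro tendsto_eventually) (auto simp: eventually_sequentially)
    qed
  qed (use fin e in auto)
  then obtain N where "exp_modular p l (\<lambda>x. u x - w N x) \<le> ennreal e" by blast
  then show thesis by (intro that[of "w N" N]) (auto simp: w_def indicator_def)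
qed

text \<open>Measurability provides continuous functions converging to \<open>w\<close> off a null
  set, without control of size or support. Clamping to [-N, N] and multiplying by a cutoff supply a
  majorant of finite modular and leave the limit unchanged.\<close>

lemma continuous_approx:
  fixes w :: "'a::euclidean_space \<Rightarrow> real"
  assumes p: "0 < p" and l: "0 < l" and wm[measurable]: "w \<in> borel_measurable lebesgue"
    and N: "\<And>x. \<bar>w x\<bar> \<le> real N" "\<And>x. real N < norm x \<Longrightarrow> w x = 0" and e: "0 < e"
  obtains \<psi> where "continuous_on UNIV \<psi>" "\<And>x. real N + 1 < norm x \<Longrightarrow> \<psi> x = 0"
    "exp_modular p l (\<lambda>x. w x - \<psi> x) \<le> ennreal e"
proof -
  have "w measurable_on UNIV" by (rule lebesgue_measurable_imp_measurable_on[OF wm]) simp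
  then obtain Z g where Z: "negligible Z" and g: "\<And>n. continuous_on UNIV (g n)"
    and lim: "\<And>x. x \<notin> Z \<Longrightarrow> (\<lambda>n. g n x) \<longlonglongrightarrow> w x"
    unfolding measurable_on_def by auto
  \<comment> \<open>A cutoff equal to 1 on the ball of radius N, outside which \<open>w\<close>
    vanishes, and to 0 beyond N + 1.\<close>
  define c where "c x = max 0 (min 1 (real N + 1 - norm x))" for x :: 'a
  define \<psi> where "\<psi> n x = c x * max (- real N) (min (real N) (g n x))" for n x
  have cont: "continuous_on UNIV (\<psi> n)" for n
    unfolding \<psi>_def c_def by (intro continuous_intros g)
  have c: "0 \<le> c x" "c x \<le> 1" for x by (auto simp: c_def)
  have supp: "\<psi> n x = 0" if "real N + 1 < norm x" for n x using that by (simp add: \<psi>_def c_def)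
  have b: "\<bar>\<psi> n x\<bar> \<le> real N" for n x
  proof -
    have "\<bar>\<psi> n x\<bar> \<le> 1 * real N" unfolding \<psi>_def abs_mult using c[of x] by (intro mult_mono) auto
    then show ?thesis by simp
  qed
  have [measurable]: "\<psi> n \<in> borel_measurable lebesgue" for n
    by (intro borel_imp_lebesgue borel_measurable_continuous_onI cont)
  let ?W = "\<lambda>x::'a. 2 * real N * indicator (cball 0 (real N + 1)) x"
  have [measurable]: "?W \<in> borel_measurable lebesgue" by (intro borel_imp_lebesgue borel_measurable_times borel_measurable_indicator borel_measurable_const) auto
  have "\<exists>n. exp_modular p l (\<lambda>x. w x - \<psi> n x) \<le> ennreal e"
  proof (rule exp_modular_tendsto_0[OF p l, of "\<lambda>n x. w x - \<psi> n x" ?W])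
    show "\<bar>w x - \<psi> n x\<bar> \<le> \<bar>?W x\<bar>" for n x
      using N(1)[of x] N(2)[of x] b[of n x] supp[of x n] by (cases "real N + 1 < norm x") (auto simp: indicator_def)
    have "exp_modular p l ?W \<le> ennreal ((exp ((2 * real N) powr p / l powr p) - 1) * measure lborel (cball (0::'a) (real N + 1)))"
      by (rule exp_modular_bounded_support_le) (use p in \<open>auto simp: indicator_def\<close>)
    then show "exp_modular p l ?W < \<infinity>" by (rule order.strict_trans1) simp
    show "AE x in lebesgue. (\<lambda>n. w x - \<psi> n x) \<longlonglongrightarrow> 0"
    proof (rule AE_I')
      show "Z \<in> null_sets lebesgue" using Z by (simp add: negligible_iff_null_sets)
      show "{x \<in> space lebesgue. \<not> (\<lambda>n. w x - \<psi> n x) \<longlonglongrightarrow> 0} \<subseteq> Z"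
      proof (clarify, rule ccontr)
        fix x assume n: "\<not> (\<lambda>n. w x - \<psi> n x) \<longlonglongrightarrow> 0" and x: "x \<notin> Z"
        have "(\<lambda>n. \<psi> n x) \<longlonglongrightarrow> c x * max (- real N) (min (real N) (w x))"
          unfolding \<psi>_def by (intro tendsto_intros lim x)
        moreover have "c x * max (- real N) (min (real N) (w x)) = w x"
        proof (cases "real N < norm x")
          case True then show ?thesis using N(2) by simp
        next
          case False
          then have "c x = 1" by (simp add: c_def)
          then show ?thesis using N(1)[of x] by (simp add: max_def min_def abs_le_iff)
        qed
        ultimately have "(\<lambda>n. w x - \<psi> n x) \<longlonglongrightarrow> w x - w x" by (intro tendsto_intros) simp
        then show False using n by simp
      qed
    qed
  qed (use e in auto)
  then obtain n where "exp_modular p l (\<lambda>x. w x - \<psi> n x) \<le> ennreal e" by blast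
  with cont supp show thesis by (intro that)
qed

text \<open>A continuous function with compact support is divided by a smooth bump that is positive on the
  support; multiplying a polynomial approximation of the quotient by the bump gives a test function.\<close>

lemma smooth_uniform_approx:
  fixes \<psi> :: "'a::euclidean_space \<Rightarrow> real"
  assumes \<psi>: "continuous_on UNIV \<psi>" and R: "0 < R" "\<And>x. R < norm x \<Longrightarrow> \<psi> x = 0" and e: "0 < e"
  obtains \<phi> where "\<phi> \<in> test_functions" "\<And>x. \<bar>\<psi> x - \<phi> x\<bar> \<le> e" "\<And>x. R + 1 < norm x \<Longrightarrow> \<phi> x = 0"
proof -
  define q where "q x = (R + 1)\<^sup>2 - x \<bullet> x" for x :: 'a
  have q_rpf: "real_polynomial_function q"
  proof -
    have "real_polynomial_function (\<lambda>x::'a. (R + 1)\<^sup>2 + (\<Sum>b\<in>Basis. (- 1) * ((x \<bullet> b) * (x \<bullet> b))))"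
      by (intro real_polynomial_function.intros real_polynomial_function_sum bounded_linear_inner_left) auto
    also have "(\<lambda>x::'a. (R + 1)\<^sup>2 + (\<Sum>b\<in>Basis. (- 1) * ((x \<bullet> b) * (x \<bullet> b)))) = q"
      unfolding q_def by (rule ext) (subst (2) euclidean_inner, simp add: sum_negf)
    finally show ?thesis .
  qed
  have q1: "1 \<le> q x" if "norm x \<le> R" for x
  proof -
    have "x \<bullet> x \<le> R\<^sup>2" using that by (simp add: power2_norm_eq_inner[symmetric] power_mono)
    then show ?thesis using R(1) by (simp add: q_def power2_eq_square algebra_simps)
  qed
  have q0: "q x \<le> 0" if "R + 1 \<le> norm x" for x
  proof -
    have "(R + 1)\<^sup>2 \<le> (norm x)\<^sup>2" using that R by (intro power_mono) auto
    then show ?thesis by (simp add: q_def power2_norm_eq_inner)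
  qed
  have qc: "continuous_on UNIV q" unfolding q_def by (intro continuous_intros)
  \<comment> \<open>Where \<psi> is nonzero \<open>q\<close> is at least 1, so this is \<psi>
    divided by the bump \<open>flat_exp 0 (q x)\<close>; the \<open>max\<close> keeps the quotient
    continuous where the bump vanishes.\<close>
  define F where "F x = \<psi> x * exp (1 / max 1 (q x))" for x
  have "continuous_on (cball 0 (R + 1)) F"
    unfolding F_def by (intro continuous_intros continuous_on_subset[OF \<psi>] continuous_on_subset[OF qc]) auto
  then obtain P where P: "real_polynomial_function P" "\<And>x. x \<in> cball 0 (R + 1) \<Longrightarrow> \<bar>F x - P x\<bar> < e"
    using Stone_Weierstrass_real_polynomial_function[OF compact_cball _ e] by blast
  define \<phi> where "\<phi> x = flat_exp 0 (q x) * P x" for x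
  have fe: "0 \<le> flat_exp 0 (q x)" "flat_exp 0 (q x) \<le> 1" for x by (auto simp: flat_exp_def)
  have \<psi>F: "\<psi> x = flat_exp 0 (q x) * F x" for x
    using q1[of x] R(2)[of x] by (cases "norm x \<le> R") (auto simp: F_def flat_exp_def exp_minus max_def)
  have supp: "\<phi> x = 0" if "R + 1 \<le> norm x" for x using q0[OF that] by (simp add: \<phi>_def flat_exp_def)
  show thesis
  proof
    have "Ck k \<phi>" for k
      unfolding \<phi>_def by (intro Ck_mult Ck_flat_exp Ck_real_polynomial_function q_rpf P)
    moreover have "{x. \<phi> x \<noteq> 0} \<subseteq> cball 0 (R + 1)" using supp by (force simp: not_le[symmetric])
    then have "compact (closure {x. \<phi> x \<noteq> 0})"
      by (metis bounded_cball bounded_subset compact_closure)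
    ultimately show "\<phi> \<in> test_functions" by (simp add: test_functions_def)
    show "\<bar>\<psi> x - \<phi> x\<bar> \<le> e" for x
    proof (cases "norm x \<le> R + 1")
      case True
      have "\<bar>\<psi> x - \<phi> x\<bar> = flat_exp 0 (q x) * \<bar>F x - P x\<bar>"
        unfolding \<psi>F \<phi>_def right_diff_distrib[symmetric] abs_mult using fe[of x] by simp
      also have "\<dots> \<le> 1 * e" using fe[of x] P(2)[of x] True by (intro mult_mono) auto
      finally show ?thesis by simp
    next
      case False then show ?thesis using R(2)[of x] supp[of x] e by simp
    qed
    show "R + 1 < norm x \<Longrightarrow> \<phi> x = 0" for x using supp by simp
  qed
qed

lemma test_function_approx:
  fixes \<psi> :: "'a::euclidean_space \<Rightarrow> real"
  assumes \<psi>: "continuous_on UNIV \<psi>" and R: "0 < R" "\<And>x. R < norm x \<Longrightarrow> \<psi> x = 0"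
    and p: "1 \<le> p" and l: "0 < l" and e: "0 < e"
  obtains \<phi> where "\<phi> \<in> test_functions" "exp_modular p l (\<lambda>x. \<psi> x - \<phi> x) \<le> ennreal e"
proof -
  define V where "V = measure lborel (cball (0::'a) (R + 1))"
  have V: "0 \<le> V" by (simp add: V_def)
  \<comment> \<open>A uniform error l d on a ball of volume V has modular at most 2 d V, since exp
    (d^p) - 1 \<le> 2 d for d \<le> 1; this choice makes it at most e.\<close>
  define d where "d = min 1 (e / (2 * (V + 1)))"
  have d: "0 < d" "d \<le> 1" "2 * d * V \<le> e"
  proof -
    show "0 < d" "d \<le> 1" using V e by (auto simp: d_def)
    have "2 * d * V \<le> 2 * (e / (2 * (V + 1))) * V" using V by (intro mult_right_mono mult_left_mono) (auto simp: d_def)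
    also have "\<dots> \<le> e" using V e by (simp add: field_simps)
    finally show "2 * d * V \<le> e" .
  qed
  obtain \<phi> where \<phi>: "\<phi> \<in> test_functions" "\<And>x. \<bar>\<psi> x - \<phi> x\<bar> \<le> l * d" "\<And>x. R + 1 < norm x \<Longrightarrow> \<phi> x = 0"
    using smooth_uniform_approx[OF \<psi> R, of "l * d"] l d by auto
  have "exp_modular p l (\<lambda>x. \<psi> x - \<phi> x) \<le> ennreal ((exp ((l * d) powr p / l powr p) - 1) * V)"
    unfolding V_def by (rule exp_modular_bounded_support_le) (use p \<phi> R in auto)
  also have "(exp ((l * d) powr p / l powr p) - 1) * V \<le> e"
  proof -
    have dp: "d powr p \<le> d" using powr_mono'[of 1 p d] d p by simp
    have "exp (d powr p) \<le> 1 + d powr p + (d powr p)\<^sup>2"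
      by (rule exp_bound) (use d p dp in auto)
    also have "\<dots> \<le> 1 + 2 * d"
    proof -
      have "d powr p * d powr p \<le> d powr p" by (rule mult_left_le) (use d dp in linarith, simp)
      then show ?thesis using dp unfolding power2_eq_square by linarith
    qed
    finally have "exp ((l * d) powr p / l powr p) - 1 \<le> 2 * d" using l by (simp add: powr_mult)
    then have "(exp ((l * d) powr p / l powr p) - 1) * V \<le> 2 * d * V" using V by (rule mult_right_mono)
    then show ?thesis using d by linarith
  qed
  finally show thesis using \<phi>(1) by (intro that) (auto intro: ennreal_leI)
qed

text \<open>Truncation in range and space, then a continuous and finally a smooth approximation,
  each with an error of small modular. Converse of \<open>exp_Lp0_modular_finite\<close>.\<close>

lemma exp_Lp0_I:
  fixes u :: "'a::euclidean_space \<Rightarrow> real"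
  assumes um[measurable]: "u \<in> borel_measurable lebesgue" and p: "1 \<le> p"
    and fin: "\<And>l. 0 < l \<Longrightarrow> exp_modular p l u < \<infinity>"
  shows "u \<in> exp_Lp0 p"
proof -
  have int: "u absolutely_integrable_on K" if "compact K" for K
  proof -
    have [measurable]: "K \<in> sets lebesgue" by (rule fmeasurableD[OF lmeasurable_compact[OF that]])
    have "(\<integral>\<^sup>+x. ennreal (norm (indicator K x *\<^sub>R u x)) \<partial>lebesgue) \<le> 
       (\<integral>\<^sup>+x. indicator K x + ennreal (exp (\<bar>u x\<bar> powr p / 1 powr p) - 1) \<partial>lebesgue)"
    proof (rule nn_integral_mono)
      fix x
      have "\<bar>indicator K x * u x\<bar> \<le> indicator K x + (exp (\<bar>u x\<bar> powr p) - 1)"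
        using abs_le_exp_powr[OF p, of "u x"] by (auto simp: indicator_def)
      then have "ennreal \<bar>indicator K x * u x\<bar> \<le> ennreal (indicator K x + (exp (\<bar>u x\<bar> powr p) - 1))" by (rule ennreal_leI)
      also have "\<dots> = ennreal (indicator K x) + ennreal (exp (\<bar>u x\<bar> powr p) - 1)" by (rule ennreal_plus) auto
      finally show "ennreal (norm (indicator K x *\<^sub>R u x)) \<le> indicator K x + ennreal (exp (\<bar>u x\<bar> powr p / 1 powr p) - 1)"
        by (simp add: ennreal_indicator)
    qed
    also have "\<dots> = emeasure lebesgue K + exp_modular p 1 u"
      unfolding exp_modular_def by (subst nn_integral_add) auto
    also have "\<dots> < \<infinity>"
      using fin[of 1] fmeasurableD2[OF lmeasurable_compact[OF that]] by (simp add: less_top)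
    finally show ?thesis unfolding set_integrable_def by (intro integrableI_bounded) measurable
  qed
  have approx: "\<exists>\<phi>\<in>test_functions. exp_Lp_norm p (\<lambda>x. u x - \<phi> x) < e" if e: "0 < e" for e
  proof -
    \<comment> \<open>Two uses of \<open>exp_modular_add\<close> raise the level from l to 4 l = e /
      2, strictly below e; three errors of modular 1/4 sum to less than 1.\<close>
    define l where "l = e / 8"
    have l: "0 < l" using e by (simp add: l_def)
    have p0: "0 < p" "0 \<le> p" using p by auto
    obtain N :: nat and w where [measurable]: "w \<in> borel_measurable lebesgue" and w: "\<And>x. \<bar>w x\<bar> \<le> real N" "\<And>x. real N < norm x \<Longrightarrow> w x = 0"
      "exp_modular p l (\<lambda>x. u x - w x) \<le> ennreal (1/4)"
      by (rule truncation_approx[OF p0(1) l um fin[OF l], of "1/4"], simp, blast)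
    obtain \<psi> where \<psi>: "continuous_on UNIV \<psi>" "\<And>x. real N + 1 < norm x \<Longrightarrow> \<psi> x = 0"
      "exp_modular p l (\<lambda>x. w x - \<psi> x) \<le> ennreal (1/4)"
      using continuous_approx[OF p0(1) l \<open>w \<in> _\<close> w(1,2), of "1/4"] by auto
    obtain \<phi> where \<phi>: "\<phi> \<in> test_functions" "exp_modular p (2 * l) (\<lambda>x. \<psi> x - \<phi> x) \<le> ennreal (1/4)"
      using test_function_approx[OF \<psi>(1) _ \<psi>(2) p, where l="2 * l" and e="1/4" and R="real N + 1"] l by auto
    have [measurable]: "\<psi> \<in> borel_measurable lebesgue" "\<phi> \<in> borel_measurable lebesgue"
      by (intro borel_imp_lebesgue borel_measurable_continuous_onI \<psi> test_functions_borel \<phi>)+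
    have "exp_modular p (2 * (2 * l)) (\<lambda>x. ((u x - w x) + (w x - \<psi> x)) + (\<psi> x - \<phi> x))
      \<le> exp_modular p (2 * l) (\<lambda>x. (u x - w x) + (w x - \<psi> x)) + exp_modular p (2 * l) (\<lambda>x. \<psi> x - \<phi> x)"
      by (rule exp_modular_add) (use l p in auto)
    also have "\<dots> \<le> (exp_modular p l (\<lambda>x. u x - w x) + exp_modular p l (\<lambda>x. w x - \<psi> x)) + exp_modular p (2 * l) (\<lambda>x. \<psi> x - \<phi> x)"
      by (intro add_right_mono exp_modular_add) (use l p in auto)
    also have "\<dots> \<le> (ennreal (1/4) + ennreal (1/4)) + ennreal (1/4)"
      by (intro add_mono w \<psi> \<phi>)
    also have "\<dots> = ennreal (1/4 + 1/4 + 1/4)" using ennreal_plus[of "1/4" "1/4"] ennreal_plus[of "1/4 + 1/4" "1/4"] by simp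
    also have "\<dots> \<le> 1" unfolding ennreal_le_1 by simp
    finally have "exp_modular p (4 * l) (\<lambda>x. u x - \<phi> x) \<le> 1" by simp
    then have "exp_Lp_norm p (\<lambda>x. u x - \<phi> x) \<le> 4 * l" using l by (intro exp_Lp_norm_le) auto
    also have "\<dots> < e" using e by (simp add: l_def)
    finally show ?thesis using \<phi> by blast
  qed
  show ?thesis using int fin[of 1] approx by (auto simp: exp_Lp0_def exp_Lp_def intro!: exI[of _ 1])
qed

section \<open>Strong continuity of the semigroup\<close>

lemma pow_le_fact_exp_minus_1:
  fixes y :: real assumes "0 \<le> y" "0 < k" shows "y ^ k \<le> fact k * (exp y - 1)"
proof -
  have "(\<Sum>j\<in>{0, k}. y ^ j /\<^sub>R fact j) \<le> (\<Sum>j. y ^ j /\<^sub>R fact j)"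
    by (rule sum_le_suminf) (use assms summable_exp_generic[of y] in auto)
  then have "1 + y ^ k / fact k \<le> exp y" using assms by (simp add: exp_def divide_inverse mult.commute)
  then show ?thesis by (simp add: field_simps)
qed

lemma exp_minus_1_le: fixes y :: real assumes "0 \<le> y" "y \<le> Y" shows "exp y - 1 \<le> y * exp Y"
proof -
  have "1 - y \<le> exp (- y)" using exp_ge_add_one_self[of "- y"] by simp
  then have "(1 - y) * exp y \<le> exp (- y) * exp y" by (rule mult_right_mono) simp
  then have "exp y - 1 \<le> y * exp y" by (simp add: exp_minus algebra_simps)
  also have "\<dots> \<le> y * exp Y" using assms by (intro mult_left_mono) auto
  finally show ?thesis .
qed

text \<open>Up to constants |u|^(p k) is the k-th term of the exponential series at (|u| / l)^p. The
  modular subtracts the zeroth term, hence 0 < k.\<close>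

lemma moment_le_exp_modular:
  assumes l: "0 < l" and k: "0 < k" and [measurable]: "u \<in> borel_measurable borel"
  shows "(\<integral>\<^sup>+x. ennreal (\<bar>u x\<bar> powr (p * real k)) \<partial>lborel) \<le> ennreal (fact k * l powr (p * real k)) * exp_modular p l u"
proof -
  have pw: "\<bar>a\<bar> powr (p * real k) \<le> fact k * l powr (p * real k) * (exp (\<bar>a\<bar> powr p / l powr p) - 1)" for a :: real
  proof -
    have "(\<bar>a\<bar> powr p / l powr p) ^ k \<le> fact k * (exp (\<bar>a\<bar> powr p / l powr p) - 1)"
      by (rule pow_le_fact_exp_minus_1) (use k in auto)
    then have "l powr (p * real k) * (\<bar>a\<bar> powr p / l powr p) ^ k \<le> l powr (p * real k) * (fact k * (exp (\<bar>a\<bar> powr p / l powr p) - 1))"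
      by (rule mult_left_mono) simp
    moreover have "l powr (p * real k) * (\<bar>a\<bar> powr p / l powr p) ^ k = \<bar>a\<bar> powr (p * real k)"
    proof (cases "a = 0")
      case True then show ?thesis using k by (simp add: power_0_left)
    next
      case False
      then show ?thesis using l by (simp add: power_divide powr_realpow[symmetric] powr_powr)
    qed
    ultimately show ?thesis by (simp add: mult_ac)
  qed
  have "(\<integral>\<^sup>+x. ennreal (\<bar>u x\<bar> powr (p * real k)) \<partial>lborel)
     \<le> (\<integral>\<^sup>+x. ennreal (fact k * l powr (p * real k)) * ennreal (exp (\<bar>u x\<bar> powr p / l powr p) - 1) \<partial>lborel)"
    by (intro nn_integral_mono, subst ennreal_mult[symmetric]) (use pw in \<open>auto intro!: ennreal_leI\<close>)
  also have "\<dots> = ennreal (fact k * l powr (p * real k)) * exp_modular p l u"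
    unfolding exp_modular_lborel by (rule nn_integral_cmult) measurable
  finally show ?thesis .
qed

context frac_heat
begin

text \<open>Two levels occur: finiteness at \<open>k\<close> gives the p-th moment that makes the
  convolution converge, and the contraction then holds at every level \<open>l\<close>.\<close>

lemma semigroup_exp_modular:
  assumes t: "0 \<le> t" and p: "1 \<le> p" and [measurable]: "u \<in> borel_measurable borel"
    and fin: "exp_modular p k u < \<infinity>" "0 < k"
  shows "exp_modular p l (heat t u) \<le> exp_modular p l u"
proof -
  have "(\<integral>\<^sup>+x. ennreal (\<bar>u x\<bar> powr p) \<partial>lborel) < \<infinity>"
    using moment_le_exp_modular[OF fin(2) zero_less_one, of u p] fin(1)
    by (auto simp: ennreal_mult_less_top intro: order.strict_trans1)
  then show ?thesis
    unfolding exp_modular_lborel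
    by (intro nn_integral_semigroup_convex[OF t _ p _ convex_on_exp_powr_abs[OF p]]) auto
qed

lemma semigroup_rescaled_0:
  fixes \<phi> :: "'a::euclidean_space \<Rightarrow> real"
  assumes t: "0 \<le> t" and [measurable]: "\<phi> \<in> borel_measurable borel"
  shows "heat t \<phi> x = (\<integral>z. ker 1 z * \<phi> (x - t powr (1 / \<beta>) *\<^sub>R z) \<partial>lborel)"
proof (cases "t = 0")
  case True
  have "(\<integral>z. ker 1 (z::'a) \<partial>lborel) = enn2real (\<integral>\<^sup>+z. ennreal (ker 1 (z::'a)) \<partial>lborel)"
    using frac_heat_kernel_nonneg[OF zero_less_one b] by (intro integral_eq_nn_integral) auto
  then show ?thesis using True
    by (simp add: frac_heat_semigroup_def nn_integral_frac_heat_kernel[OF zero_less_one b])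
qed (use semigroup_rescaled[OF _ assms(2)] t in simp)

lemma kernel_integrable: "integrable lborel (ker 1 :: 'a::euclidean_space \<Rightarrow> real)"
  "(\<integral>z. ker 1 (z::'a::euclidean_space) \<partial>lborel) = 1"
proof -
  have n: "0 \<le> ker 1 (z::'a)" for z by (rule frac_heat_kernel_nonneg[OF zero_less_one b])
  show "integrable lborel (ker 1 :: 'a \<Rightarrow> real)"
    by (rule integrableI_bounded) (use n in \<open>auto simp: nn_integral_frac_heat_kernel[OF zero_less_one b]\<close>)
  have "(\<integral>z. ker 1 (z::'a) \<partial>lborel) = enn2real (\<integral>\<^sup>+z. ennreal (ker 1 (z::'a)) \<partial>lborel)"
    using n by (intro integral_eq_nn_integral) auto
  then show "(\<integral>z. ker 1 (z::'a) \<partial>lborel) = 1"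
    by (simp add: nn_integral_frac_heat_kernel[OF zero_less_one b])
qed

lemma kernel_tail:
  assumes e: "0 < e"
  shows "\<exists>R>0. (\<integral>z. indicator {z. R < norm z} z * ker 1 (z::'a::euclidean_space) \<partial>lborel) < e"
proof -
  let ?K = "ker 1 :: 'a \<Rightarrow> real"
  have "(\<lambda>k. \<integral>z. indicator {z. real (Suc k) < norm z} z * ?K z \<partial>lborel) \<longlonglongrightarrow> (\<integral>z. 0 \<partial>(lborel::'a measure))"
  proof (rule integral_dominated_convergence[where w="?K"])
    show "AE z in lborel. norm (indicator {z. real (Suc k) < norm z} z * ?K z) \<le> ?K z" for k
      using frac_heat_kernel_nonneg[OF zero_less_one b, where 'a='a] by (auto simp: indicator_def)
    show "AE z in lborel. (\<lambda>k. indicator {z. real (Suc k) < norm z} z * ?K z) \<longlonglongrightarrow> 0"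
    proof (rule AE_I2)
      fix z :: 'a
      obtain N :: nat where "norm z \<le> real N" using real_arch_simple by blast
      then have "indicator {z. real (Suc k) < norm z} z * ?K z = 0" if "N \<le> k" for k
        using that by (auto simp: indicator_def)
      then show "(\<lambda>k. indicator {z. real (Suc k) < norm z} z * ?K z) \<longlonglongrightarrow> 0"
        by (intro tendsto_eventually) (auto simp: eventually_sequentially)
    qed
  qed (use kernel_integrable in auto)
  then have "\<forall>\<^sub>F k in sequentially. (\<integral>z. indicator {z. real (Suc k) < norm z} z * ?K z \<partial>lborel) < e"
    using e by (intro order_tendstoD(2)) auto
  then obtain k where "(\<integral>z. indicator {z. real (Suc k) < norm z} z * ?K z \<partial>lborel) < e"
    by (auto simp: eventually_sequentially)
  then show ?thesis by (intro exI[of _ "real (Suc k)"]) auto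
qed

lemma uniformly_continuous_compact_support:
  fixes \<phi> :: "'a::euclidean_space \<Rightarrow> real"
  assumes c: "continuous_on UNIV \<phi>" and R: "\<And>x. R < norm x \<Longrightarrow> \<phi> x = 0" and e: "0 < e"
  shows "\<exists>d>0. \<forall>x y. norm (x - y) < d \<longrightarrow> \<bar>\<phi> x - \<phi> y\<bar> < e"
proof -
  have "uniformly_continuous_on (cball 0 (R + 1)) \<phi>"
    by (intro compact_uniformly_continuous continuous_on_subset[OF c]) auto
  then obtain d where d: "0 < d" "\<And>x y. x \<in> cball 0 (R + 1) \<Longrightarrow> y \<in> cball 0 (R + 1) \<Longrightarrow> dist y x < d \<Longrightarrow> dist (\<phi> y) (\<phi> x) < e"
    unfolding uniformly_continuous_on_def using e by metis
  show ?thesis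
  \<comment> \<open>Points at distance below 1 lie either both in the ball of radius R + 1 or both
    outside the ball of radius R, where the function vanishes.\<close>
  proof (intro exI[of _ "min d 1"] conjI allI impI)
    fix x y :: 'a assume n: "norm (x - y) < min d 1"
    show "\<bar>\<phi> x - \<phi> y\<bar> < e"
    proof (cases "norm x \<le> R + 1 \<and> norm y \<le> R + 1")
      case True then show ?thesis using d(2)[of y x] n by (auto simp: dist_norm)
    next
      case False
      then have "R < norm x" "R < norm y"
        using n norm_triangle_ineq2[of x y] norm_triangle_ineq2[of y x] by (auto simp: norm_minus_commute)
      then show ?thesis using R e by simp
    qed
  qed (use d in auto)
qed

text \<open>In the rescaled representation the increment of \<phi> is small for
  \<open>norm z \<le> S\<close> by uniform continuity, and the remaining z have small kernel mass.
  Both estimates are uniform in x.\<close>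

lemma semigroup_uniform_continuity:
  fixes \<phi> :: "'a::euclidean_space \<Rightarrow> real"
  assumes c: "continuous_on UNIV \<phi>" and R: "\<And>x. R < norm x \<Longrightarrow> \<phi> x = 0" and M: "\<And>x. \<bar>\<phi> x\<bar> \<le> M"
    and t0: "0 \<le> t0" and e: "0 < e"
  shows "\<exists>d>0. \<forall>t\<ge>0. \<bar>t - t0\<bar> < d \<longrightarrow> (\<forall>x. \<bar>heat t \<phi> x - heat t0 \<phi> x\<bar> \<le> e)"
proof -
  let ?K = "ker 1 :: 'a \<Rightarrow> real"
  have Kn: "0 \<le> ?K z" for z by (rule frac_heat_kernel_nonneg[OF zero_less_one b])
  have [measurable]: "\<phi> \<in> borel_measurable borel" by (rule borel_measurable_continuous_onI[OF c])
  have M0: "0 \<le> M" using M[of 0] by linarith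
  \<comment> \<open>The tail enters with the factor 2 M; this bound on its mass makes its share at
    most e / 2.\<close>
  obtain S where S: "0 < S" "(\<integral>z. indicator {z. S < norm z} z * ?K z \<partial>lborel) < e / (4 * (M + 1))"
    using kernel_tail[of "e / (4 * (M + 1))"] e M0 by auto
  obtain d1 where d1: "0 < d1" "\<And>x y. norm (x - y) < d1 \<Longrightarrow> \<bar>\<phi> x - \<phi> y\<bar> < e / 2"
    using uniformly_continuous_compact_support[OF c R half_gt_zero[OF e]] by blast
  have "continuous_on {0..} (\<lambda>t::real. t powr (1 / \<beta>))"
    using b by (intro continuous_on_powr') (auto intro: continuous_intros)
  then obtain d where d: "0 < d" "\<And>t. 0 \<le> t \<Longrightarrow> \<bar>t - t0\<bar> < d \<Longrightarrow> \<bar>t powr (1 / \<beta>) - t0 powr (1 / \<beta>)\<bar> < d1 / S"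
    using t0 d1(1) S(1) unfolding continuous_on_iff dist_real_def by (metis atLeast_iff divide_pos_pos)
  show ?thesis
  proof (intro exI[of _ d] conjI allI impI)
    fix t x assume t: "0 \<le> t" "\<bar>t - t0\<bar> < d"
    let ?c = "t powr (1 / \<beta>)" and ?cz = "t0 powr (1 / \<beta>)"
    have i: "integrable lborel (\<lambda>z. ?K z * \<phi> (x - a *\<^sub>R z))" for a
    proof (rule Bochner_Integration.integrable_bound[OF integrable_mult_right[OF kernel_integrable(1), of M]])
      show "AE z in lborel. norm (?K z * \<phi> (x - a *\<^sub>R z)) \<le> norm (M * ?K z)"
        using Kn M M0 by (auto simp: abs_mult mult.commute[of M] intro!: AE_I2 mult_left_mono)
    qed measurable
    let ?D = "\<lambda>z. ?K z * (\<phi> (x - ?c *\<^sub>R z) - \<phi> (x - ?cz *\<^sub>R z))"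
    have iD: "integrable lborel ?D"
      unfolding right_diff_distrib by (intro Bochner_Integration.integrable_diff i)
    have iI: "integrable lborel (\<lambda>z. indicator {z. S < norm z} z * ?K z)"
      by (rule Bochner_Integration.integrable_bound[OF kernel_integrable(1)]) (auto simp: indicator_def)
    have "(\<integral>z. ?D z \<partial>lborel) = (\<integral>z. ?K z * \<phi> (x - ?c *\<^sub>R z) \<partial>lborel) - (\<integral>z. ?K z * \<phi> (x - ?cz *\<^sub>R z) \<partial>lborel)"
      unfolding right_diff_distrib by (rule Bochner_Integration.integral_diff[OF i i])
    then have "heat t \<phi> x - heat t0 \<phi> x = (\<integral>z. ?D z \<partial>lborel)"
      unfolding semigroup_rescaled_0[OF t(1) \<open>\<phi> \<in> _\<close>] semigroup_rescaled_0[OF t0 \<open>\<phi> \<in> _\<close>] by (rule sym)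
    also have "\<bar>\<dots>\<bar> \<le> (\<integral>z. norm (?D z) \<partial>lborel)" using integral_norm_bound[of lborel ?D] by simp
    also have "\<dots> \<le> (\<integral>z. (e / 2) * ?K z + (2 * M) * (indicator {z. S < norm z} z * ?K z) \<partial>lborel)"
    proof (rule integral_mono)
      show "integrable lborel (\<lambda>z. norm (?D z))" using iD by (rule integrable_norm)
      show "integrable lborel (\<lambda>z. (e / 2) * ?K z + (2 * M) * (indicator {z. S < norm z} z * ?K z))"
        by (intro Bochner_Integration.integrable_add integrable_mult_right kernel_integrable iI)
      fix z :: 'a
      have "\<bar>\<phi> (x - ?c *\<^sub>R z) - \<phi> (x - ?cz *\<^sub>R z)\<bar> \<le> e / 2 + 2 * M * indicator {z. S < norm z} z"
      proof (cases "S < norm z")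
        case True
        then show ?thesis using M[of "x - ?c *\<^sub>R z"] M[of "x - ?cz *\<^sub>R z"] e by simp
      next
        case False
        have "norm ((x - ?c *\<^sub>R z) - (x - ?cz *\<^sub>R z)) = \<bar>?c - ?cz\<bar> * norm z"
          by (simp add: scaleR_diff_left[symmetric] norm_minus_commute abs_minus_commute)
        also have "\<dots> \<le> \<bar>?c - ?cz\<bar> * S" using False by (intro mult_left_mono) auto
        also have "\<dots> < (d1 / S) * S" using d(2)[OF t] S(1) by (intro mult_strict_right_mono)
        also have "\<dots> = d1" using S(1) by simp
        finally have "\<bar>\<phi> (x - ?c *\<^sub>R z) - \<phi> (x - ?cz *\<^sub>R z)\<bar> < e / 2" by (rule d1(2))
        then show ?thesis using False by simp
      qed
      then have "?K z * \<bar>\<phi> (x - ?c *\<^sub>R z) - \<phi> (x - ?cz *\<^sub>R z)\<bar> \<le> ?K z * (e / 2 + 2 * M * indicator {z. S < norm z} z)"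
        by (rule mult_left_mono[OF _ Kn])
      then show "norm (?D z) \<le> (e / 2) * ?K z + (2 * M) * (indicator {z. S < norm z} z * ?K z)"
        unfolding real_norm_def abs_mult abs_of_nonneg[OF Kn] by (simp add: distrib_left mult_ac)
    qed
    also have "\<dots> = e / 2 + 2 * M * (\<integral>z. indicator {z. S < norm z} z * ?K z \<partial>lborel)"
      using kernel_integrable iI by (subst Bochner_Integration.integral_add) auto
    also have "\<dots> \<le> e / 2 + 2 * M * (e / (4 * (M + 1)))" using S M0 by (intro add_left_mono mult_left_mono) auto
    also have "\<dots> \<le> e" using M0 e by (simp add: field_simps)
    finally show "\<bar>heat t \<phi> x - heat t0 \<phi> x\<bar> \<le> e" .
  qed (use d in auto)
qed

text \<open>A small supremum \<eta> and a bounded L^1 norm interpolate: |h|^p \<le> \<eta>^(p-1)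
  |h|, and p > 1 makes the power of \<eta> small.\<close>

lemma semigroup_continuity_test:
  fixes \<phi> :: "'a::euclidean_space \<Rightarrow> real"
  assumes \<phi>: "\<phi> \<in> test_functions" and p: "1 < p" and l: "0 < l" and t0: "0 \<le> t0"
  shows "\<exists>d>0. \<forall>t\<ge>0. \<bar>t - t0\<bar> < d \<longrightarrow> exp_modular p l (\<lambda>x. heat t \<phi> x - heat t0 \<phi> x) \<le> 1"
proof -
  obtain R M where c: "continuous_on UNIV \<phi>" and R: "0 < R" "\<And>x. R < norm x \<Longrightarrow> \<phi> x = 0" and M: "0 < M" "\<And>x. \<bar>\<phi> x\<bar> \<le> M"
    using test_functions_D[OF \<phi>] by metis
  have [measurable]: "\<phi> \<in> borel_measurable borel" by (rule test_functions_borel[OF \<phi>])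
  have "(\<integral>\<^sup>+x. ennreal \<bar>\<phi> x\<bar> \<partial>lborel) \<le> (\<integral>\<^sup>+x. ennreal M * indicator (cball (0::'a) R) x \<partial>lborel)"
    by (intro nn_integral_mono) (use R M in \<open>auto simp: indicator_def not_le intro!: ennreal_leI\<close>)
  also have "\<dots> < \<infinity>" using emeasure_lborel_cball_finite[of "0::'a" R]
    by (subst nn_integral_cmult_indicator) (auto simp: ennreal_mult_less_top less_top)
  finally have fin: "(\<integral>\<^sup>+x. ennreal \<bar>\<phi> x\<bar> \<partial>lborel) < \<infinity>" .
  then obtain A where A: "0 \<le> A" "(\<integral>\<^sup>+x. ennreal \<bar>\<phi> x\<bar> \<partial>lborel) = ennreal A"
    by (cases "\<integral>\<^sup>+x. ennreal \<bar>\<phi> x\<bar> \<partial>lborel") auto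
  have L1: "(\<integral>\<^sup>+x. ennreal \<bar>heat t \<phi> x\<bar> \<partial>lborel) \<le> ennreal A" if "0 \<le> t" for t
    using nn_integral_semigroup_convex[OF that _ order_refl _ convex_on_powr_abs[OF order_refl], of \<phi>] fin A by simp
  \<comment> \<open>A bound for \<eta>^(p-1) that makes the modular integrand at most |h| / (2 A +
    1), while the L^1 norm of h is at most 2 A. In the next line \<eta> \<le> l keeps the exponent
    at most 1, where exp y - 1 \<le> e y.\<close>
  define X where "X = l powr p / (exp 1 * (2 * A + 1))"
  define \<eta> where "\<eta> = min l (X powr (1 / (p - 1)))"
  have X: "0 < X" using l A by (simp add: X_def)
  have \<eta>: "0 < \<eta>" "\<eta> \<le> l" using X l by (auto simp: \<eta>_def)
  have \<eta>X: "\<eta> powr (p - 1) \<le> X"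
  proof -
    have "\<eta> powr (p - 1) \<le> (X powr (1 / (p - 1))) powr (p - 1)"
      using p \<eta> by (intro powr_mono2) (auto simp: \<eta>_def)
    also have "\<dots> = X" using p X by (simp add: powr_powr)
    finally show ?thesis .
  qed
  obtain d where d: "0 < d" "\<And>t x. 0 \<le> t \<Longrightarrow> \<bar>t - t0\<bar> < d \<Longrightarrow> \<bar>heat t \<phi> x - heat t0 \<phi> x\<bar> \<le> \<eta>"
    using semigroup_uniform_continuity[OF c R(2) M(2) t0 \<eta>(1)] by blast
  show ?thesis
  proof (intro exI[of _ d] conjI allI impI)
    fix t assume t: "0 \<le> t" "\<bar>t - t0\<bar> < d"
    let ?u = "heat t \<phi>" and ?v = "heat t0 \<phi>"
    have [measurable]: "?u \<in> borel_measurable borel" "?v \<in> borel_measurable borel" by (intro semigroup_measurable, measurable)+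
    have pw: "exp (\<bar>?u x - ?v x\<bar> powr p / l powr p) - 1 \<le> 1 / (2 * A + 1) * \<bar>?u x\<bar> + 1 / (2 * A + 1) * \<bar>?v x\<bar>" for x
    proof -
      let ?h = "\<bar>?u x - ?v x\<bar>"
      have h: "?h \<le> \<eta>" using d(2)[OF t] by simp
      have "?h powr p \<le> l powr p" using h \<eta> p by (intro powr_mono2) auto
      then have "exp (?h powr p / l powr p) - 1 \<le> (?h powr p / l powr p) * exp 1"
        using l by (intro exp_minus_1_le) auto
      also have "(?h powr p / l powr p) * exp 1 = ?h powr (p - 1) * ?h / l powr p * exp 1"
        using powr_add[of ?h "p - 1" 1] by (cases "?h = 0") auto
      also have "?h powr (p - 1) * ?h / l powr p * exp 1 \<le> X * ?h / l powr p * exp 1"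
        using \<eta>X powr_mono2[of "p - 1" ?h \<eta>] h p
        by (intro mult_right_mono divide_right_mono) auto
      also have "\<dots> = 1 / (2 * A + 1) * ?h"
      proof -
        define D where "D = 2 * A + 1"
        have "0 < D" using A by (simp add: D_def)
        then show ?thesis unfolding X_def D_def[symmetric] using l by (simp add: field_simps)
      qed
      also have "\<dots> \<le> 1 / (2 * A + 1) * (\<bar>?u x\<bar> + \<bar>?v x\<bar>)" using A by (intro mult_left_mono) auto
      finally show ?thesis by (simp add: distrib_left)
    qed
    have "exp_modular p l (\<lambda>x. ?u x - ?v x) \<le> (\<integral>\<^sup>+x. ennreal (1 / (2 * A + 1)) * ennreal \<bar>?u x\<bar> + ennreal (1 / (2 * A + 1)) * ennreal \<bar>?v x\<bar> \<partial>lborel)"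
      unfolding exp_modular_lborel
    proof (rule nn_integral_mono)
      fix x
      have "ennreal (exp (\<bar>?u x - ?v x\<bar> powr p / l powr p) - 1) \<le> ennreal (1 / (2 * A + 1) * \<bar>?u x\<bar> + 1 / (2 * A + 1) * \<bar>?v x\<bar>)"
        by (rule ennreal_leI[OF pw])
      also have "\<dots> = ennreal (1 / (2 * A + 1)) * ennreal \<bar>?u x\<bar> + ennreal (1 / (2 * A + 1)) * ennreal \<bar>?v x\<bar>"
        using A by (simp add: ennreal_plus ennreal_mult[symmetric])
      finally show "ennreal (exp (\<bar>?u x - ?v x\<bar> powr p / l powr p) - 1) \<le> \<dots>" .
    qed
    also have "\<dots> = ennreal (1 / (2 * A + 1)) * (\<integral>\<^sup>+x. ennreal \<bar>?u x\<bar> \<partial>lborel) + ennreal (1 / (2 * A + 1)) * (\<integral>\<^sup>+x. ennreal \<bar>?v x\<bar> \<partial>lborel)"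
      by (subst nn_integral_add, measurable) (subst (1 2) nn_integral_cmult, measurable)
    also have "\<dots> \<le> ennreal (1 / (2 * A + 1)) * ennreal A + ennreal (1 / (2 * A + 1)) * ennreal A"
      by (intro add_mono mult_left_mono L1 t t0) auto
    also have "\<dots> = ennreal (2 * A / (2 * A + 1))"
      using A by (simp add: ennreal_mult[symmetric] ennreal_plus[symmetric] add_divide_distrib[symmetric] del: ennreal_plus)
    also have "\<dots> \<le> 1" using A by (simp add: ennreal_le_1)
    finally show "exp_modular p l (\<lambda>x. ?u x - ?v x) \<le> 1" .
  qed (use d in auto)
qed

text \<open>Three thirds: at both times the semigroup does not enlarge u - \<phi>, and the test
  function \<phi> moves continuously.\<close>

lemma semigroup_strong_continuity:
  fixes u :: "'a::euclidean_space \<Rightarrow> real"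
  assumes u: "u \<in> exp_Lp0 p" and um[measurable]: "u \<in> borel_measurable borel" and p: "1 < p" and l: "0 < l" and t0: "0 \<le> t0"
  shows "\<exists>d>0. \<forall>t\<ge>0. \<bar>t - t0\<bar> < d \<longrightarrow> exp_modular p l (\<lambda>x. heat t u x - heat t0 u x) \<le> 1"
proof -
  have p1: "1 \<le> p" using p by simp
  obtain \<phi> where \<phi>: "\<phi> \<in> test_functions" "exp_modular p (l / 3) (\<lambda>x. u x - \<phi> x) \<le> 1"
    using exp_Lp0_approx[OF u p1, of "l / 3"] l by auto
  have \<phi>m[measurable]: "\<phi> \<in> borel_measurable borel" by (rule test_functions_borel[OF \<phi>(1)])
  obtain d where d: "0 < d" "\<And>t. 0 \<le> t \<Longrightarrow> \<bar>t - t0\<bar> < d \<Longrightarrow> exp_modular p (l / 3) (\<lambda>x. heat t \<phi> x - heat t0 \<phi> x) \<le> 1"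
    using semigroup_continuity_test[OF \<phi>(1) p, of "l / 3" t0] l t0 by auto
  have fin: "(\<integral>\<^sup>+x. ennreal (\<bar>u x\<bar> powr p) \<partial>lborel) < \<infinity>" "(\<integral>\<^sup>+x. ennreal (\<bar>\<phi> x\<bar> powr p) \<partial>lborel) < \<infinity>"
    using moment_le_exp_modular[OF zero_less_one zero_less_one um, of p] exp_Lp0_modular_finite[OF u p1 zero_less_one]
      moment_le_exp_modular[OF zero_less_one zero_less_one \<phi>m, of p] exp_modular_test_finite[OF \<phi>(1), of p 1] p
    by (auto intro: order.strict_trans1)
  let ?H = "heat"
  have lin: "?H t (\<lambda>y. u y - \<phi> y) x = ?H t u x - ?H t \<phi> x" if "0 \<le> t" for t x
    using semigroup_diff[OF _ um \<phi>m p1 p1 fin, of t x] that by (cases "t = 0") (auto simp: frac_heat_semigroup_def)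
  have [measurable]: "?H t u \<in> borel_measurable borel" "?H t \<phi> \<in> borel_measurable borel" for t
    by (intro semigroup_measurable, measurable)+
  have D: "exp_modular p (l / 3) (\<lambda>x. ?H t u x - ?H t \<phi> x) \<le> 1" if "0 \<le> t" for t
  proof -
    have "exp_modular p (l / 3) (?H t (\<lambda>y. u y - \<phi> y)) \<le> exp_modular p (l / 3) (\<lambda>y. u y - \<phi> y)"
      by (rule semigroup_exp_modular[OF that p1, of _ "l / 3"]) (use \<phi>(2) l in \<open>auto intro: order.strict_trans1\<close>)
    also have "?H t (\<lambda>y. u y - \<phi> y) = (\<lambda>x. ?H t u x - ?H t \<phi> x)" using lin[OF that] by auto
    finally show ?thesis using \<phi>(2) by (rule order_trans)
  qed
  show ?thesis
  proof (intro exI[of _ d] conjI allI impI)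
    fix t assume t: "0 \<le> t" "\<bar>t - t0\<bar> < d"
    have "exp_modular p ((l / 3 + l / 3) + l / 3) (\<lambda>x. ((?H t u x - ?H t \<phi> x) + (?H t \<phi> x - ?H t0 \<phi> x)) + (?H t0 \<phi> x - ?H t0 u x)) \<le> 1"
      by (intro exp_modular_triangle borel_imp_lebesgue p1 D d t)
         (use D[OF t0] l in \<open>auto simp: exp_modular_uminus[of p _ "?H t0 \<phi>"]\<close>)
    then show "exp_modular p l (\<lambda>x. ?H t u x - ?H t0 u x) \<le> 1" by simp
  qed (use d in auto)
qed

end

section \<open>The nonlinearity\<close>

lemma exp_le_max_sum:
  fixes a b :: real assumes "0 \<le> a" "0 \<le> b"
  shows "exp (max a b) - 1 \<le> (exp a - 1) + (exp b - 1)"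
  using assms by (cases "a \<le> b") (simp_all add: max_def)

text \<open>The condition on \<open>k\<close> says that q = p k exceeds n / \<beta>, which makes the
  smoothing rate t^(-n/(\<beta> q)) integrable at 0; as \<open>k\<close> is a natural number,
  moments of order p k are terms of the exponential series. The parameter \<open>space_type\<close>
  fixes the space whose dimension enters this condition.\<close>

locale frac_heat_nonlinear = frac_heat \<beta> for \<beta> +
  fixes p C lam :: real and f :: "real \<Rightarrow> real" and k :: nat and space_type :: "'a::euclidean_space itself"
  assumes p: "1 < p" and f0: "f 0 = 0" and C: "0 < C" and lam: "0 < lam"
    and lip: "\<And>u v. \<bar>f u - f v\<bar> \<le> C * \<bar>u - v\<bar> * (exp (lam * \<bar>u\<bar> powr p) + exp (lam * \<bar>v\<bar> powr p))"
    and k: "0 < k" "real DIM('a) < \<beta> * (p * real k)"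
begin

lemma p1: "1 \<le> p" and p0: "0 < p" using p by auto

text \<open>The weights in the Lipschitz bound are locally bounded. Continuity is what gives Borel
  measurability of \<open>f\<close>.\<close>

lemma f_continuous: "continuous_on UNIV f"
proof (rule continuous_at_imp_continuous_on, rule ballI)
  fix x
  have "((\<lambda>y. C * \<bar>y - x\<bar> * (exp (lam * \<bar>y\<bar> powr p) + exp (lam * \<bar>x\<bar> powr p))) \<longlongrightarrow>
     C * \<bar>x - x\<bar> * (exp (lam * \<bar>x\<bar> powr p) + exp (lam * \<bar>x\<bar> powr p))) (at x)"
    using p0 by (intro tendsto_intros tendsto_powr2[OF _ tendsto_const]) (auto intro: tendsto_intros)
  then have z: "((\<lambda>y. C * \<bar>y - x\<bar> * (exp (lam * \<bar>y\<bar> powr p) + exp (lam * \<bar>x\<bar> powr p))) \<longlongrightarrow> 0) (at x)" by simp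
  have "((\<lambda>y. f y - f x) \<longlongrightarrow> 0) (at x)"
    by (rule Lim_null_comparison[OF _ z]) (use lip in auto)
  then show "isCont f x" by (simp add: isCont_def LIM_zero_iff)
qed

lemma f_measurable [measurable]: "f \<in> borel_measurable borel"
  by (rule borel_measurable_continuous_onI[OF f_continuous])

text \<open>The level at which the modular dominates the Lipschitz weights: (|a| / l0)^p = 2 lam p k
  |a|^p, and exp of half of this is exp (lam |a|^p) to the power p k. The factor 2 leaves room for
  squaring that weight in \<open>f_lipschitz_pointwise\<close>.\<close>

definition l0 :: real where "l0 = (1 / (2 * lam * p * real k)) powr (1 / p)"

lemma l0_pos: "0 < l0" unfolding l0_def using lam p k by simp

lemma l0_powr: "a / l0 powr p = 2 * lam * p * real k * a"
  unfolding l0_def using lam p k by (simp add: powr_powr)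

text \<open>The factorials come from Y^j \<le> j! (exp Y - 1) and the same bound for Y^(2j); the 2
  in the power comes from replacing the sum of two weights by twice the larger.\<close>

definition lipc :: "nat \<Rightarrow> real" where
  "lipc j = (2 * C) powr (p * real j) * (fact (2 * j) + fact j + 1)"

lemma lipc_nonneg: "0 \<le> lipc j" by (simp add: lipc_def)

text \<open>With \<open>Y = \<bar>a - b\<bar>\<^sup>p / l\<^sup>p\<close>, the product of \<open>Y\<^sup>j\<close> and the exponential weight is split by
  the arithmetic-geometric mean inequality, which replaces Hoelder's inequality.\<close>

lemma f_lipschitz_pointwise:
  assumes l: "0 < l" and j: "0 < j" "j \<le> k"
  shows "\<bar>f a - f b\<bar> powr (p * real j) \<le> lipc j * l powr (p * real j) *
     ((exp (\<bar>a - b\<bar> powr p / l powr p) - 1) + (exp (\<bar>a\<bar> powr p / l0 powr p) - 1) + (exp (\<bar>b\<bar> powr p / l0 powr p) - 1))"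
proof -
  define Y where "Y = \<bar>a - b\<bar> powr p / l powr p"
  define m where "m = max (\<bar>a\<bar> powr p) (\<bar>b\<bar> powr p)"
  define A where "A = m / l0 powr p"
  let ?r = "p * real j"
  have Y0: "0 \<le> Y" by (simp add: Y_def)
  have m0: "0 \<le> m" by (simp add: m_def le_max_iff_disj)
  have A0: "0 \<le> A" using m0 by (simp add: A_def)
  have r0: "0 < ?r" using p j by simp
  have "exp (lam * \<bar>a\<bar> powr p) + exp (lam * \<bar>b\<bar> powr p) \<le> exp (lam * m) + exp (lam * m)"
    using lam by (intro add_mono) (simp_all add: m_def)
  then have "\<bar>f a - f b\<bar> \<le> C * \<bar>a - b\<bar> * (2 * exp (lam * m))"
    using lip[of a b] C by (intro order_trans[OF lip] mult_left_mono) auto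
  then have "\<bar>f a - f b\<bar> powr ?r \<le> (C * \<bar>a - b\<bar> * (2 * exp (lam * m))) powr ?r"
    using r0 by (intro powr_mono2) auto
  also have "C * \<bar>a - b\<bar> * (2 * exp (lam * m)) = (2 * C) * \<bar>a - b\<bar> * exp (lam * m)" by simp
  also have "\<dots> powr ?r = (2 * C) powr ?r * \<bar>a - b\<bar> powr ?r * exp (lam * m) powr ?r"
    using C by (simp add: powr_mult)
  also have "exp (lam * m) powr ?r = exp (lam * m * ?r)" by (simp add: powr_def)
  also have "\<bar>a - b\<bar> powr ?r = l powr ?r * Y ^ j"
  proof (cases "a = b")
    case True then show ?thesis using j p by (simp add: Y_def power_0_left)
  next
    case False
    then show ?thesis using l by (simp add: Y_def power_divide powr_realpow[symmetric] powr_powr)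
  qed
  also have "(2 * C) powr ?r * (l powr ?r * Y ^ j) * exp (lam * m * ?r) = (2 * C) powr ?r * l powr ?r * (Y ^ j * exp (lam * m * ?r))"
    by simp
  also have "\<dots> \<le> (2 * C) powr ?r * l powr ?r * ((fact (2 * j) + fact j + 1) * ((exp Y - 1) + (exp A - 1)))"
  proof (rule mult_left_mono)
    have "lam * m * ?r \<le> lam * m * (p * real k)" using lam m0 p j by (intro mult_left_mono) auto
    also have "\<dots> = A / 2" unfolding A_def l0_powr by simp
    finally have e: "exp (lam * m * ?r) \<le> exp (A / 2)" by simp
    have sq: "(exp (A / 2) - 1)\<^sup>2 \<le> exp A - 1"
    proof -
      have "exp A = (exp (A / 2))\<^sup>2" by (simp add: power2_eq_square exp_add[symmetric])
      then show ?thesis using A0 by (simp add: power2_diff)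
    qed
    have Yj: "Y ^ j \<le> fact j * (exp Y - 1)" "Y ^ (2 * j) \<le> fact (2 * j) * (exp Y - 1)"
      using j Y0 by (intro pow_le_fact_exp_minus_1, auto)+
    have "Y ^ j * exp (lam * m * ?r) \<le> Y ^ j * exp (A / 2)" using e Y0 by (intro mult_left_mono) auto
    \<comment> \<open>The weight tends to 1, not to 0, where u and v are small. Separating its
      excess over 1 leaves terms bounded by multiples of exp - 1, which are integrable over the
      whole space.\<close>
    also have "\<dots> = Y ^ j * (exp (A / 2) - 1) + Y ^ j" by (simp add: algebra_simps)
    also have "Y ^ j * (exp (A / 2) - 1) \<le> Y ^ (2 * j) + (exp (A / 2) - 1)\<^sup>2"
    proof -
      have "2 * (Y ^ j * (exp (A / 2) - 1)) \<le> (Y ^ j)\<^sup>2 + (exp (A / 2) - 1)\<^sup>2"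
        using sum_squares_bound[of "Y ^ j" "exp (A / 2) - 1"] by (simp add: mult.assoc)
      moreover have "(Y ^ j)\<^sup>2 = Y ^ (2 * j)" by (simp add: power_mult[symmetric] mult.commute)
      moreover have "0 \<le> Y ^ j * (exp (A / 2) - 1)" using Y0 A0 by simp
      ultimately show ?thesis by linarith
    qed
    finally have "Y ^ j * exp (lam * m * ?r) \<le> fact (2 * j) * (exp Y - 1) + (exp A - 1) + fact j * (exp Y - 1)"
      using Yj sq by linarith
    also have "\<dots> \<le> (fact (2 * j) + fact j + 1) * ((exp Y - 1) + (exp A - 1))"
    proof -
      have "0 \<le> (fact (2 * j) + fact j) * (exp A - 1)" "0 \<le> exp Y - 1" using A0 Y0 by simp_all
      moreover have "(fact (2 * j) + fact j + 1) * ((exp Y - 1) + (exp A - 1)) =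
        fact (2 * j) * (exp Y - 1) + (exp A - 1) + fact j * (exp Y - 1) + (fact (2 * j) + fact j) * (exp A - 1) + (exp Y - 1)"
        by (simp add: algebra_simps)
      ultimately show ?thesis by linarith
    qed
    finally show "Y ^ j * exp (lam * m * ?r) \<le> (fact (2 * j) + fact j + 1) * ((exp Y - 1) + (exp A - 1))" .
  qed simp
  also have "\<dots> = lipc j * l powr ?r * ((exp Y - 1) + (exp A - 1))" by (simp add: lipc_def)
  also have "\<dots> \<le> lipc j * l powr ?r * ((exp Y - 1) + ((exp (\<bar>a\<bar> powr p / l0 powr p) - 1) + (exp (\<bar>b\<bar> powr p / l0 powr p) - 1)))"
  proof (intro mult_left_mono add_left_mono)
    have "A = max (\<bar>a\<bar> powr p / l0 powr p) (\<bar>b\<bar> powr p / l0 powr p)"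
      using l0_pos by (simp add: A_def m_def max_divide_distrib_right)
    then show "exp A - 1 \<le> (exp (\<bar>a\<bar> powr p / l0 powr p) - 1) + (exp (\<bar>b\<bar> powr p / l0 powr p) - 1)"
      using exp_le_max_sum[of "\<bar>a\<bar> powr p / l0 powr p" "\<bar>b\<bar> powr p / l0 powr p"] by simp
  qed (use lipc_nonneg in auto)
  finally show ?thesis by (simp add: Y_def add.assoc)
qed

text \<open>A common bound \<open>A\<close> for the norms in L^p and L^(p k), which control the p-th
  moment and the supremum of the Duhamel term. Comparing powers keeps the condition free of
  roots.\<close>

definition bnd :: "('a \<Rightarrow> real) \<Rightarrow> real \<Rightarrow> bool" where
  "bnd h A \<longleftrightarrow> h \<in> borel_measurable borel \<and> 0 \<le> A \<and>
     (\<forall>j\<in>{1, k}. (\<integral>\<^sup>+x. ennreal (\<bar>h x\<bar> powr (p * real j)) \<partial>lborel) \<le> ennreal (A powr (p * real j)))"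

text \<open>The summand 1 makes the constant at least 1, hence at most its own r-th power for r
  \<ge> 1, so that it serves as norm bound for both exponents.\<close>

definition lipL :: "real \<Rightarrow> real" where "lipL K = 1 + (lipc 1 + lipc k) * (1 + 2 * K)"

lemma lipL_ge_1: "0 \<le> K \<Longrightarrow> 1 \<le> lipL K"
  unfolding lipL_def using lipc_nonneg[of 1] lipc_nonneg[of k] by simp

text \<open>The difference u - v is measured at its own level l, which factors out linearly, while
  the weights are paid for at the fixed level \<open>l0\<close>. Hence a Lipschitz bound wherever
  the modular at \<open>l0\<close> is bounded.\<close>

lemma f_lipschitz:
  assumes [measurable]: "u \<in> borel_measurable borel" "v \<in> borel_measurable borel"
    and l: "0 < l" and K: "0 \<le> K" and uv: "exp_modular p l (\<lambda>x. u x - v x) \<le> 1"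
    and u: "exp_modular p l0 u \<le> ennreal K" and v: "exp_modular p l0 v \<le> ennreal K"
  shows "bnd (\<lambda>x. f (u x) - f (v x)) (lipL K * l)"
  unfolding bnd_def
proof (intro conjI ballI)
  show "(\<lambda>x. f (u x) - f (v x)) \<in> borel_measurable borel" by measurable
  show "0 \<le> lipL K * l" using lipL_ge_1[OF K] l by simp
  fix j assume "j \<in> {1, k}"
  then have j: "0 < j" "j \<le> k" "lipc j \<le> lipc 1 + lipc k" using k lipc_nonneg by auto
  let ?r = "p * real j"
  let ?c = "lipc j * l powr ?r"
  let ?E = "\<lambda>l y. exp (\<bar>y\<bar> powr p / l powr p) - 1"
  have r: "1 \<le> ?r" using p j mult_mono[of 1 p 1 "real j"] by simp
  have c: "0 \<le> ?c" using lipc_nonneg by simp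
  have en: "ennreal (c * (x + y + z)) = ennreal c * ((ennreal x + ennreal y) + ennreal z)"
    if "0 \<le> c" "0 \<le> x" "0 \<le> y" "0 \<le> z" for c x y z :: real
    using that by (simp add: ennreal_mult ennreal_plus)
  have "(\<integral>\<^sup>+x. ennreal (\<bar>f (u x) - f (v x)\<bar> powr ?r) \<partial>lborel)
    \<le> (\<integral>\<^sup>+x. ennreal ?c * ((ennreal (?E l (u x - v x)) + ennreal (?E l0 (u x))) + ennreal (?E l0 (v x))) \<partial>lborel)"
  proof (rule nn_integral_mono)
    fix x
    have "ennreal (\<bar>f (u x) - f (v x)\<bar> powr ?r) \<le> ennreal (?c * (?E l (u x - v x) + ?E l0 (u x) + ?E l0 (v x)))"
      by (rule ennreal_leI[OF f_lipschitz_pointwise[OF l j(1,2)]])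
    also have "\<dots> = ennreal ?c * ((ennreal (?E l (u x - v x)) + ennreal (?E l0 (u x))) + ennreal (?E l0 (v x)))"
      by (rule en) (use c in auto)
    finally show "ennreal (\<bar>f (u x) - f (v x)\<bar> powr ?r) \<le> \<dots>" .
  qed
  also have "\<dots> = ennreal ?c * ((exp_modular p l (\<lambda>x. u x - v x) + exp_modular p l0 u) + exp_modular p l0 v)"
    unfolding exp_modular_lborel by (subst nn_integral_cmult, measurable) (subst nn_integral_add, measurable)+
  also have "\<dots> \<le> ennreal ?c * ((1 + ennreal K) + ennreal K)" by (intro mult_left_mono add_mono uv u v) simp
  also have "(1 + ennreal K) + ennreal K = ennreal (1 + 2 * K)"
  proof -
    have "ennreal (1 + 2 * K) = ennreal (1 + K + K)" by (rule arg_cong[of _ _ ennreal]) simp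
    also have "\<dots> = ennreal (1 + K) + ennreal K" by (rule ennreal_plus) (use K in auto)
    also have "ennreal (1 + K) = 1 + ennreal K" using K ennreal_plus[of 1 K] by simp
    finally show ?thesis by simp
  qed
  also have "ennreal ?c * ennreal (1 + 2 * K) = ennreal (?c * (1 + 2 * K))"
    by (rule ennreal_mult[symmetric]) (use c K in auto)
  also have "\<dots> \<le> ennreal ((lipL K * l) powr ?r)"
  proof (rule ennreal_leI)
    have "?c * (1 + 2 * K) = (lipc j * (1 + 2 * K)) * l powr ?r" by simp
    also have "\<dots> \<le> ((lipc 1 + lipc k) * (1 + 2 * K)) * l powr ?r" using j K by (intro mult_right_mono) auto
    also have "\<dots> \<le> lipL K * l powr ?r" by (intro mult_right_mono) (auto simp: lipL_def)
    also have "\<dots> \<le> lipL K powr ?r * l powr ?r"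
      using lipL_ge_1[OF K] powr_mono[of 1 ?r "lipL K"] r by (intro mult_right_mono) auto
    also have "\<dots> = (lipL K * l) powr ?r" by (rule powr_mult[symmetric])
    finally show "?c * (1 + 2 * K) \<le> (lipL K * l) powr ?r" .
  qed
  finally show "(\<integral>\<^sup>+x. ennreal (\<bar>f (u x) - f (v x)\<bar> powr ?r) \<partial>lborel) \<le> ennreal ((lipL K * l) powr ?r)" .
qed

lemma f_bnd:
  assumes [measurable]: "u \<in> borel_measurable borel" and K: "0 \<le> K" and u: "exp_modular p l0 u \<le> ennreal K"
  shows "bnd (\<lambda>x. f (u x)) (lipL K * (max 1 K * l0))"
proof -
  have "exp_modular p (max 1 K * l0) u \<le> 1"
    by (rule exp_modular_le_1_exists[OF p1 l0_pos borel_imp_lebesgue u]) measurable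
  then have "bnd (\<lambda>x. f (u x) - f ((\<lambda>_. 0) x)) (lipL K * (max 1 K * l0))"
    using l0_pos K u by (intro f_lipschitz) (auto simp: exp_modular_def)
  then show ?thesis by (simp add: f0)
qed

end

section \<open>Duhamel integrals\<close>

lemma powr_neg_integral:
  fixes g c :: real assumes g: "0 \<le> g" "g < 1" and c: "0 \<le> c"
  shows "integrable lborel (\<lambda>s. indicator {0<..c} s * s powr (-g))"
    and "(\<integral>s. indicator {0<..c} s * s powr (-g) \<partial>lborel) = c powr (1 - g) / (1 - g)"
proof -
  have eq: "indicator {0<..c} s * s powr (-g) = indicator {0..c} s * s powr (-g)" for s :: real
    by (auto simp: indicator_def)
  have hi: "((\<lambda>s. s powr (-g)) has_integral (c powr (-g + 1) / (-g + 1))) {0..c}"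
    by (rule has_integral_powr_from_0) (use g c in auto)
  show i: "integrable lborel (\<lambda>s. indicator {0<..c} s * s powr (-g))"
    unfolding eq by (rule integrable_lborel_indicator_of_integrable_on) (use hi in auto)
  have "((\<lambda>s. indicator {0<..c} s * s powr (-g)) has_integral (\<integral>s. indicator {0<..c} s * s powr (-g) \<partial>lborel)) UNIV"
    by (rule has_integral_integral_lborel[OF i])
  moreover have "((\<lambda>s. indicator {0<..c} s * s powr (-g)) has_integral (c powr (-g + 1) / (-g + 1))) UNIV"
  proof -
    have "(\<lambda>s. indicator {0..c} s * s powr (-g)) = (\<lambda>s. if s \<in> {0..c} then s powr (-g) else 0)"
      by (auto simp: indicator_def)
    then show ?thesis unfolding eq using hi by (simp only: has_integral_restrict_UNIV)
  qed
  ultimately have "(\<integral>s. indicator {0<..c} s * s powr (-g) \<partial>lborel) = c powr (-g + 1) / (-g + 1)"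
    by (rule has_integral_unique)
  then show "(\<integral>s. indicator {0<..c} s * s powr (-g) \<partial>lborel) = c powr (1 - g) / (1 - g)"
    by simp
qed

text \<open>For bounded functions a change of level costs only a constant, since y \<le> exp y - 1
  \<le> y exp Y for 0 \<le> y \<le> Y. Through this lemma the bounded Duhamel term has all
  exponential moments and lies in the closure of the test functions.\<close>

lemma exp_modular_finite_of_bounded:
  assumes [measurable]: "u \<in> borel_measurable borel" and p: "0 < p" and l: "0 < l" "0 < l'"
    and fin: "exp_modular p l u < \<infinity>" and S: "\<And>x. \<bar>u x\<bar> \<le> S"
  shows "exp_modular p l' u < \<infinity>"
proof -
  define c where "c = l powr p / l' powr p * exp (S powr p / l' powr p)"
  have c: "0 \<le> c" by (simp add: c_def)
  have pw: "exp (\<bar>u x\<bar> powr p / l' powr p) - 1 \<le> c * (exp (\<bar>u x\<bar> powr p / l powr p) - 1)" for x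
  proof -
    let ?y = "\<bar>u x\<bar> powr p"
    have "?y \<le> S powr p" using S p by (intro powr_mono2) auto
    then have "exp (?y / l' powr p) - 1 \<le> (?y / l' powr p) * exp (S powr p / l' powr p)"
      using l by (intro exp_minus_1_le divide_right_mono) auto
    also have "\<dots> = c * (?y / l powr p)" using l by (simp add: c_def)
    also have "\<dots> \<le> c * (exp (?y / l powr p) - 1)"
      by (rule mult_left_mono[OF _ c]) (use exp_ge_add_one_self[of "?y / l powr p"] in linarith)
    finally show ?thesis .
  qed
  have "exp_modular p l' u \<le> (\<integral>\<^sup>+x. ennreal c * ennreal (exp (\<bar>u x\<bar> powr p / l powr p) - 1) \<partial>lborel)"
    unfolding exp_modular_lborel
    by (intro nn_integral_mono, subst ennreal_mult[symmetric]) (use pw c in \<open>auto intro!: ennreal_leI\<close>)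
  also have "\<dots> = ennreal c * exp_modular p l u"
    unfolding exp_modular_lborel by (rule nn_integral_cmult) measurable
  also have "\<dots> < \<infinity>" using fin by (simp add: ennreal_mult_less_top)
  finally show ?thesis .
qed

context frac_heat_nonlinear
begin

definition "q = p * real k"
text \<open>Norms from L^q to the bounded functions blow up like t^(-gam), with constant
  \<open>cB\<close>; the choice of \<open>k\<close> gives gam < 1, so the rate is integrable at
  0.\<close>

definition "gam = real DIM('a) / (\<beta> * q)"
definition "kz = ker 1 (0::'a)"
definition "cB = kz powr (1 / q)"
text \<open>\<open>om t\<close> bounds the Duhamel operator on an interval of length \<open>t\<close>: the linear part controls the
  \<open>L\<^sup>p\<close> norm, the fractional power the supremum.\<close>

definition "om t = exp 1 * t + cB / (1 - gam) * t powr (1 - gam)"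

lemma q: "p \<le> q" "1 \<le> q" "0 < q" and gam: "0 < gam" "gam < 1" and kz: "0 \<le> kz" and cB: "0 \<le> cB"
proof -
  have "1 \<le> real k" using k by simp
  then show "p \<le> q" using p unfolding q_def by (metis mult.right_neutral mult_left_mono p0 less_imp_le)
  then show "1 \<le> q" "0 < q" using p by auto
  then show "0 < gam" "gam < 1" using k b unfolding gam_def by (auto simp: q_def DIM_positive)
  show "0 \<le> kz" unfolding kz_def by (rule frac_heat_kernel_nonneg[OF zero_less_one b])
  show "0 \<le> cB" by (simp add: cB_def)
qed

lemma om_mono: "0 \<le> s \<Longrightarrow> s \<le> t \<Longrightarrow> om s \<le> om t"
  unfolding om_def using gam cB by (intro add_mono mult_left_mono powr_mono2) auto

lemma om_nonneg: "0 \<le> t \<Longrightarrow> 0 \<le> om t"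
  unfolding om_def using gam cB by simp

lemma om_small: assumes "0 < e" shows "\<exists>d>0. \<forall>t. 0 \<le> t \<longrightarrow> t \<le> d \<longrightarrow> om t \<le> e"
proof -
  have "continuous_on {0..} om" unfolding om_def
    using gam by (intro continuous_intros continuous_on_powr') auto
  moreover have "om 0 = 0" using gam by (simp add: om_def)
  ultimately obtain d where "0 < d" "\<And>t. 0 \<le> t \<Longrightarrow> \<bar>t\<bar> < d \<Longrightarrow> \<bar>om t\<bar> < e"
    unfolding continuous_on_iff dist_real_def using assms by (metis atLeast_iff diff_zero order_refl)
  then show ?thesis by (intro exI[of _ "d / 2"]) force
qed

lemma bnd_measurable: "bnd h A \<Longrightarrow> h \<in> borel_measurable borel" by (simp add: bnd_def)

lemma bnd_moments:
  assumes "bnd h A"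
  shows "(\<integral>\<^sup>+x. ennreal (\<bar>h x\<bar> powr p) \<partial>lborel) \<le> ennreal (A powr p)"
    "(\<integral>\<^sup>+x. ennreal (\<bar>h x\<bar> powr q) \<partial>lborel) \<le> ennreal (A powr q)"
  using assms by (auto simp: bnd_def q_def)

lemma bnd_moment_finite: "bnd h A \<Longrightarrow> (\<integral>\<^sup>+x. ennreal (\<bar>h x\<bar> powr p) \<partial>lborel) < \<infinity>"
  by (rule order.strict_trans1[OF bnd_moments(1)]) auto

lemma bnd_semigroup_le:
  assumes h: "bnd h A" and s: "0 < s"
  shows "\<bar>heat s h x\<bar> \<le> cB * A * s powr (-gam)"
proof -
  have A: "0 \<le> A" using h by (simp add: bnd_def)
  let ?y = "\<bar>heat s h x\<bar>"
  have "?y = (?y powr q) powr (1 / q)" using q by (simp add: powr_powr)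
  also have "\<dots> \<le> (s powr (-(real DIM('a) / \<beta>)) * kz * A powr q) powr (1 / q)"
    unfolding kz_def using q
    by (intro powr_mono2 semigroup_powr_le[OF s bnd_measurable[OF h] q(2) bnd_moments(2)[OF h]]) auto
  also have "\<dots> = s powr (-gam) * cB * A"
    using q b kz A s by (simp add: powr_mult powr_powr cB_def gam_def)
  finally show ?thesis by (simp add: mult_ac)
qed

text \<open>The variable s is the time elapsed since the source acted, so the singularity sits at s
  = 0. The supremum follows by integrating s^(-gam), the L^p norm by Jensen's inequality in time and
  contractivity in space; together they give the modular. A left end a > 0 serves increments of the
  Duhamel term in time.\<close>

lemma duhamel_estimate:
  fixes h :: "real \<Rightarrow> 'a \<Rightarrow> real"
  assumes ab: "0 \<le> a" "a \<le> c" and A: "0 \<le> A" and h: "\<And>s. a < s \<Longrightarrow> s \<le> c \<Longrightarrow> bnd (h s) A"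
    and m[measurable]: "(\<lambda>(s, x). indicator {a<..c} s * heat s (h s) x) \<in> borel_measurable (borel \<Otimes>\<^sub>M borel)"
    and l: "0 < l" "A * om (c - a) \<le> l"
  shows "\<And>x. integrable lborel (\<lambda>s. indicator {a<..c} s * heat s (h s) x)"
    and "\<And>x. \<bar>\<integral>s. indicator {a<..c} s * heat s (h s) x \<partial>lborel\<bar> \<le> l"
    and "exp_modular p l (\<lambda>x. \<integral>s. indicator {a<..c} s * heat s (h s) x \<partial>lborel) \<le> 1"
    and "(\<lambda>x. \<integral>s. indicator {a<..c} s * heat s (h s) x \<partial>lborel) \<in> borel_measurable borel"
proof -
  define F where "F s x = indicator {a<..c} s * heat s (h s) x" for s x
  have Fm[measurable]: "(\<lambda>(s, x). F s x) \<in> borel_measurable (borel \<Otimes>\<^sub>M borel)" unfolding F_def by (rule m)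
  have [measurable]: "(\<lambda>s. F s x) \<in> borel_measurable borel" for x
    using measurable_Pair1[OF Fm, of x] by simp
  have [measurable]: "F s \<in> borel_measurable borel" for s
    using measurable_Pair2[OF Fm, of s] by simp
  define G where "G s = indicator {0<..c - a} s * s powr (-gam)" for s :: real
  have Gi: "integrable lborel G" "(\<integral>s. G s \<partial>lborel) = (c - a) powr (1 - gam) / (1 - gam)"
    unfolding G_def using powr_neg_integral[of gam "c - a"] gam ab by auto
  have Gs: "integrable lborel (\<lambda>s. G (- a + 1 *\<^sub>R s))" "(\<integral>s. G (- a + 1 *\<^sub>R s) \<partial>lborel) = (\<integral>s. G s \<partial>lborel)"
    using integrable_lborel_affine[OF Gi(1), of 1 "-a"] integral_lborel_affine[of G 1 "-a"] Gi(1) by auto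
  have FG: "\<bar>F s x\<bar> \<le> cB * A * G (- a + 1 *\<^sub>R s)" for s x
  proof (cases "a < s \<and> s \<le> c")
    case True
    then have "\<bar>F s x\<bar> \<le> cB * A * s powr (-gam)"
      using bnd_semigroup_le[OF h[of s], of s x] ab by (simp add: F_def)
    \<comment> \<open>Moving the singularity to the left end a weakens the bound but makes it depend
      on the length c - a alone.\<close>
    also have "\<dots> \<le> cB * A * (s - a) powr (-gam)"
      using True ab gam cB A by (intro mult_left_mono powr_mono2') auto
    finally show ?thesis using True by (simp add: G_def)
  qed (auto simp: F_def G_def)
  have Fi: "integrable lborel (\<lambda>s. F s x)" for x
    by (rule Bochner_Integration.integrable_bound[OF integrable_mult_right[OF Gs(1), of "cB * A"]])
       (use FG abs_ge_self order_trans in \<open>fastforce intro!: AE_I2\<close>)+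
  then show "integrable lborel (\<lambda>s. indicator {a<..c} s * heat s (h s) x)" for x
    by (simp add: F_def)
  define E where "E x = (\<integral>s. F s x \<partial>lborel)" for x
  have Eom: "\<bar>E x\<bar> \<le> A * (cB / (1 - gam) * (c - a) powr (1 - gam))" for x
  proof -
    have "\<bar>E x\<bar> \<le> (\<integral>s. norm (F s x) \<partial>lborel)" unfolding E_def using integral_norm_bound[of lborel "\<lambda>s. F s x"] by simp
    also have "\<dots> \<le> (\<integral>s. cB * A * G (- a + 1 *\<^sub>R s) \<partial>lborel)"
      by (intro integral_mono integrable_norm Fi integrable_mult_right Gs) (use FG in auto)
    also have "\<dots> = cB * A * ((c - a) powr (1 - gam) / (1 - gam))"
      unfolding integral_mult_right_zero Gs Gi ..
    finally show ?thesis by (simp add: mult_ac)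
  qed
  have le: "\<bar>E x\<bar> \<le> l" for x
  proof -
    have "A * (cB / (1 - gam) * (c - a) powr (1 - gam)) \<le> A * om (c - a)"
      using A ab by (intro mult_left_mono) (auto simp: om_def)
    then show ?thesis using Eom[of x] l by linarith
  qed
  then show "\<bar>\<integral>s. indicator {a<..c} s * heat s (h s) x \<partial>lborel\<bar> \<le> l" for x
    by (simp add: E_def F_def)
  have Em[measurable]: "E \<in> borel_measurable borel"
    unfolding E_def by measurable
  then show "(\<lambda>x. \<integral>s. indicator {a<..c} s * heat s (h s) x \<partial>lborel) \<in> borel_measurable borel"
    by (simp add: E_def[abs_def] F_def)
  have "exp_modular p l E \<le> 1"
  proof (cases "a = c")
    case True
    then have "E x = 0" for x by (simp add: E_def F_def)
    then show ?thesis by (simp add: exp_modular_def)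
  next
    case False
    with ab have ac: "a < c" by simp
    \<comment> \<open>The uniform probability density on the interval, for Jensen's inequality in
      time; the p-th power of the integral then carries the factor (c - a)^p.\<close>
    define w where "w s = indicator {a<..c} s / (c - a)" for s :: real
    have [measurable]: "w \<in> borel_measurable borel" unfolding w_def by measurable
    have w1: "(\<integral>\<^sup>+s. ennreal (w s) \<partial>lborel) = 1"
    proof -
      have "(\<integral>\<^sup>+s. ennreal (w s) \<partial>lborel) = (\<integral>\<^sup>+s. ennreal (1 / (c - a)) * indicator {a<..c} s \<partial>lborel)"
        by (intro nn_integral_cong) (auto simp: w_def indicator_def)
      also have "\<dots> = ennreal (1 / (c - a)) * ennreal (c - a)"
        using ac by (subst nn_integral_cmult_indicator) auto
      also have "\<dots> = 1" using ac by (simp add: ennreal_mult[symmetric])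
      finally show ?thesis .
    qed
    have wF: "w s * F s x = F s x / (c - a)" for s x by (simp add: w_def F_def indicator_def)
    have J: "ennreal (\<bar>E x / (c - a)\<bar> powr p) \<le> (\<integral>\<^sup>+s. ennreal (w s) * ennreal (\<bar>F s x\<bar> powr p) \<partial>lborel)" for x
    proof -
      have "ennreal (\<bar>\<integral>s. w s * F s x \<partial>lborel\<bar> powr p) \<le> (\<integral>\<^sup>+s. ennreal (w s) * ennreal (\<bar>F s x\<bar> powr p) \<partial>lborel)"
      proof (rule jensen_nn_integral[OF _ _ _ _ w1 _ convex_on_powr_abs[OF p1]])
        show "integrable lborel (\<lambda>s. w s * F s x)" unfolding wF using Fi by simp
        show "0 \<le> w s" for s using ac by (simp add: w_def)
      qed auto
      then show ?thesis unfolding wF by (simp add: E_def)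
    qed
    have Fp: "(\<integral>\<^sup>+x. ennreal (\<bar>F s x\<bar> powr p) \<partial>lborel) \<le> ennreal (A powr p)" for s
    proof (cases "a < s \<and> s \<le> c")
      case True
      then have hs: "bnd (h s) A" by (intro h) auto
      have "(\<integral>\<^sup>+x. ennreal (\<bar>F s x\<bar> powr p) \<partial>lborel) = (\<integral>\<^sup>+x. ennreal (\<bar>heat s (h s) x\<bar> powr p) \<partial>lborel)"
        using True by (simp add: F_def)
      also have "\<dots> \<le> (\<integral>\<^sup>+x. ennreal (\<bar>h s x\<bar> powr p) \<partial>lborel)"
        by (rule nn_integral_semigroup_convex[OF _ bnd_measurable[OF hs] p1 bnd_moment_finite[OF hs] convex_on_powr_abs[OF p1]])
           (use True ab in auto)
      also have "\<dots> \<le> ennreal (A powr p)" by (rule bnd_moments(1)[OF hs])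
      finally show ?thesis .
    next
      case False
      then have "F s x = 0" for x by (auto simp: F_def)
      then show ?thesis by simp
    qed
    have "(\<integral>\<^sup>+x. ennreal (\<bar>E x / (c - a)\<bar> powr p) \<partial>lborel) \<le> (\<integral>\<^sup>+x. \<integral>\<^sup>+s. ennreal (w s) * ennreal (\<bar>F s x\<bar> powr p) \<partial>lborel \<partial>lborel)"
      by (rule nn_integral_mono[OF J])
    also have "\<dots> = (\<integral>\<^sup>+s. \<integral>\<^sup>+x. ennreal (w s) * ennreal (\<bar>F s x\<bar> powr p) \<partial>lborel \<partial>lborel)"
      by (rule lborel_pair.Fubini') measurable
    also have "\<dots> \<le> (\<integral>\<^sup>+s. ennreal (w s) * ennreal (A powr p) \<partial>lborel)"
      by (intro nn_integral_mono) (use Fp in \<open>auto simp: nn_integral_cmult intro!: mult_left_mono\<close>)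
    also have "\<dots> = ennreal (A powr p)" by (simp add: nn_integral_multc w1)
    finally have Ep: "(\<integral>\<^sup>+x. ennreal (\<bar>E x / (c - a)\<bar> powr p) \<partial>lborel) \<le> ennreal (A powr p)" .
    define r where "r = exp 1 * (c - a) powr p / l powr p"
    have r: "0 \<le> r" by (simp add: r_def)
    \<comment> \<open>The supremum bound keeps the exponent at most 1, so the p-th moment controls
      the modular.\<close>
    have pw: "exp (\<bar>E x\<bar> powr p / l powr p) - 1 \<le> r * \<bar>E x / (c - a)\<bar> powr p" for x
    proof -
      have "\<bar>E x\<bar> powr p \<le> l powr p" using le p by (intro powr_mono2) auto
      then have "exp (\<bar>E x\<bar> powr p / l powr p) - 1 \<le> (\<bar>E x\<bar> powr p / l powr p) * exp 1"
        using l by (intro exp_minus_1_le) auto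
      also have "\<dots> = r * \<bar>E x / (c - a)\<bar> powr p" using ac by (simp add: r_def powr_divide)
      finally show ?thesis .
    qed
    have "exp_modular p l E \<le> (\<integral>\<^sup>+x. ennreal r * ennreal (\<bar>E x / (c - a)\<bar> powr p) \<partial>lborel)"
      unfolding exp_modular_lborel
      by (intro nn_integral_mono, subst ennreal_mult[symmetric]) (use pw r in \<open>auto intro!: ennreal_leI\<close>)
    also have "\<dots> = ennreal r * (\<integral>\<^sup>+x. ennreal (\<bar>E x / (c - a)\<bar> powr p) \<partial>lborel)"
      by (rule nn_integral_cmult) measurable
    also have "\<dots> \<le> ennreal r * ennreal (A powr p)" using Ep by (rule mult_left_mono) simp
    also have "\<dots> = ennreal (r * A powr p)" using r by (simp add: ennreal_mult)
    also have "\<dots> \<le> 1" unfolding ennreal_le_1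
    proof -
      have "A * (exp 1 * (c - a)) \<le> A * om (c - a)"
        using A gam cB ab by (intro mult_left_mono) (auto simp: om_def)
      then have "A * (exp 1 * (c - a)) \<le> l" using l by linarith
      then have "(A * (exp 1 * (c - a))) powr p \<le> l powr p" using A ab p by (intro powr_mono2) auto
      \<comment> \<open>The factor e from the previous estimate is absorbed by the summand
        \<open>exp 1 * t\<close> of \<open>om\<close>.\<close>
      moreover have "exp 1 \<le> exp 1 powr p" using p by (simp add: powr_def)
      then have "A powr p * (exp 1 * (c - a) powr p) \<le> A powr p * (exp 1 powr p * (c - a) powr p)"
        by (intro mult_left_mono mult_right_mono) auto
      moreover have "(A * (exp 1 * (c - a))) powr p = A powr p * (exp 1 powr p * (c - a) powr p)"
        by (simp add: powr_mult)
      ultimately have "A powr p * (exp 1 * (c - a) powr p) \<le> l powr p" by linarith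
      then show "r * A powr p \<le> 1" using l by (simp add: r_def field_simps)
    qed
    finally show ?thesis .
  qed
  then show "exp_modular p l (\<lambda>x. \<integral>s. indicator {a<..c} s * heat s (h s) x \<partial>lborel) \<le> 1"
    by (simp add: E_def[abs_def] F_def)
qed

text \<open>Curves that are continuous for the norms of L^p and L^q together; this lets
  \<open>duhamel_measurable\<close> freeze the time argument.\<close>

definition bnd_cont :: "real \<Rightarrow> (real \<Rightarrow> 'a \<Rightarrow> real) \<Rightarrow> bool" where
  "bnd_cont T g \<longleftrightarrow> (\<forall>s\<in>{0..T}. \<exists>A. bnd (g s) A) \<and>
     (\<forall>s\<in>{0..T}. \<forall>e>0. \<exists>d>0. \<forall>s'\<in>{0..T}. \<bar>s - s'\<bar> < d \<longrightarrow> bnd (\<lambda>x. g s x - g s' x) e)"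

lemma semigroup_diff_bnd:
  assumes "0 < s" "bnd g A" "bnd h B"
  shows "heat s (\<lambda>y. g y - h y) x = heat s g x - heat s h x"
  using assms by (intro semigroup_diff[OF _ _ _ p1 p1] bnd_measurable bnd_moment_finite)

text \<open>A Caratheodory argument: for fixed \<open>g\<close> the convolution is jointly measurable in time and space,
  and it depends continuously on the time at which \<open>g\<close> is frozen.\<close>

lemma duhamel_measurable:
  assumes g: "bnd_cont T g" and t: "0 \<le> t" "t \<le> T"
  shows "(\<lambda>(s, x). indicator {0<..t} s * heat s (g (t - s)) x) \<in> borel_measurable (borel \<Otimes>\<^sub>M borel)"
proof -
  \<comment> \<open>Grid points of spacing 1 / (m + 1), clamped to [0, t] so that t - r m i stays
    among the times at which \<open>g\<close> is controlled. For each m there are countably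
    many.\<close>
  define r where "r m i = max 0 (min t (real_of_int i / real (Suc m)))" for m :: nat and i :: int
  have r: "0 \<le> r m i" "r m i \<le> t" for m i using t by (auto simp: r_def)
  have gb: "\<exists>A. bnd (g s) A" if "0 \<le> s" "s \<le> T" for s using g that by (auto simp: bnd_cont_def)
  have gm: "g (t - r m i) \<in> borel_measurable borel" for m i
    using gb[of "t - r m i"] r[of m i] t bnd_measurable by auto
  define W where "W m i = (\<lambda>(s, x). indicator {0<..t} s * (\<integral>y. ker s (x - y) * g (t - r m i) y \<partial>lborel))" for m i
  have Wm: "W m i \<in> borel_measurable (borel \<Otimes>\<^sub>M borel)" for m i
    using convolution_measurable[OF gm[of m i]] unfolding W_def
    by (simp add: split_beta') measurable
  show ?thesis
  proof (rule borel_measurable_LIMSEQ_real)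
    show "(\<lambda>z. W m \<lfloor>fst z * real (Suc m)\<rfloor> z) \<in> borel_measurable (borel \<Otimes>\<^sub>M borel)" for m
    proof (rule measurable_compose_countable[where f="W m", OF Wm])
      show "(\<lambda>z. \<lfloor>fst z * real (Suc m)\<rfloor>) \<in> (borel \<Otimes>\<^sub>M (borel :: 'a measure)) \<rightarrow>\<^sub>M count_space UNIV" by measurable
    qed
    fix z :: "real \<times> 'a"
    obtain s x where z: "z = (s, x)" by (cases z)
    show "(\<lambda>m. W m \<lfloor>fst z * real (Suc m)\<rfloor> z) \<longlonglongrightarrow> (case z of (s, x) \<Rightarrow> indicator {0<..t} s * heat s (g (t - s)) x)"
    proof (cases "0 < s \<and> s \<le> t")
      case True
      let ?i = "\<lambda>m. \<lfloor>s * real (Suc m)\<rfloor>"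
      have rs: "\<bar>r m (?i m) - s\<bar> \<le> 1 / real (Suc m)" for m
      proof -
        have i: "real_of_int (?i m) \<le> s * real (Suc m)" "s * real (Suc m) \<le> real_of_int (?i m) + 1" by linarith+
        have "0 \<le> ?i m" using True by simp
        then have i0: "0 \<le> real_of_int (?i m) / real (Suc m)" by simp
        have "real_of_int (?i m) / real (Suc m) \<le> s" using i(1) by (simp add: pos_divide_le_eq del: of_nat_Suc)
        moreover have "s \<le> (real_of_int (?i m) + 1) / real (Suc m)" using i(2) by (simp add: pos_le_divide_eq del: of_nat_Suc)
        then have "s \<le> real_of_int (?i m) / real (Suc m) + 1 / real (Suc m)" by (simp add: add_divide_distrib)
        ultimately show ?thesis using i0 True unfolding r_def by linarith
      qed
      have eqW: "W m (?i m) z = heat s (g (t - r m (?i m))) x" for m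
        using True by (simp add: W_def z semigroup_eq_lborel gm)
      have "(\<lambda>m. heat s (g (t - r m (?i m))) x) \<longlonglongrightarrow> heat s (g (t - s)) x"
      proof (rule LIMSEQ_I)
        fix e :: real assume e: "0 < e"
        define D where "D = cB * s powr (-gam) + 1"
        define e' where "e' = e / (2 * D)"
        have den: "0 < D" unfolding D_def using cB by (intro add_nonneg_pos) auto
        have e': "0 < e'" using den e by (simp add: e'_def)
        have small: "cB * e' * s powr (-gam) < e"
        proof -
          have "cB * e' * s powr (-gam) \<le> D * e'" using e' by (simp add: D_def algebra_simps)
          also have "\<dots> = e / 2" using den by (simp add: e'_def)
          finally show ?thesis using e by simp
        qed
        obtain d where d: "0 < d" "\<And>s'. s' \<in> {0..T} \<Longrightarrow> \<bar>(t - s) - s'\<bar> < d \<Longrightarrow> bnd (\<lambda>x. g (t - s) x - g s' x) e'"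
          using g True t e' unfolding bnd_cont_def by (elim conjE ballE[of _ _ "t - s"]) auto
        obtain N where N: "1 / real (Suc N) < d" using d(1) nat_approx_posE by blast
        show "\<exists>no. \<forall>m\<ge>no. norm (heat s (g (t - r m (?i m))) x - heat s (g (t - s)) x) < e"
        proof (intro exI[of _ N] allI impI)
          fix m assume m: "N \<le> m"
          have "1 / real (Suc m) \<le> 1 / real (Suc N)" using m by (simp add: field_simps)
          then have "\<bar>(t - s) - (t - r m (?i m))\<bar> < d" using rs[of m] N by linarith
          then have B: "bnd (\<lambda>x. g (t - s) x - g (t - r m (?i m)) x) e'" using r[of m "?i m"] t by (intro d) auto
          obtain A1 A2 where "bnd (g (t - s)) A1" "bnd (g (t - r m (?i m))) A2"
            using gb[of "t - s"] gb[of "t - r m (?i m)"] r[of m "?i m"] t True by auto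
          then have "heat s (\<lambda>x. g (t - s) x - g (t - r m (?i m)) x) x = 
            heat s (g (t - s)) x - heat s (g (t - r m (?i m))) x"
            using True by (intro semigroup_diff_bnd) auto
          then show "norm (heat s (g (t - r m (?i m))) x - heat s (g (t - s)) x) < e"
            using bnd_semigroup_le[OF B, of s x] True small by (simp add: abs_minus_commute)
        qed
      qed
      then show ?thesis using True eqW by (simp add: z)
    next
      case False
      then show ?thesis by (auto simp: z W_def)
    qed
  qed
qed

end

section \<open>Exponentially continuous families\<close>

context frac_heat_nonlinear
begin

text \<open>Continuous curves into the closure of the test functions, in terms of modulars:
  finiteness at every level characterises the closure, and modular at most 1 at level l means
  distance at most l. A Borel representative is fixed at each time.\<close>

definition exp_cont :: "real \<Rightarrow> (real \<Rightarrow> 'a \<Rightarrow> real) \<Rightarrow> bool" where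
  "exp_cont T u \<longleftrightarrow> (\<forall>t\<in>{0..T}. u t \<in> borel_measurable borel \<and> (\<forall>l>0. exp_modular p l (u t) < \<infinity>)) \<and>
     (\<forall>t\<in>{0..T}. \<forall>l>0. \<exists>d>0. \<forall>s\<in>{0..T}. \<bar>s - t\<bar> < d \<longrightarrow> exp_modular p l (\<lambda>x. u s x - u t x) \<le> 1)"

lemma exp_cont_measurable: "exp_cont T u \<Longrightarrow> 0 \<le> t \<Longrightarrow> t \<le> T \<Longrightarrow> u t \<in> borel_measurable borel"
  by (simp add: exp_cont_def)

lemma exp_cont_finite: "exp_cont T u \<Longrightarrow> 0 \<le> t \<Longrightarrow> t \<le> T \<Longrightarrow> 0 < l \<Longrightarrow> exp_modular p l (u t) < \<infinity>"
  by (simp add: exp_cont_def)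

lemma exp_cont_nbhd:
  assumes "exp_cont T u" "0 < l"
  shows "\<exists>d. \<forall>t\<in>{0..T}. 0 < d t \<and> (\<forall>s\<in>{0..T}. \<bar>s - t\<bar> < d t \<longrightarrow> exp_modular p l (\<lambda>x. u s x - u t x) \<le> 1)"
  by (rule bchoice) (use assms in \<open>simp add: exp_cont_def\<close>)

text \<open>Finitely many neighbourhoods cover the interval, and in each the modular at level l is
  at most 1 plus that of the centre at level l / 2. Summing over the centres in place of a maximum
  also covers an empty interval.\<close>

lemma exp_cont_bounded:
  assumes u: "exp_cont T u" and l: "0 < l"
  shows "\<exists>K\<ge>0. \<forall>t\<in>{0..T}. exp_modular p l (u t) \<le> ennreal K"
proof -
  obtain d where dd: "\<forall>t\<in>{0..T}. 0 < d t \<and> (\<forall>s\<in>{0..T}. \<bar>s - t\<bar> < d t \<longrightarrow> exp_modular p (l / 2) (\<lambda>x. u s x - u t x) \<le> 1)"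
    using exp_cont_nbhd[OF u half_gt_zero[OF l]] ..
  have d: "0 < d t" if "t \<in> {0..T}" for t using dd that by blast
  have dm: "exp_modular p (l / 2) (\<lambda>x. u s x - u t x) \<le> 1"
    if "t \<in> {0..T}" "s \<in> {0..T}" "\<bar>s - t\<bar> < d t" for s t using dd that by blast
  obtain F where F: "F \<subseteq> {0..T}" "finite F" "{0..T} \<subseteq> (\<Union>t\<in>F. ball t (d t))"
  proof (rule compactE_image[of "{0..T}" "{0..T}" "\<lambda>t. ball t (d t)"])
    show "{0..T} \<subseteq> (\<Union>t\<in>{0..T}. ball t (d t))" using d by (auto intro!: bexI)
  qed auto
  define K where "K = (\<Sum>t\<in>F. 1 + enn2real (exp_modular p (l / 2) (u t)))"
  have K0: "0 \<le> K" unfolding K_def by (intro sum_nonneg) auto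
  have "exp_modular p l (u s) \<le> ennreal K" if s: "s \<in> {0..T}" for s
  proof -
    obtain t where t: "t \<in> F" "s \<in> ball t (d t)" using F s by blast
    have tT: "t \<in> {0..T}" using t F by auto
    have "exp_modular p (2 * (l / 2)) (\<lambda>x. (u s x - u t x) + u t x) \<le> exp_modular p (l / 2) (\<lambda>x. u s x - u t x) + exp_modular p (l / 2) (u t)"
      using exp_cont_measurable[OF u] s tT p0 l by (intro exp_modular_add borel_imp_lebesgue) auto
    also have "\<dots> \<le> 1 + exp_modular p (l / 2) (u t)"
      using dm[OF tT s] t by (intro add_right_mono) (simp add: dist_real_def abs_minus_commute)
    also have "\<dots> = ennreal (1 + enn2real (exp_modular p (l / 2) (u t)))"
      using exp_cont_finite[OF u, of t "l / 2"] tT l by (subst ennreal_plus) (auto simp: less_top)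
    also have "\<dots> \<le> ennreal K"
      unfolding K_def using t F by (intro ennreal_leI member_le_sum) auto
    finally show ?thesis by simp
  qed
  with K0 show ?thesis by blast
qed

text \<open>A Lebesgue number of the cover by neighbourhoods for level l / 2: two close times share
  a neighbourhood, whose centre links them by the triangle inequality.\<close>

lemma exp_cont_uniform:
  assumes u: "exp_cont T u" and l: "0 < l"
  shows "\<exists>d>0. \<forall>s\<in>{0..T}. \<forall>t\<in>{0..T}. \<bar>s - t\<bar> < d \<longrightarrow> exp_modular p l (\<lambda>x. u s x - u t x) \<le> 1"
proof -
  obtain d where dd: "\<forall>t\<in>{0..T}. 0 < d t \<and> (\<forall>s\<in>{0..T}. \<bar>s - t\<bar> < d t \<longrightarrow> exp_modular p (l / 2) (\<lambda>x. u s x - u t x) \<le> 1)"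
    using exp_cont_nbhd[OF u half_gt_zero[OF l]] ..
  have d: "0 < d t" if "t \<in> {0..T}" for t using dd that by blast
  have dm: "exp_modular p (l / 2) (\<lambda>x. u s x - u t x) \<le> 1"
    if "t \<in> {0..T}" "s \<in> {0..T}" "\<bar>s - t\<bar> < d t" for s t using dd that by blast
  obtain e where e: "0 < e" "\<And>x. x \<in> {0..T} \<Longrightarrow> \<exists>G\<in>(\<lambda>t. ball t (d t)) ` {0..T}. ball x e \<subseteq> G"
  proof (rule Heine_Borel_lemma[of "{0..T}" "(\<lambda>t. ball t (d t)) ` {0..T}"])
    show "{0..T} \<subseteq> \<Union> ((\<lambda>t. ball t (d t)) ` {0..T})" using d by (auto intro!: bexI)
  qed auto
  have "exp_modular p l (\<lambda>x. u s x - u t x) \<le> 1" if s: "s \<in> {0..T}" and t: "t \<in> {0..T}" and st: "\<bar>s - t\<bar> < e" for s t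
  proof -
    obtain r where r: "r \<in> {0..T}" "ball t e \<subseteq> ball r (d r)" using e(2)[OF t] by auto
    have "s \<in> ball t e" "t \<in> ball t e" using st e(1) by (auto simp: dist_real_def abs_minus_commute)
    then have "s \<in> ball r (d r)" "t \<in> ball r (d r)" using r(2) by blast+
    then have *: "exp_modular p (l / 2) (\<lambda>x. u s x - u r x) \<le> 1" "exp_modular p (l / 2) (\<lambda>x. u r x - u t x) \<le> 1"
      using dm[OF r(1) s] dm[OF r(1) t] by (auto simp: dist_real_def abs_minus_commute exp_modular_uminus[of p _ "u r"])
    have "exp_modular p (l / 2 + l / 2) (\<lambda>x. (u s x - u r x) + (u r x - u t x)) \<le> 1"
      using exp_cont_measurable[OF u] s t r l by (intro exp_modular_triangle borel_imp_lebesgue p1 *) auto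
    then show ?thesis by simp
  qed
  with e(1) show ?thesis by blast
qed

text \<open>The uniform bound at level \<open>l0\<close> fixes one Lipschitz constant for the whole
  curve, so continuity at level \<open>e / lipL K\<close> transfers to \<open>f\<close>.\<close>

lemma exp_cont_f_bnd_cont:
  assumes u: "exp_cont T u" shows "bnd_cont T (\<lambda>s x. f (u s x))"
proof -
  obtain K where K: "0 \<le> K" "\<And>t. t \<in> {0..T} \<Longrightarrow> exp_modular p l0 (u t) \<le> ennreal K"
    using exp_cont_bounded[OF u l0_pos] by auto
  have L: "0 < lipL K" using lipL_ge_1[OF K(1)] by simp
  show ?thesis unfolding bnd_cont_def
  proof (intro conjI ballI allI impI)
    fix s assume s: "s \<in> {0..T}"
    show "\<exists>A. bnd (\<lambda>x. f (u s x)) A"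
      using f_bnd[OF _ K(1) K(2)[OF s]] exp_cont_measurable[OF u] s by auto
    fix e :: real assume e: "0 < e"
    obtain d where d: "0 < d" "\<And>s t. s \<in> {0..T} \<Longrightarrow> t \<in> {0..T} \<Longrightarrow> \<bar>s - t\<bar> < d \<Longrightarrow> exp_modular p (e / lipL K) (\<lambda>x. u s x - u t x) \<le> 1"
      using exp_cont_uniform[OF u, of "e / lipL K"] e L by auto
    have "bnd (\<lambda>x. f (u s x) - f (u s' x)) (lipL K * (e / lipL K))" if "s' \<in> {0..T}" "\<bar>s - s'\<bar> < d" for s'
      using exp_cont_measurable[OF u] s that e L
      by (intro f_lipschitz K d) auto
    then show "\<exists>d>0. \<forall>s'\<in>{0..T}. \<bar>s - s'\<bar> < d \<longrightarrow> bnd (\<lambda>x. f (u s x) - f (u s' x)) e"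
      using d(1) L by auto
  qed
qed

text \<open>The Duhamel integral in the elapsed time. The half-open interval leaves out elapsed time
  0, where the semigroup is the identity and the integrand would depend on the representative; a
  single time is negligible.\<close>

definition duh :: "(real \<Rightarrow> 'a \<Rightarrow> real) \<Rightarrow> real \<Rightarrow> 'a \<Rightarrow> real" where
  "duh u t x = (\<integral>s. indicator {0<..t} s * heat s (\<lambda>y. f (u (t - s) y)) x \<partial>lborel)"

lemma duh_estimate:
  assumes u: "exp_cont T u" and K: "0 \<le> K" "\<And>t. t \<in> {0..T} \<Longrightarrow> exp_modular p l0 (u t) \<le> ennreal K"
    and t: "0 \<le> t" "t \<le> T" and l: "0 < l" "lipL K * (max 1 K * l0) * om t \<le> l"
  shows "\<And>x. integrable lborel (\<lambda>s. indicator {0<..t} s * heat s (\<lambda>y. f (u (t - s) y)) x)"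
    and "\<And>x. \<bar>duh u t x\<bar> \<le> l"
    and "exp_modular p l (duh u t) \<le> 1"
    and "duh u t \<in> borel_measurable borel"
proof -
  have A: "0 \<le> lipL K * (max 1 K * l0)" using lipL_ge_1[OF K(1)] l0_pos by simp
  have h: "bnd (\<lambda>y. f (u (t - s) y)) (lipL K * (max 1 K * l0))" if "0 < s" "s \<le> t" for s
    using that t by (intro f_bnd K exp_cont_measurable[OF u]) auto
  note D = duhamel_estimate[OF order_refl t(1) A h duhamel_measurable[OF exp_cont_f_bnd_cont[OF u] t] l(1)]
  show "integrable lborel (\<lambda>s. indicator {0<..t} s * heat s (\<lambda>y. f (u (t - s) y)) x)" for x
    by (rule D(1)) (use l in auto)
  show "\<bar>duh u t x\<bar> \<le> l" for x unfolding duh_def by (rule D(2)) (use l in auto)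
  show "exp_modular p l (duh u t) \<le> 1" unfolding duh_def[abs_def] by (rule D(3)) (use l in auto)
  show "duh u t \<in> borel_measurable borel" unfolding duh_def[abs_def] by (rule D(4)) (use l in auto)
qed

lemma duh_integrable:
  assumes u: "exp_cont T u" and t: "0 \<le> t" "t \<le> T"
  shows "integrable lborel (\<lambda>s. indicator {0<..t} s * heat s (\<lambda>y. f (u (t - s) y)) x)"
    and "duh u t \<in> borel_measurable borel"
    and "\<And>l. 0 < l \<Longrightarrow> exp_modular p l (duh u t) < \<infinity>"
proof -
  obtain K where K: "0 \<le> K" "\<And>t. t \<in> {0..T} \<Longrightarrow> exp_modular p l0 (u t) \<le> ennreal K"
    using exp_cont_bounded[OF u l0_pos] by auto
  \<comment> \<open>A level large enough for the estimate; as the Duhamel term is bounded,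
    finiteness passes from this level to all others.\<close>
  define j where "j = max 1 (lipL K * (max 1 K * l0) * om t)"
  have j: "0 < j" "lipL K * (max 1 K * l0) * om t \<le> j" by (auto simp: j_def)
  note D = duh_estimate[OF u K t j]
  show "integrable lborel (\<lambda>s. indicator {0<..t} s * heat s (\<lambda>y. f (u (t - s) y)) x)"
    by (rule D(1))
  show "duh u t \<in> borel_measurable borel" by (rule D(4))
  show "exp_modular p l (duh u t) < \<infinity>" if "0 < l" for l
    by (rule exp_modular_finite_of_bounded[OF D(4) p0 j(1) that order.strict_trans1[OF D(3)] D(2)]) simp_all
qed

text \<open>Sources that agree before time r cancel, which leaves elapsed times up to t - r and
  hence the factor \<open>om (t - r)\<close>. The Picard iteration takes r = 0; uniqueness restarts
  at the time up to which agreement is known.\<close>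

lemma duh_diff:
  assumes u: "exp_cont T u" and v: "exp_cont T v" and K: "0 \<le> K"
    "\<And>t. t \<in> {0..T} \<Longrightarrow> exp_modular p l0 (u t) \<le> ennreal K" "\<And>t. t \<in> {0..T} \<Longrightarrow> exp_modular p l0 (v t) \<le> ennreal K"
    and t: "0 \<le> r" "r \<le> t" "t \<le> T"
    and eq: "\<And>s. 0 \<le> s \<Longrightarrow> s < r \<Longrightarrow> AE x in lborel. u s x = v s x"
    and uv: "\<And>s. r \<le> s \<Longrightarrow> s \<le> t \<Longrightarrow> exp_modular p l (\<lambda>x. u s x - v s x) \<le> 1" and l: "0 < l"
    and l': "0 < l'" "lipL K * l * om (t - r) \<le> l'"
  shows "\<And>x. \<bar>duh u t x - duh v t x\<bar> \<le> l'" and "exp_modular p l' (\<lambda>x. duh u t x - duh v t x) \<le> 1"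
proof -
  have t0: "0 \<le> t" using t by simp
  let ?fu = "\<lambda>s y. f (u s y)" and ?fv = "\<lambda>s y. f (v s y)"
  have bu: "\<exists>A. bnd (?fu s) A" and bv: "\<exists>A. bnd (?fv s) A" if "0 \<le> s" "s \<le> T" for s
    using exp_cont_f_bnd_cont[OF u] exp_cont_f_bnd_cont[OF v] that by (auto simp: bnd_cont_def)
  let ?h = "\<lambda>s y. ?fu (t - s) y - ?fv (t - s) y"
  have hH: "heat s (?h s) x = heat s (?fu (t - s)) x - heat s (?fv (t - s)) x"
    if s: "0 < s" "s \<le> t" for s x
  proof -
    obtain A B where "bnd (?fu (t - s)) A" "bnd (?fv (t - s)) B" using bu[of "t - s"] bv[of "t - s"] s t by auto
    then show ?thesis by (rule semigroup_diff_bnd[OF s(1)])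
  qed
  have m: "(\<lambda>(s, x). indicator {0<..t - r} s * heat s (?h s) x) \<in> borel_measurable (borel \<Otimes>\<^sub>M borel)"
  proof -
    note [measurable] = duhamel_measurable[OF exp_cont_f_bnd_cont[OF u] t0 t(3)] duhamel_measurable[OF exp_cont_f_bnd_cont[OF v] t0 t(3)]
    have "(\<lambda>z. indicator {0<..t - r} (fst z) * ((case z of (s, x) \<Rightarrow> indicator {0<..t} s * heat s (?fu (t - s)) x)
       - (case z of (s, x) \<Rightarrow> indicator {0<..t} s * heat s (?fv (t - s)) x))) \<in> borel_measurable (borel \<Otimes>\<^sub>M (borel :: 'a measure))"
      by (intro borel_measurable_times borel_measurable_diff
          duhamel_measurable[OF exp_cont_f_bnd_cont[OF u] t0 t(3)] duhamel_measurable[OF exp_cont_f_bnd_cont[OF v] t0 t(3)]) measurable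
    also have "?this \<longleftrightarrow> ?thesis"
      by (rule measurable_cong) (use t hH in \<open>auto simp: indicator_def split: if_splits\<close>)
    finally show ?thesis .
  qed
  have A: "0 \<le> lipL K * l" using lipL_ge_1[OF K(1)] l by simp
  have h: "bnd (?h s) (lipL K * l)" if "0 < s" "s \<le> t - r" for s
    using that t l by (intro f_lipschitz K uv exp_cont_measurable[OF u] exp_cont_measurable[OF v]) auto
  have tr: "0 \<le> t - r" using t by simp
  note D = duhamel_estimate[OF order_refl tr A h m l'(1)]
  have E: "duh u t x - duh v t x = (\<integral>s. indicator {0<..t - r} s * heat s (?h s) x \<partial>lborel)" for x
  proof -
    have "duh u t x - duh v t x = (\<integral>s. indicator {0<..t} s * heat s (?fu (t - s)) x - indicator {0<..t} s * heat s (?fv (t - s)) x \<partial>lborel)"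
      unfolding duh_def using duh_integrable(1)[OF u t0 t(3)] duh_integrable(1)[OF v t0 t(3)]
      by (intro Bochner_Integration.integral_diff[symmetric])
    also have "\<dots> = (\<integral>s. indicator {0<..t - r} s * heat s (?h s) x \<partial>lborel)"
    proof (intro Bochner_Integration.integral_cong refl)
      fix s
      consider "0 < s" "s \<le> t - r" | "t - r < s" "s \<le> t" | "s \<le> 0 \<or> t < s" by linarith
      then show "indicator {0<..t} s * heat s (?fu (t - s)) x - indicator {0<..t} s * heat s (?fv (t - s)) x
        = indicator {0<..t - r} s * heat s (?h s) x"
      proof cases
        case 1 then show ?thesis using hH[of s x] t by simp
      next
        case 2
        have s0: "s \<noteq> 0" using 2 t by auto
        have "AE y in lborel. u (t - s) y = v (t - s) y" using 2 by (intro eq) auto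
        then have ae: "AE y in lborel. ?fu (t - s) y = ?fv (t - s) y" by eventually_elim simp
        have "v (t - s) \<in> borel_measurable borel" using 2 t by (intro exp_cont_measurable[OF v]) auto
        then have vm: "?fv (t - s) \<in> borel_measurable borel" by measurable
        have "heat s (?fu (t - s)) x = heat s (?fv (t - s)) x"
          using frac_heat_semigroup_AE_eq[OF s0 vm ae, of \<beta> x] semigroup_eq_lborel[OF s0 vm, of x] by simp
        then show ?thesis using 2 by simp
      next
        case 3 then show ?thesis using t by auto
      qed
    qed
    finally show ?thesis .
  qed
  show "\<bar>duh u t x - duh v t x\<bar> \<le> l'" for x unfolding E by (rule D(2)) (use l' in auto)
  show "exp_modular p l' (\<lambda>x. duh u t x - duh v t x) \<le> 1" unfolding E by (rule D(3)) (use l' in auto)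
qed

text \<open>With the elapsed time as variable the same semigroup operator acts in both terms. The
  increment splits into the increments of \<open>f (u s)\<close> over elapsed times up to s and a
  remainder over elapsed times between s and t.\<close>

lemma duh_time_diff:
  assumes u: "exp_cont T u" and K: "0 \<le> K" "\<And>t. t \<in> {0..T} \<Longrightarrow> exp_modular p l0 (u t) \<le> ennreal K"
    and st: "0 \<le> s" "s \<le> t" "t \<le> T"
    and l: "0 < l" "\<And>r. 0 \<le> r \<Longrightarrow> r \<le> s \<Longrightarrow> exp_modular p l (\<lambda>x. u (r + (t - s)) x - u r x) \<le> 1"
    and j: "0 < j" "lipL K * l * om s \<le> j" "lipL K * (max 1 K * l0) * om (t - s) \<le> j"
  shows "exp_modular p (j + j) (\<lambda>x. duh u t x - duh u s x) \<le> 1"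
proof -
  let ?fu = "\<lambda>s y. f (u s y)"
  have t0: "0 \<le> t" and sT: "s \<le> T" and ts: "0 \<le> t - s" using st by auto
  have bu: "\<exists>A. bnd (?fu s) A" if "0 \<le> s" "s \<le> T" for s
    using exp_cont_f_bnd_cont[OF u] that by (auto simp: bnd_cont_def)
  note mt = duhamel_measurable[OF exp_cont_f_bnd_cont[OF u] t0 st(3)]
  note ms = duhamel_measurable[OF exp_cont_f_bnd_cont[OF u] st(1) sT]
  let ?h = "\<lambda>r y. ?fu (t - r) y - ?fu (s - r) y"
  have hH: "heat r (?h r) x = heat r (?fu (t - r)) x - heat r (?fu (s - r)) x"
    if r: "0 < r" "r \<le> s" for r x
  proof -
    obtain A B where "bnd (?fu (t - r)) A" "bnd (?fu (s - r)) B" using bu[of "t - r"] bu[of "s - r"] r st by auto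
    then show ?thesis by (rule semigroup_diff_bnd[OF r(1)])
  qed
  have m1: "(\<lambda>(r, x). indicator {0<..s} r * heat r (?h r) x) \<in> borel_measurable (borel \<Otimes>\<^sub>M borel)"
  proof -
    have "(\<lambda>z. indicator {0<..s} (fst z) * ((case z of (r, x) \<Rightarrow> indicator {0<..t} r * heat r (?fu (t - r)) x)
       - (case z of (r, x) \<Rightarrow> indicator {0<..s} r * heat r (?fu (s - r)) x))) \<in> borel_measurable (borel \<Otimes>\<^sub>M (borel :: 'a measure))"
      by (intro borel_measurable_times borel_measurable_diff mt ms) measurable
    also have "?this \<longleftrightarrow> ?thesis"
      by (rule measurable_cong) (use st hH in \<open>auto simp: indicator_def split: if_splits\<close>)
    finally show ?thesis .
  qed
  have m2: "(\<lambda>(r, x). indicator {s<..t} r * heat r (?fu (t - r)) x) \<in> borel_measurable (borel \<Otimes>\<^sub>M borel)"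
  proof -
    have "(\<lambda>z. indicator {s<..t} (fst z) * (case z of (r, x) \<Rightarrow> indicator {0<..t} r * heat r (?fu (t - r)) x)) \<in> borel_measurable (borel \<Otimes>\<^sub>M (borel :: 'a measure))"
      by (intro borel_measurable_times mt) measurable
    also have "?this \<longleftrightarrow> ?thesis"
      by (rule measurable_cong) (use st in \<open>auto simp: indicator_def split: if_splits\<close>)
    finally show ?thesis .
  qed
  have A1: "0 \<le> lipL K * l" using lipL_ge_1[OF K(1)] l by simp
  have A2: "0 \<le> lipL K * (max 1 K * l0)" using lipL_ge_1[OF K(1)] l0_pos by simp
  have h1: "bnd (?h r) (lipL K * l)" if r: "0 < r" "r \<le> s" for r
  proof (rule f_lipschitz[OF _ _ l(1) K(1)])
    show "exp_modular p l (\<lambda>x. u (t - r) x - u (s - r) x) \<le> 1" using l(2)[of "s - r"] r by simp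
  qed (use r st in \<open>auto intro!: K exp_cont_measurable[OF u]\<close>)
  have h2: "bnd (?fu (t - r)) (lipL K * (max 1 K * l0))" if "s < r" "r \<le> t" for r
    using that st by (intro f_bnd K exp_cont_measurable[OF u]) auto
  have j': "lipL K * l * om (s - 0) \<le> j" using j by simp
  note D1 = duhamel_estimate[OF order_refl st(1) A1 h1 m1 j(1) j']
  note D2 = duhamel_estimate[OF st(1,2) A2 h2 m2 j(1) j(3)]
  have E: "duh u t x - duh u s x = (\<integral>r. indicator {0<..s} r * heat r (?h r) x \<partial>lborel)
      + (\<integral>r. indicator {s<..t} r * heat r (?fu (t - r)) x \<partial>lborel)" for x
  proof -
    have "duh u t x - duh u s x = (\<integral>r. indicator {0<..t} r * heat r (?fu (t - r)) x - indicator {0<..s} r * heat r (?fu (s - r)) x \<partial>lborel)"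
      unfolding duh_def using duh_integrable(1)[OF u t0 st(3)] duh_integrable(1)[OF u st(1) sT]
      by (intro Bochner_Integration.integral_diff[symmetric])
    also have "\<dots> = (\<integral>r. indicator {0<..s} r * heat r (?h r) x + indicator {s<..t} r * heat r (?fu (t - r)) x \<partial>lborel)"
      by (intro Bochner_Integration.integral_cong refl) (use st hH in \<open>auto simp: indicator_def\<close>)
    also have "\<dots> = (\<integral>r. indicator {0<..s} r * heat r (?h r) x \<partial>lborel)
      + (\<integral>r. indicator {s<..t} r * heat r (?fu (t - r)) x \<partial>lborel)"
      by (rule Bochner_Integration.integral_add[OF D1(1) D2(1)]) auto
    finally show ?thesis .
  qed
  show ?thesis unfolding E
    by (intro exp_modular_triangle borel_imp_lebesgue D1(4) D2(4) p1 j(1) D1(3) D2(3)) auto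
qed

lemma duh_exp_cont:
  assumes u: "exp_cont T u" shows "exp_cont T (duh u)"
  unfolding exp_cont_def
proof (intro conjI ballI allI impI)
  obtain K where K: "0 \<le> K" "\<And>t. t \<in> {0..T} \<Longrightarrow> exp_modular p l0 (u t) \<le> ennreal K"
    using exp_cont_bounded[OF u l0_pos] by auto
  fix t assume t: "t \<in> {0..T}"
  then have t0: "0 \<le> t" "t \<le> T" by auto
  show "duh u t \<in> borel_measurable borel" by (rule duh_integrable(2)[OF u t0])
  fix l :: real assume l: "0 < l"
  show "exp_modular p l (duh u t) < \<infinity>" by (rule duh_integrable(3)[OF u t0 l])
  define A where "A = lipL K * (max 1 K * l0)"
  have L: "1 \<le> lipL K" by (rule lipL_ge_1[OF K(1)])
  have A0: "0 < A" unfolding A_def using L l0_pos by (intro mult_pos_pos) auto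
  have oT: "0 \<le> om T" using t0 by (intro om_nonneg) auto
  \<comment> \<open>The level at which \<open>u\<close> has to vary so that its increments
    contribute at most l / 2; the 1 added to \<open>om T\<close> keeps the denominator
    positive.\<close>
  define e where "e = l / 2 / (lipL K * (om T + 1))"
  have e: "0 < e" unfolding e_def using l L oT by (intro divide_pos_pos mult_pos_pos) auto
  have eL: "lipL K * e * om s \<le> l / 2" if "0 \<le> s" "s \<le> T" for s
  proof -
    have "lipL K * e * om s \<le> lipL K * e * (om T + 1)"
      using om_mono[OF that] L e by (intro mult_left_mono) auto
    also have "\<dots> = l / 2"
    proof -
      have "a * (x / (a * b)) * b = x" if "a \<noteq> 0" "b \<noteq> 0" for a b x :: real using that by simp
      then show ?thesis unfolding e_def using L oT by (metis add_nonneg_pos less_irrefl less_le_trans zero_less_one)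
    qed
    finally show ?thesis .
  qed
  obtain d1 where d1: "0 < d1" "\<And>s t. s \<in> {0..T} \<Longrightarrow> t \<in> {0..T} \<Longrightarrow> \<bar>s - t\<bar> < d1 \<Longrightarrow> exp_modular p e (\<lambda>x. u s x - u t x) \<le> 1"
    using exp_cont_uniform[OF u e] by auto
  obtain d2 where d2: "0 < d2" "\<And>t. 0 \<le> t \<Longrightarrow> t \<le> d2 \<Longrightarrow> om t \<le> l / 2 / A"
    using om_small[of "l / 2 / A"] A0 l by auto
  have main: "exp_modular p l (\<lambda>x. duh u t x - duh u s x) \<le> 1" if st: "0 \<le> s" "s \<le> t" "t \<le> T" "t - s < d1" "t - s < d2" for s t
  proof -
    have "exp_modular p (l / 2 + l / 2) (\<lambda>x. duh u t x - duh u s x) \<le> 1"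
    proof (rule duh_time_diff[OF u K st(1,2,3) e])
      show "exp_modular p e (\<lambda>x. u (r + (t - s)) x - u r x) \<le> 1" if "0 \<le> r" "r \<le> s" for r
        using that st by (intro d1) auto
      show "lipL K * e * om s \<le> l / 2" using st by (intro eL) auto
      have "om (t - s) \<le> l / 2 / A" using st by (intro d2) auto
      then have "A * om (t - s) \<le> A * (l / 2 / A)" using A0 by (intro mult_left_mono) auto
      then show "lipL K * (max 1 K * l0) * om (t - s) \<le> l / 2" using A0 by (simp add: A_def[symmetric])
    qed (use l in auto)
    then show ?thesis by simp
  qed
  show "\<exists>d>0. \<forall>s\<in>{0..T}. \<bar>s - t\<bar> < d \<longrightarrow> exp_modular p l (\<lambda>x. duh u s x - duh u t x) \<le> 1"
  proof (intro exI[of _ "min d1 d2"] conjI ballI impI)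
    fix s assume s: "s \<in> {0..T}" "\<bar>s - t\<bar> < min d1 d2"
    show "exp_modular p l (\<lambda>x. duh u s x - duh u t x) \<le> 1"
      using main[of s t] main[of t s] s t by (cases "s \<le> t") (auto simp: exp_modular_uminus[of p l "duh u s"])
  qed (use d1 d2 in auto)
qed

lemma exp_cont_add:
  assumes u: "exp_cont T u" and v: "exp_cont T v" shows "exp_cont T (\<lambda>t x. u t x + v t x)"
  unfolding exp_cont_def
proof (intro conjI ballI allI impI)
  fix t assume t: "t \<in> {0..T}"
  then have m: "u t \<in> borel_measurable borel" "v t \<in> borel_measurable borel"
    using exp_cont_measurable[OF u] exp_cont_measurable[OF v] by auto
  then show "(\<lambda>x. u t x + v t x) \<in> borel_measurable borel" by measurable
  fix l :: real assume l: "0 < l"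
  have "exp_modular p (2 * (l / 2)) (\<lambda>x. u t x + v t x) \<le> exp_modular p (l / 2) (u t) + exp_modular p (l / 2) (v t)"
    using m l p0 by (intro exp_modular_add borel_imp_lebesgue) auto
  also have "\<dots> < \<infinity>" using exp_cont_finite[OF u, of t "l / 2"] exp_cont_finite[OF v, of t "l / 2"] t l by auto
  finally show "exp_modular p l (\<lambda>x. u t x + v t x) < \<infinity>" by simp
  obtain d1 where d1: "0 < d1" "\<And>s t. s \<in> {0..T} \<Longrightarrow> t \<in> {0..T} \<Longrightarrow> \<bar>s - t\<bar> < d1 \<Longrightarrow> exp_modular p (l / 2) (\<lambda>x. u s x - u t x) \<le> 1"
    using exp_cont_uniform[OF u half_gt_zero[OF l]] by auto
  obtain d2 where d2: "0 < d2" "\<And>s t. s \<in> {0..T} \<Longrightarrow> t \<in> {0..T} \<Longrightarrow> \<bar>s - t\<bar> < d2 \<Longrightarrow> exp_modular p (l / 2) (\<lambda>x. v s x - v t x) \<le> 1"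
    using exp_cont_uniform[OF v half_gt_zero[OF l]] by auto
  show "\<exists>d>0. \<forall>s\<in>{0..T}. \<bar>s - t\<bar> < d \<longrightarrow> exp_modular p l (\<lambda>x. (u s x + v s x) - (u t x + v t x)) \<le> 1"
  proof (intro exI[of _ "min d1 d2"] conjI ballI impI)
    fix s assume s: "s \<in> {0..T}" "\<bar>s - t\<bar> < min d1 d2"
    then have ms: "u s \<in> borel_measurable borel" "v s \<in> borel_measurable borel"
      using exp_cont_measurable[OF u] exp_cont_measurable[OF v] by auto
    have "exp_modular p (l / 2 + l / 2) (\<lambda>x. (u s x - u t x) + (v s x - v t x)) \<le> 1"
      using s t l m ms by (intro exp_modular_triangle borel_imp_lebesgue p1 d1 d2) auto
    then show "exp_modular p l (\<lambda>x. (u s x + v s x) - (u t x + v t x)) \<le> 1" by (simp add: algebra_simps)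
  qed (use d1 d2 in auto)
qed

lemma semigroup_exp_cont:
  assumes u: "u \<in> exp_Lp0 p" and m: "u \<in> borel_measurable borel"
  shows "exp_cont T (\<lambda>t. heat t u)"
  unfolding exp_cont_def
proof (intro conjI ballI allI impI)
  fix t assume t: "t \<in> {0..T}"
  show "heat t u \<in> borel_measurable borel" by (rule semigroup_measurable[OF m])
  fix l :: real assume l: "0 < l"
  have fin: "exp_modular p l u < \<infinity>" by (rule exp_Lp0_modular_finite[OF u p1 l])
  show "exp_modular p l (heat t u) < \<infinity>"
    by (rule order.strict_trans1[OF semigroup_exp_modular[OF _ p1 m fin l] fin]) (use t in auto)
  show "\<exists>d>0. \<forall>s\<in>{0..T}. \<bar>s - t\<bar> < d \<longrightarrow> exp_modular p l (\<lambda>x. heat s u x - heat t u x) \<le> 1"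
    using semigroup_strong_continuity[OF u m p l, of t] t by auto
qed

end

section \<open>Picard iteration and uniqueness\<close>

lemma le_1_finite: "(x::ennreal) \<le> 1 \<Longrightarrow> x < \<infinity>"
  unfolding infinity_ennreal_def by (metis ennreal_1 ennreal_less_top order.strict_trans1)

lemma exp_modular_Fatou:
  assumes p: "0 < p" and l: "0 < l" and [measurable]: "\<And>j. w j \<in> borel_measurable borel"
    and lim: "\<And>x. (\<lambda>j::nat. w j x) \<longlonglongrightarrow> v x" and c: "\<And>j. exp_modular p l (w j) \<le> c"
  shows "exp_modular p l v \<le> c"
proof -
  have L: "(\<lambda>j. ennreal (exp (\<bar>w j x\<bar> powr p / l powr p) - 1)) \<longlonglongrightarrow> ennreal (exp (\<bar>v x\<bar> powr p / l powr p) - 1)" for x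
  proof -
    have "(\<lambda>j. \<bar>w j x\<bar> powr p) \<longlonglongrightarrow> \<bar>v x\<bar> powr p"
      using p by (intro tendsto_powr2[OF tendsto_rabs[OF lim] tendsto_const]) auto
    then show ?thesis using l by (intro tendsto_ennrealI tendsto_diff tendsto_exp tendsto_divide tendsto_const) auto
  qed
  have "exp_modular p l v = (\<integral>\<^sup>+x. liminf (\<lambda>j. ennreal (exp (\<bar>w j x\<bar> powr p / l powr p) - 1)) \<partial>lborel)"
    unfolding exp_modular_lborel by (intro nn_integral_cong lim_imp_Liminf[OF _ L, symmetric]) simp
  also have "\<dots> \<le> liminf (\<lambda>j. exp_modular p l (w j))"
    unfolding exp_modular_lborel by (rule nn_integral_liminf) measurable
  also have "\<dots> \<le> c"
    using Liminf_le[of sequentially "\<lambda>j. exp_modular p l (w j)" c] c by simp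
  finally show ?thesis .
qed

text \<open>Each hypothesis bounds the p-th moment of \<open>w\<close> by (l / 2^i)^p, so this
  moment vanishes.\<close>

lemma AE_zero_of_exp_modular:
  assumes p: "0 < p" and l: "0 < l" and [measurable]: "w \<in> borel_measurable borel"
    and h: "\<And>i::nat. exp_modular p (l / 2 ^ i) w \<le> 1"
  shows "AE x in lborel. w x = 0"
proof -
  have le: "(\<integral>\<^sup>+x. ennreal (\<bar>w x\<bar> powr p) \<partial>lborel) \<le> ennreal ((l / 2 ^ i) powr p)" for i
  proof -
    have "(\<integral>\<^sup>+x. ennreal (\<bar>w x\<bar> powr p) \<partial>lborel) \<le> ennreal ((l / 2 ^ i) powr p) * exp_modular p (l / 2 ^ i) w"
      using moment_le_exp_modular[of "l / 2 ^ i" 1 w p] l by simp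
    also have "\<dots> \<le> ennreal ((l / 2 ^ i) powr p) * 1" by (intro mult_left_mono h) simp
    finally show ?thesis by simp
  qed
  have "(\<lambda>i. l * (1 / 2) ^ i) \<longlonglongrightarrow> l * 0" by (intro tendsto_mult tendsto_const LIMSEQ_power_zero) simp
  then have "(\<lambda>i. l / 2 ^ i) \<longlonglongrightarrow> 0" by (simp add: power_one_over)
  then have "(\<lambda>i. (l / 2 ^ i) powr p) \<longlonglongrightarrow> 0 powr p"
    using p l by (intro tendsto_powr2[OF _ tendsto_const]) auto
  then have "(\<lambda>i. ennreal ((l / 2 ^ i) powr p)) \<longlonglongrightarrow> ennreal 0" using p by (intro tendsto_ennrealI) simp
  then have "(\<integral>\<^sup>+x. ennreal (\<bar>w x\<bar> powr p) \<partial>lborel) \<le> ennreal 0"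
    by (rule LIMSEQ_le_const) (use le in auto)
  then have "(\<integral>\<^sup>+x. ennreal (\<bar>w x\<bar> powr p) \<partial>lborel) = 0" by simp
  then have "AE x in lborel. ennreal (\<bar>w x\<bar> powr p) = 0" by (subst (asm) nn_integral_0_iff_AE) auto
  then show ?thesis by eventually_elim (use p in \<open>auto simp: ennreal_eq_0_iff\<close>)
qed

context frac_heat_nonlinear
begin

lemma exp_cont_limit:
  assumes U: "\<And>m::nat. exp_cont T (U m)" and m: "\<And>t. t \<in> {0..T} \<Longrightarrow> u t \<in> borel_measurable borel"
    and lim: "\<And>l. 0 < l \<Longrightarrow> \<exists>m. \<forall>t\<in>{0..T}. exp_modular p l (\<lambda>x. u t x - U m t x) \<le> 1"
  shows "exp_cont T u"
  unfolding exp_cont_def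
proof (intro conjI ballI allI impI)
  fix t assume t: "t \<in> {0..T}"
  have Um: "U m s \<in> borel_measurable borel" if "s \<in> {0..T}" for m s using exp_cont_measurable[OF U] that by auto
  show "u t \<in> borel_measurable borel" by (rule m[OF t])
  fix l :: real assume l: "0 < l"
  obtain i where i: "\<forall>t\<in>{0..T}. exp_modular p (l / 2) (\<lambda>x. u t x - U i t x) \<le> 1" using lim[of "l / 2"] l by auto
  have "exp_modular p (2 * (l / 2)) (\<lambda>x. (u t x - U i t x) + U i t x) \<le> exp_modular p (l / 2) (\<lambda>x. u t x - U i t x) + exp_modular p (l / 2) (U i t)"
    using m[OF t] Um[OF t] p0 l by (intro exp_modular_add borel_imp_lebesgue) auto
  also have "\<dots> < \<infinity>"
    using le_1_finite[OF i[rule_format, OF t]] t l exp_cont_finite[OF U, of t "l / 2"] by auto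
  finally show "exp_modular p l (u t) < \<infinity>" by simp
  obtain i where i: "\<forall>t\<in>{0..T}. exp_modular p (l / 3) (\<lambda>x. u t x - U i t x) \<le> 1" using lim[of "l / 3"] l by auto
  obtain d where d: "0 < d" "\<And>s t. s \<in> {0..T} \<Longrightarrow> t \<in> {0..T} \<Longrightarrow> \<bar>s - t\<bar> < d \<Longrightarrow> exp_modular p (l / 3) (\<lambda>x. U i s x - U i t x) \<le> 1"
    using exp_cont_uniform[OF U, of "l / 3" i] l by auto
  show "\<exists>d>0. \<forall>s\<in>{0..T}. \<bar>s - t\<bar> < d \<longrightarrow> exp_modular p l (\<lambda>x. u s x - u t x) \<le> 1"
  proof (intro exI[of _ d] conjI ballI impI)
    fix s assume s: "s \<in> {0..T}" "\<bar>s - t\<bar> < d"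
    have i': "exp_modular p (l / 3) (\<lambda>x. U i t x - u t x) \<le> 1"
      using i t by (subst exp_modular_uminus) auto
    have iz: "exp_modular p (l / 3) (\<lambda>x. u s x - U i s x) \<le> 1" using i s by auto
    have "exp_modular p ((l / 3 + l / 3) + l / 3) (\<lambda>x. ((u s x - U i s x) + (U i s x - U i t x)) + (U i t x - u t x)) \<le> 1"
      using m[OF s(1)] m[OF t] Um[OF s(1)] Um[OF t] l
      by (intro exp_modular_triangle borel_imp_lebesgue p1 d(2) i' iz s t) auto
    then show "exp_modular p l (\<lambda>x. u s x - u t x) \<le> 1" by simp
  qed (use d in auto)
qed

primrec picard :: "('a \<Rightarrow> real) \<Rightarrow> nat \<Rightarrow> real \<Rightarrow> 'a \<Rightarrow> real" where
  "picard u0 0 = (\<lambda>t. heat t u0)"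
| "picard u0 (Suc m) = (\<lambda>t x. heat t u0 x + duh (picard u0 m) t x)"

lemma picard_exists:
  assumes u0: "u0 \<in> exp_Lp0 p" and u0m: "u0 \<in> borel_measurable borel"
  shows "\<exists>T>0. \<exists>u. exp_cont T u \<and> (\<forall>t\<in>{0..T}. \<forall>x. u t x = heat t u0 x + duh u t x)"
proof -
  \<comment> \<open>The radius of the ball around u0: by \<open>exp_modular_add\<close>, distance at
    most r bounds the modular at level 2 r = l0, the level of the Lipschitz estimate, by the
    constant \<open>K\<close> below.\<close>
  define r where "r = l0 / 2"
  have r: "0 < r" using l0_pos by (simp add: r_def)
  let ?S = "\<lambda>t. heat t u0"
  have fin: "exp_modular p r u0 < \<infinity>" by (rule exp_Lp0_modular_finite[OF u0 p1 r])
  define K where "K = 1 + enn2real (exp_modular p r u0)"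
  have K: "0 \<le> K" by (simp add: K_def)
  have L: "1 \<le> lipL K" by (rule lipL_ge_1[OF K])
  define A where "A = lipL K * (max 1 K * l0)"
  have A: "0 < A" unfolding A_def using L l0_pos by (intro mult_pos_pos) auto
  have near: "exp_modular p l0 w \<le> ennreal K" if "w \<in> borel_measurable borel" "exp_modular p r (\<lambda>x. w x - u0 x) \<le> 1" for w
  proof -
    have "exp_modular p (2 * r) (\<lambda>x. (w x - u0 x) + u0 x) \<le> exp_modular p r (\<lambda>x. w x - u0 x) + exp_modular p r u0"
      using that u0m p0 r by (intro exp_modular_add borel_imp_lebesgue) auto
    also have "\<dots> \<le> 1 + exp_modular p r u0" by (rule add_right_mono[OF that(2)])
    also have "\<dots> = ennreal K" unfolding K_def using fin by (subst ennreal_plus) (auto simp: less_top)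
    finally show ?thesis by (simp add: r_def)
  qed
  obtain d1 where d1: "0 < d1" "\<And>t. 0 \<le> t \<Longrightarrow> t < d1 \<Longrightarrow> exp_modular p (r / 2) (\<lambda>x. ?S t x - u0 x) \<le> 1"
    using semigroup_strong_continuity[OF u0 u0m p, of "r / 2" 0] r by (auto simp: frac_heat_semigroup_def[of \<beta> 0])
  obtain d2 where d2: "0 < d2" "\<And>t. 0 \<le> t \<Longrightarrow> t \<le> d2 \<Longrightarrow> om t \<le> r / 2 / A"
    using om_small[of "r / 2 / A"] r A by auto
  obtain d3 where d3: "0 < d3" "\<And>t. 0 \<le> t \<Longrightarrow> t \<le> d3 \<Longrightarrow> om t \<le> 1 / (2 * lipL K)"
    using om_small[of "1 / (2 * lipL K)"] L by auto
  \<comment> \<open>Up to d1 / 2, strictly inside d1, the free evolution stays within r / 2 of u0;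
    d2 keeps the Duhamel term within the other r / 2; d3 makes the Lipschitz constant of the Duhamel
    map at most 1 / 2.\<close>
  define T where "T = min (d1 / 2) (min d2 d3)"
  have T: "0 < T" using d1 d2 d3 by (simp add: T_def)
  have S0: "exp_modular p (r / 2) (\<lambda>x. ?S t x - u0 x) \<le> 1" if "t \<in> {0..T}" for t
    using that d1 by (intro d1(2)) (auto simp: T_def)
  have Aom: "A * om t \<le> r / 2" if "t \<in> {0..T}" for t
  proof -
    have "A * om t \<le> A * (r / 2 / A)" using that A by (intro mult_left_mono d2) (auto simp: T_def)
    then show ?thesis using A by simp
  qed
  have Lom: "lipL K * l * om t \<le> l / 2" if "t \<in> {0..T}" "0 < l" for t l
  proof -
    have "(lipL K * l) * om t \<le> (lipL K * l) * (1 / (2 * lipL K))" using that L by (intro mult_left_mono d3) (auto simp: T_def)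
    then show ?thesis using L by simp
  qed
  let ?U = "picard u0"
  have Sc: "exp_cont T ?S" by (rule semigroup_exp_cont[OF u0 u0m])
  have Sm: "?S t \<in> borel_measurable borel" for t by (rule semigroup_measurable[OF u0m])
  have inv: "exp_cont T (?U m) \<and> (\<forall>t\<in>{0..T}. exp_modular p l0 (?U m t) \<le> ennreal K)" for m
  proof (induction m)
    case 0
    have "exp_modular p r (\<lambda>x. ?S t x - u0 x) \<le> 1" if "t \<in> {0..T}" for t
      using exp_modular_antimono[of p "r / 2" r] S0[OF that] p0 r by (fastforce intro: order_trans)
    then show ?case using Sc near[OF Sm] by simp
  next
    case (Suc m)
    then have c: "exp_cont T (?U m)" and b: "\<And>t. t \<in> {0..T} \<Longrightarrow> exp_modular p l0 (?U m t) \<le> ennreal K" by auto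
    have c': "exp_cont T (?U (Suc m))" using exp_cont_add[OF Sc duh_exp_cont[OF c]] by simp
    have "exp_modular p l0 (?U (Suc m) t) \<le> ennreal K" if t: "t \<in> {0..T}" for t
    proof (rule near)
      show "?U (Suc m) t \<in> borel_measurable borel" using exp_cont_measurable[OF c'] t by auto
      have D: "exp_modular p (r / 2) (duh (?U m) t) \<le> 1"
        by (rule duh_estimate(3)[OF c K b]) (use t r Aom[OF t] in \<open>auto simp: A_def\<close>)
      have "exp_modular p (r / 2 + r / 2) (\<lambda>x. (?S t x - u0 x) + duh (?U m) t x) \<le> 1"
        using Sm u0m duh_integrable(2)[OF c] t r
        by (intro exp_modular_triangle borel_imp_lebesgue p1 S0 D) auto
      then show "exp_modular p r (\<lambda>x. ?U (Suc m) t x - u0 x) \<le> 1" by (simp add: algebra_simps)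
    qed
    with c' show ?case by blast
  qed
  then have Uc: "exp_cont T (?U m)" and UK: "t \<in> {0..T} \<Longrightarrow> exp_modular p l0 (?U m t) \<le> ennreal K" for m t by auto
  have Um: "?U m t \<in> borel_measurable borel" if "t \<in> {0..T}" for m t using exp_cont_measurable[OF Uc] that by auto
  \<comment> \<open>The supremum of the increments is tracked along with the modular: the iterates
    may be unbounded, but uniformly small increments make them converge at every point.\<close>
  have dif: "\<forall>t\<in>{0..T}. (\<forall>x. \<bar>?U (Suc m) t x - ?U m t x\<bar> \<le> r / 2 ^ m) \<and> exp_modular p (r / 2 ^ m) (\<lambda>x. ?U (Suc m) t x - ?U m t x) \<le> 1" for m
  proof (induction m)
    case 0
    show ?case
    proof (intro ballI)
      fix t assume t: "t \<in> {0..T}"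
      have a: "lipL K * (max 1 K * l0) * om t \<le> r" using Aom[OF t] r by (simp add: A_def)
      show "(\<forall>x. \<bar>?U (Suc 0) t x - ?U 0 t x\<bar> \<le> r / 2 ^ 0) \<and> exp_modular p (r / 2 ^ 0) (\<lambda>x. ?U (Suc 0) t x - ?U 0 t x) \<le> 1"
        using duh_estimate(2,3)[OF Uc K UK _ _ r a, of 0] t by simp
    qed
  next
    case (Suc m)
    show ?case
    proof (intro ballI)
      fix t assume t: "t \<in> {0..T}"
      have t': "0 \<le> t" "t \<le> T" using t by auto
      have l: "0 < r / 2 ^ m" "0 < r / 2 ^ Suc m" using r by auto
      have lo: "lipL K * (r / 2 ^ m) * om (t - 0) \<le> r / 2 ^ Suc m" using Lom[OF t l(1)] by simp
      have uv: "exp_modular p (r / 2 ^ m) (\<lambda>x. ?U (Suc m) s x - ?U m s x) \<le> 1" if "0 \<le> s" "s \<le> t" for s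
        using Suc.IH that t by auto
      note D = duh_diff[OF Uc Uc K UK UK order_refl t' _ uv l(1) l(2) lo]
      have "\<bar>duh (?U (Suc m)) t x - duh (?U m) t x\<bar> \<le> r / 2 ^ Suc m" for x by (rule D(1)) auto
      moreover have "exp_modular p (r / 2 ^ Suc m) (\<lambda>x. duh (?U (Suc m)) t x - duh (?U m) t x) \<le> 1" by (rule D(2)) auto
      moreover have a: "?U (Suc m) t x = ?S t x + duh (?U m) t x" for m x by simp
      have "?U (Suc (Suc m)) t x - ?U (Suc m) t x = duh (?U (Suc m)) t x - duh (?U m) t x" for x
        using a[of "Suc m" x] a[of m x] by linarith
      ultimately show "(\<forall>x. \<bar>?U (Suc (Suc m)) t x - ?U (Suc m) t x\<bar> \<le> r / 2 ^ Suc m) \<and> exp_modular p (r / 2 ^ Suc m) (\<lambda>x. ?U (Suc (Suc m)) t x - ?U (Suc m) t x) \<le> 1"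
        by (simp only:) simp
    qed
  qed
  \<comment> \<open>The tail r / 2^m + r / 2^(m+1) + ... equals 2 r / 2^m. The induction on j needs
    all m at once, as its step passes from m to m + 1.\<close>
  have tele: "\<forall>m. (\<forall>x. \<bar>?U (m + j) t x - ?U m t x\<bar> \<le> 2 * r / 2 ^ m) \<and> exp_modular p (2 * r / 2 ^ m) (\<lambda>x. ?U (m + j) t x - ?U m t x) \<le> 1"
    if t: "t \<in> {0..T}" for t j
  proof (induction j)
    case 0 show ?case using r p0 by (auto simp: exp_modular_def)
  next
    case (Suc j)
    show ?case
    proof (intro allI)
      fix m
      have s: "2 * r / 2 ^ Suc m + r / 2 ^ m = 2 * r / 2 ^ m" by (simp add: field_simps)
      have 1: "\<bar>?U (Suc m + j) t x - ?U (Suc m) t x\<bar> \<le> 2 * r / 2 ^ Suc m" for x using Suc.IH by blast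
      have 2: "\<bar>?U (Suc m) t x - ?U m t x\<bar> \<le> r / 2 ^ m" for x using dif t by blast
      have a: "\<bar>?U (m + Suc j) t x - ?U m t x\<bar> \<le> 2 * r / 2 ^ m" for x
        using 1[of x] 2[of x] s by (simp only: add_Suc_right add_Suc)
      have "exp_modular p (2 * r / 2 ^ Suc m + r / 2 ^ m) (\<lambda>x. (?U (Suc m + j) t x - ?U (Suc m) t x) + (?U (Suc m) t x - ?U m t x)) \<le> 1"
      proof (rule exp_modular_triangle[OF _ _ p1])
        show "exp_modular p (2 * r / 2 ^ Suc m) (\<lambda>x. ?U (Suc m + j) t x - ?U (Suc m) t x) \<le> 1" using Suc.IH by blast
        show "exp_modular p (r / 2 ^ m) (\<lambda>x. ?U (Suc m) t x - ?U m t x) \<le> 1" using dif t by blast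
        show "0 < 2 * r / 2 ^ Suc m" "0 < r / 2 ^ m" using r by simp_all
      qed (intro borel_imp_lebesgue borel_measurable_diff Um t)+
      then have "exp_modular p (2 * r / 2 ^ m) (\<lambda>x. ?U (m + Suc j) t x - ?U m t x) \<le> 1"
        unfolding s by (simp del: picard.simps)
      with a show "(\<forall>x. \<bar>?U (m + Suc j) t x - ?U m t x\<bar> \<le> 2 * r / 2 ^ m) \<and> exp_modular p (2 * r / 2 ^ m) (\<lambda>x. ?U (m + Suc j) t x - ?U m t x) \<le> 1"
        by blast
    qed
  qed
  have pw0: "(\<lambda>m. 2 * r / 2 ^ m) \<longlonglongrightarrow> 0"
  proof -
    have "(\<lambda>i. 2 * r * (1 / 2) ^ i) \<longlonglongrightarrow> 2 * r * 0" by (intro tendsto_mult tendsto_const LIMSEQ_power_zero) simp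
    then show ?thesis by (simp add: power_one_over)
  qed
  define u where "u t x = lim (\<lambda>m. ?U m t x)" for t x
  have ulim: "(\<lambda>m. ?U m t x) \<longlonglongrightarrow> u t x" if t: "t \<in> {0..T}" for t x
  proof -
    have "Cauchy (\<lambda>m. ?U m t x)"
    proof (rule CauchyI')
      fix e :: real assume "0 < e"
      then have "\<forall>\<^sub>F m in sequentially. 2 * r / 2 ^ m < e" by (rule order_tendstoD(2)[OF pw0])
      then obtain M where M: "\<And>m. M \<le> m \<Longrightarrow> 2 * r / 2 ^ m < e" by (auto simp: eventually_sequentially)
      show "\<exists>M. \<forall>m\<ge>M. \<forall>n>m. dist (?U m t x) (?U n t x) < e"
      proof (intro exI[of _ M] allI impI)
        fix m n assume m: "M \<le> m" "m < n"
        have "\<bar>?U (m + (n - m)) t x - ?U m t x\<bar> \<le> 2 * r / 2 ^ m" using tele[OF t, of "n - m"] by blast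
        then show "dist (?U m t x) (?U n t x) < e" using M[OF m(1)] m by (simp add: dist_real_def abs_minus_commute)
      qed
    qed
    then show ?thesis unfolding u_def by (simp add: real_Cauchy_convergent convergent_LIMSEQ_iff[symmetric])
  qed
  have um: "u t \<in> borel_measurable borel" if t: "t \<in> {0..T}" for t
    by (rule borel_measurable_LIMSEQ_real[OF ulim[OF t] Um[OF t]])
  \<comment> \<open>The bound for the iterates m + j and m is uniform in j, so Fatou's lemma carries
    it to the limit.\<close>
  have uU: "exp_modular p (2 * r / 2 ^ m) (\<lambda>x. u t x - ?U m t x) \<le> 1" if t: "t \<in> {0..T}" for t m
  proof (rule exp_modular_Fatou[OF p0])
    show "(\<lambda>x. ?U (m + j) t x - ?U m t x) \<in> borel_measurable borel" for j by (intro borel_measurable_diff Um t)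
    show "(\<lambda>j. ?U (m + j) t x - ?U m t x) \<longlonglongrightarrow> u t x - ?U m t x" for x
      using LIMSEQ_ignore_initial_segment[OF ulim[OF t, of x], of m] by (intro tendsto_diff tendsto_const) (simp add: add.commute)
    show "exp_modular p (2 * r / 2 ^ m) (\<lambda>x. ?U (m + j) t x - ?U m t x) \<le> 1" for j using tele[OF t, of j] by blast
  qed (use r in auto)
  have uc: "exp_cont T u"
  proof (rule exp_cont_limit[OF Uc um])
    fix l :: real assume l: "0 < l"
    then have "\<forall>\<^sub>F m in sequentially. 2 * r / 2 ^ m < l" by (rule order_tendstoD(2)[OF pw0])
    then obtain m where m: "2 * r / 2 ^ m < l" by (auto simp: eventually_sequentially)
    have "exp_modular p l (\<lambda>x. u t x - ?U m t x) \<le> 1" if "t \<in> {0..T}" for t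
      by (rule order_trans[OF exp_modular_antimono uU[OF that, of m]]) (use p0 r m in auto)
    then show "\<exists>m. \<forall>t\<in>{0..T}. exp_modular p l (\<lambda>x. u t x - ?U m t x) \<le> 1" by blast
  qed
  have uK: "exp_modular p l0 (u t) \<le> ennreal K" if t: "t \<in> {0..T}" for t
    by (rule exp_modular_Fatou[OF p0 l0_pos Um[OF t] ulim[OF t] UK[OF t]])
  \<comment> \<open>The supremum of a difference of Duhamel terms is bounded by the modular distance
    of the curves, so the Duhamel map commutes with the limit of the iterates.\<close>
  have "u t x = ?S t x + duh u t x" if t: "t \<in> {0..T}" for t x
  proof (rule LIMSEQ_unique)
    show "(\<lambda>m. ?U (Suc m) t x) \<longlonglongrightarrow> u t x" by (rule LIMSEQ_Suc[OF ulim[OF t]])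
    have t': "0 \<le> t" "t \<le> T" using t by auto
    have b: "\<bar>duh (?U m) t x - duh u t x\<bar> \<le> 2 * r / 2 ^ m" for m
    proof -
      have l: "0 < 2 * r / 2 ^ m" using r by simp
      have lo: "lipL K * (2 * r / 2 ^ m) * om (t - 0) \<le> 2 * r / 2 ^ m" using Lom[OF t l] l by simp
      have uv: "exp_modular p (2 * r / 2 ^ m) (\<lambda>x. u s x - ?U m s x) \<le> 1" if "0 \<le> s" "s \<le> t" for s
        using uU that t by auto
      have "\<bar>duh u t x - duh (?U m) t x\<bar> \<le> 2 * r / 2 ^ m"
        by (rule duh_diff(1)[OF uc Uc K uK UK order_refl t' _ uv l l lo]) auto
      then show ?thesis by (simp add: abs_minus_commute)
    qed
    have "(\<lambda>m. duh (?U m) t x - duh u t x) \<longlonglongrightarrow> 0"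
      by (rule Lim_null_comparison[OF _ pw0]) (use b in auto)
    then have "(\<lambda>m. duh (?U m) t x) \<longlonglongrightarrow> duh u t x" by (simp add: LIM_zero_iff)
    then show "(\<lambda>m. ?U (Suc m) t x) \<longlonglongrightarrow> ?S t x + duh u t x" by (simp add: tendsto_add)
  qed
  with T uc show ?thesis by blast
qed

text \<open>The bound \<open>K\<close> holds on all of [0, T], so the step length \<open>h\<close>
  is the same everywhere and finitely many steps suffice. Once the curves agree up to r, their
  difference on [r, r + h] satisfies its own bound at half the level; repeated halving forces it to
  0.\<close>

lemma mild_unique:
  assumes u: "exp_cont T u" and v: "exp_cont T v"
    and eu: "\<And>t. t \<in> {0..T} \<Longrightarrow> AE x in lborel. u t x = S t x + duh u t x"
    and ev: "\<And>t. t \<in> {0..T} \<Longrightarrow> AE x in lborel. v t x = S t x + duh v t x"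
    and t: "t \<in> {0..T}"
  shows "AE x in lborel. u t x = v t x"
proof -
  obtain K1 where K1: "0 \<le> K1" "\<And>t. t \<in> {0..T} \<Longrightarrow> exp_modular p l0 (u t) \<le> ennreal K1"
    using exp_cont_bounded[OF u l0_pos] by auto
  obtain K2 where K2: "0 \<le> K2" "\<And>t. t \<in> {0..T} \<Longrightarrow> exp_modular p l0 (v t) \<le> ennreal K2"
    using exp_cont_bounded[OF v l0_pos] by auto
  define K where "K = max K1 K2"
  have K: "0 \<le> K" "\<And>t. t \<in> {0..T} \<Longrightarrow> exp_modular p l0 (u t) \<le> ennreal K" "\<And>t. t \<in> {0..T} \<Longrightarrow> exp_modular p l0 (v t) \<le> ennreal K"
  proof -
    have "ennreal K1 \<le> ennreal K" "ennreal K2 \<le> ennreal K" unfolding K_def by (auto intro!: ennreal_leI)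
    then show "exp_modular p l0 (u t) \<le> ennreal K" "exp_modular p l0 (v t) \<le> ennreal K" if "t \<in> {0..T}" for t
      using K1(2)[OF that] K2(2)[OF that] by (auto intro: order_trans)
  qed (use K1 in \<open>simp add: K_def\<close>)
  have L: "1 \<le> lipL K" by (rule lipL_ge_1[OF K(1)])
  have um: "u s \<in> borel_measurable borel" "v s \<in> borel_measurable borel" if "s \<in> {0..T}" for s
    using exp_cont_measurable[OF u] exp_cont_measurable[OF v] that by auto
  obtain h where h: "0 < h" "\<And>t. 0 \<le> t \<Longrightarrow> t \<le> h \<Longrightarrow> om t \<le> 1 / (2 * lipL K)"
    using om_small[of "1 / (2 * lipL K)"] L by auto
  \<comment> \<open>A level from which the halving can start: the modular at level 2 l0 is at most K
    + K, and \<open>exp_modular_le_1_exists\<close> rescales it.\<close>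
  define l where "l = max 1 (K + K) * (2 * l0)"
  have l: "0 < l" unfolding l_def using l0_pos by (intro mult_pos_pos) auto
  have uvl: "exp_modular p l (\<lambda>x. u s x - v s x) \<le> 1" if s: "s \<in> {0..T}" for s
    unfolding l_def
  proof (rule exp_modular_le_1_exists[OF p1])
    have "exp_modular p (2 * l0) (\<lambda>x. u s x + (- v s x)) \<le> exp_modular p l0 (u s) + exp_modular p l0 (\<lambda>x. - v s x)"
      using um[OF s] p0 l0_pos by (intro exp_modular_add borel_imp_lebesgue) auto
    also have "exp_modular p l0 (\<lambda>x. - v s x) = exp_modular p l0 (v s)" by (simp add: exp_modular_def)
    also have "exp_modular p l0 (u s) + exp_modular p l0 (v s) \<le> ennreal K + ennreal K" by (intro add_mono K s)
    also have "\<dots> = ennreal (K + K)" by (rule ennreal_plus[symmetric]) (use K(1) in auto)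
    finally show "exp_modular p (2 * l0) (\<lambda>x. u s x - v s x) \<le> ennreal (K + K)" by simp
    show "(\<lambda>x. u s x - v s x) \<in> borel_measurable lebesgue" using um[OF s] by (intro borel_imp_lebesgue) measurable
  qed (use l0_pos in auto)
  have main: "\<forall>t\<in>{0..T}. t \<le> real m * h \<longrightarrow> (AE x in lborel. u t x = v t x)" for m :: nat
  proof (induction m)
    case 0
    show ?case
    proof (intro ballI impI)
      fix t assume t: "t \<in> {0..T}" "t \<le> real 0 * h"
      then have "t = 0" by simp
      then have "duh u t x = 0" "duh v t x = 0" for x by (simp_all add: duh_def)
      with eu[OF t(1)] ev[OF t(1)] show "AE x in lborel. u t x = v t x" by auto
    qed
  next
    case (Suc m)
    define r where "r = real m * h"
    have r0: "0 \<le> r" using h by (simp add: r_def)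
    have IH: "AE x in lborel. u s x = v s x" if "0 \<le> s" "s \<le> r" "s \<le> T" for s
      using Suc.IH that by (auto simp: r_def)
    have em: "\<forall>t\<in>{0..T}. r \<le> t \<longrightarrow> t \<le> r + h \<longrightarrow> exp_modular p (l / 2 ^ i) (\<lambda>x. u t x - v t x) \<le> 1" for i :: nat
    proof (induction i)
      case 0 then show ?case using uvl by simp
    next
      case (Suc i)
      show ?case
      proof (intro ballI impI)
        fix t assume t: "t \<in> {0..T}" "r \<le> t" "t \<le> r + h"
        have li: "0 < l / 2 ^ i" "0 < l / 2 ^ Suc i" using l by auto
        have "0 \<le> lipL K * (l / 2 ^ i)" using L li(1) by (intro mult_nonneg_nonneg) auto
        then have "(lipL K * (l / 2 ^ i)) * om (t - r) \<le> (lipL K * (l / 2 ^ i)) * (1 / (2 * lipL K))"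
          using t by (intro mult_left_mono h) auto
        then have lo: "lipL K * (l / 2 ^ i) * om (t - r) \<le> l / 2 ^ Suc i" using L by simp
        have "exp_modular p (l / 2 ^ Suc i) (\<lambda>x. duh u t x - duh v t x) \<le> 1"
        proof (rule duh_diff(2)[OF u v K r0 t(2) _ _ _ li lo])
          show "t \<le> T" using t by simp
          show "AE x in lborel. u s x = v s x" if "0 \<le> s" "s < r" for s using that t by (intro IH) auto
          show "exp_modular p (l / 2 ^ i) (\<lambda>x. u s x - v s x) \<le> 1" if "r \<le> s" "s \<le> t" for s
            using Suc.IH that t r0 by auto
        qed auto
        moreover have "AE x in lborel. u t x - v t x = duh u t x - duh v t x"
          using eu[OF t(1)] ev[OF t(1)] by eventually_elim simp
        ultimately show "exp_modular p (l / 2 ^ Suc i) (\<lambda>x. u t x - v t x) \<le> 1"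
          using exp_modular_cong_AE[of "\<lambda>x. u t x - v t x" "\<lambda>x. duh u t x - duh v t x"] by simp
      qed
    qed
    show ?case
    proof (intro ballI impI)
      fix t assume t: "t \<in> {0..T}" "t \<le> real (Suc m) * h"
      show "AE x in lborel. u t x = v t x"
      proof (cases "t \<le> r")
        case True then show ?thesis using t by (intro IH) auto
      next
        case False
        have "t \<le> r + h" using t by (simp add: r_def algebra_simps)
        then have "AE x in lborel. u t x - v t x = 0"
          using um[OF t(1)] em t False by (intro AE_zero_of_exp_modular[OF p0 l]) auto
        then show ?thesis by eventually_elim simp
      qed
    qed
  qed
  obtain m :: nat where "t / h \<le> real m" using real_arch_simple by blast
  then have "t \<le> real m * h" using h by (simp add: field_simps)
  then show ?thesis using main t by blast
qed

end

section \<open>Mild solutions\<close>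

context frac_heat_nonlinear
begin

text \<open>For \<open>s < t\<close> the semigroup only sees the almost-everywhere class of \<open>w s\<close>, so the family \<open>w\<close>
  may be replaced by the Borel family \<open>v\<close>; the single time \<open>s = t\<close> is negligible.\<close>

lemma duh_eq_set_integral:
  assumes v: "exp_cont T v" and t: "0 \<le> t" "t \<le> T"
    and eq: "\<And>s. s \<in> {0..T} \<Longrightarrow> AE x in lborel. w s x = v s x"
  shows "(\<lambda>s. heat (t - s) (\<lambda>y. f (w s y)) x) absolutely_integrable_on {0..t}"
    and "(LINT s:{0..t}|lebesgue. heat (t - s) (\<lambda>y. f (w s y)) x) = duh v t x"
proof -
  define F where "F r = indicator {0<..t} r * heat r (\<lambda>y. f (v (t - r) y)) x" for r
  let ?G = "\<lambda>s. indicator {0..t} s *\<^sub>R heat (t - s) (\<lambda>y. f (w s y)) x"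
  have Fi: "integrable lborel F" unfolding F_def by (rule duh_integrable(1)[OF v t])
  have Fr: "integrable lborel (\<lambda>s. F (t + (-1) *\<^sub>R s))" by (rule integrable_lborel_affine[OF Fi]) simp
  have FI: "(\<integral>s. F (t + (-1) *\<^sub>R s) \<partial>lborel) = duh v t x"
    using integral_lborel_affine[of F "-1" t] Fi by (simp add: duh_def F_def)
  have G: "?G s = F (t + (-1) *\<^sub>R s)" if "s \<noteq> t" for s
  proof (cases "0 \<le> s \<and> s < t")
    case True
    have ae: "AE y in lborel. f (w s y) = f (v s y)" using eq[of s] True t by (auto elim: eventually_mono)
    have "v s \<in> borel_measurable borel" using True t by (intro exp_cont_measurable[OF v]) auto
    then have vm: "(\<lambda>y. f (v s y)) \<in> borel_measurable borel" by measurable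
    have "t - s \<noteq> 0" using True by simp
    then have "heat (t - s) (\<lambda>y. f (w s y)) x = heat (t - s) (\<lambda>y. f (v s y)) x"
      using frac_heat_semigroup_AE_eq[OF _ vm ae, of "t - s" \<beta> x] semigroup_eq_lborel[OF _ vm, of "t - s" x] by simp
    then show ?thesis using True by (simp add: F_def)
  next
    case False
    then show ?thesis using that by (auto simp: F_def indicator_def)
  qed
  have ae: "AE s in lebesgue. F (t + (-1) *\<^sub>R s) = ?G s"
    using AE_completion[OF AE_lborel_singleton[of t]] by eventually_elim (rule G[symmetric])
  have Fl: "integrable lebesgue (\<lambda>s. F (t + (-1) *\<^sub>R s))"
    using Fr by (subst integrable_completion) auto
  have Gm: "?G \<in> borel_measurable lebesgue"
    by (rule borel_measurable_AE[OF borel_measurable_integrable[OF Fl] ae])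
  show "(\<lambda>s. heat (t - s) (\<lambda>y. f (w s y)) x) absolutely_integrable_on {0..t}"
    unfolding set_integrable_def by (rule integrable_cong_AE_imp[OF Fl Gm ae])
  have "(LINT s:{0..t}|lebesgue. heat (t - s) (\<lambda>y. f (w s y)) x) = (\<integral>s. F (t + (-1) *\<^sub>R s) \<partial>lebesgue)"
    unfolding set_lebesgue_integral_def
    by (rule integral_cong_AE[OF Gm borel_measurable_integrable[OF Fl]]) (use ae in \<open>auto elim: eventually_mono\<close>)
  also have "\<dots> = duh v t x" unfolding FI[symmetric] using Fr by (intro integral_completion) auto
  finally show "(LINT s:{0..t}|lebesgue. heat (t - s) (\<lambda>y. f (w s y)) x) = duh v t x" .
qed

lemma exp_cont_imp_exp_Lp0_continuous:
  assumes u: "exp_cont T u" shows "exp_Lp0_continuous p T u"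
  unfolding exp_Lp0_continuous_def
proof (intro conjI ballI)
  fix t assume t: "t \<in> {0..T}"
  show "u t \<in> exp_Lp0 p"
    using exp_cont_measurable[OF u] exp_cont_finite[OF u] t
    by (intro exp_Lp0_I[OF _ p1] borel_imp_lebesgue) auto
  show "((\<lambda>s. exp_Lp_norm p (\<lambda>x. u s x - u t x)) \<longlongrightarrow> 0) (at t within {0..T})"
  proof (rule tendstoI)
    fix e :: real assume e: "0 < e"
    obtain d where d: "0 < d" "\<And>s. s \<in> {0..T} \<Longrightarrow> \<bar>s - t\<bar> < d \<Longrightarrow> exp_modular p (e / 2) (\<lambda>x. u s x - u t x) \<le> 1"
      using exp_cont_uniform[OF u half_gt_zero[OF e]] t by blast
    have "\<bar>exp_Lp_norm p (\<lambda>x. u s x - u t x)\<bar> < e" if s: "s \<in> {0..T}" "\<bar>s - t\<bar> < d" for s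
      using exp_Lp_norm_le[OF half_gt_zero[OF e] d(2)[OF s]] exp_Lp_norm_nonneg[OF half_gt_zero[OF e] d(2)[OF s]] e by simp
    then show "\<forall>\<^sub>F s in at t within {0..T}. dist (exp_Lp_norm p (\<lambda>x. u s x - u t x)) 0 < e"
      unfolding eventually_at using d(1) by (auto simp: dist_real_def intro!: exI[of _ d])
  qed
qed

text \<open>Modulars ignore null sets, so continuity carries over although the Borel representatives
  are chosen independently at each time.\<close>

lemma exp_Lp0_continuous_borel:
  assumes u: "exp_Lp0_continuous p T u"
  obtains v where "exp_cont T v" "\<And>t. t \<in> {0..T} \<Longrightarrow> AE x in lborel. u t x = v t x"
proof -
  have u0: "u t \<in> exp_Lp0 p" if "t \<in> {0..T}" for t using u that by (simp add: exp_Lp0_continuous_def)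
  have um: "u t \<in> borel_measurable lebesgue" if "t \<in> {0..T}" for t
    using u0[OF that] by (auto simp: exp_Lp0_def intro: exp_Lp_measurable)
  have "\<forall>t\<in>{0..T}. \<exists>g. g \<in> borel_measurable lborel \<and> (AE x in lborel. u t x = g x)"
    using completion_ex_borel_measurable_real[OF um] by blast
  from bchoice[OF this] obtain v where v: "\<forall>t\<in>{0..T}. v t \<in> borel_measurable lborel \<and> (AE x in lborel. u t x = v t x)" ..
  have ae: "AE x in lborel. u t x = v t x" if "t \<in> {0..T}" for t using v that by blast
  have "exp_cont T v"
    unfolding exp_cont_def
  proof (intro conjI ballI allI impI)
    fix t assume t: "t \<in> {0..T}"
    show "v t \<in> borel_measurable borel" using v t by simp
    fix l :: real assume l: "0 < l"
    show "exp_modular p l (v t) < \<infinity>"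
      using exp_Lp0_modular_finite[OF u0[OF t] p1 l] exp_modular_cong_AE[OF ae[OF t]] by simp
    have "((\<lambda>s. exp_Lp_norm p (\<lambda>x. u s x - u t x)) \<longlongrightarrow> 0) (at t within {0..T})"
      using u t by (simp add: exp_Lp0_continuous_def)
    from order_tendstoD(2)[OF this l]
    obtain d where d: "0 < d" "\<And>s. s \<in> {0..T} \<Longrightarrow> s \<noteq> t \<Longrightarrow> \<bar>s - t\<bar> < d \<Longrightarrow> exp_Lp_norm p (\<lambda>x. u s x - u t x) < l"
      by (auto simp: eventually_at dist_real_def)
    have "exp_modular p l (\<lambda>x. v s x - v t x) \<le> 1" if s: "s \<in> {0..T}" "\<bar>s - t\<bar> < d" for s
    \<comment> \<open>The limit of the norm says nothing about s = t, where the difference is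
      0.\<close>
    proof (cases "s = t")
      case True then show ?thesis using p0 by (simp add: exp_modular_def)
    next
      case False
      have "exp_modular p (2 * 1) (\<lambda>x. u s x + (- u t x)) \<le> exp_modular p 1 (u s) + exp_modular p 1 (\<lambda>x. - u t x)"
        using um[OF s(1)] um[OF t] p0 by (intro exp_modular_add) auto
      also have "exp_modular p 1 (\<lambda>x. - u t x) = exp_modular p 1 (u t)" by (simp add: exp_modular_def)
      also have "exp_modular p 1 (u s) + exp_modular p 1 (u t) < \<infinity>"
        using exp_Lp0_modular_finite[OF u0[OF s(1)] p1 zero_less_one] exp_Lp0_modular_finite[OF u0[OF t] p1 zero_less_one] by simp
      finally have fin: "exp_modular p 2 (\<lambda>x. u s x - u t x) < \<infinity>" by simp
      have "exp_modular p l (\<lambda>x. u s x - u t x) \<le> 1"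
        by (rule exp_modular_le_1_of_norm(2)[OF p1 _ _ fin d(2)[OF s(1) False s(2)]]) (use um[OF s(1)] um[OF t] in auto)
      moreover have "AE x in lborel. u s x - u t x = v s x - v t x"
        using ae[OF s(1)] ae[OF t] by eventually_elim simp
      ultimately show ?thesis using exp_modular_cong_AE[of "\<lambda>x. u s x - u t x" "\<lambda>x. v s x - v t x"] by simp
    qed
    with d(1) show "\<exists>d>0. \<forall>s\<in>{0..T}. \<bar>s - t\<bar> < d \<longrightarrow> exp_modular p l (\<lambda>x. v s x - v t x) \<le> 1" by blast
  qed
  with ae show thesis by (intro that)
qed

lemma mild_solution_exists_unique:
  fixes u0 :: "'a \<Rightarrow> real"
  assumes u0: "u0 \<in> exp_Lp0 p"
  shows "\<exists>T>0. \<exists>u. mild_solution p \<beta> f u0 T u \<and>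
     (\<forall>v. mild_solution p \<beta> f u0 T v \<longrightarrow> (\<forall>t\<in>{0..T}. AE x in lebesgue. v t x = u t x))"
proof -
  have "u0 \<in> borel_measurable lebesgue" using u0 by (auto simp: exp_Lp0_def intro: exp_Lp_measurable)
  from completion_ex_borel_measurable_real[OF this]
  \<comment> \<open>Changing u0 on a null set leaves the semigroup unchanged at positive times and
    alters it only on a null set at time 0, so the Picard scheme may run on the Borel
    version.\<close>
  obtain w where w: "w \<in> borel_measurable borel" and ae: "AE x in lborel. u0 x = w x" by auto
  have w0: "w \<in> exp_Lp0 p"
    using exp_Lp0_modular_finite[OF u0 p1] exp_modular_cong_AE[OF ae]
    by (intro exp_Lp0_I[OF borel_imp_lebesgue[OF w] p1]) auto
  have S: "AE x in lborel. heat t u0 x = heat t w x" if "0 \<le> t" for t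
  proof (cases "t = 0")
    case True then show ?thesis using ae by (simp add: frac_heat_semigroup_def)
  next
    case False
    then show ?thesis using frac_heat_semigroup_AE_eq[OF False w ae] semigroup_eq_lborel[OF False w] by simp
  qed
  obtain T u where T: "0 < T" and u: "exp_cont T u" "\<forall>t\<in>{0..T}. \<forall>x. u t x = heat t w x + duh u t x"
    using picard_exists[OF w0 w] by blast
  have "mild_solution p \<beta> f u0 T u"
    unfolding mild_solution_def
  proof (intro conjI ballI)
    show "exp_Lp0_continuous p T u" by (rule exp_cont_imp_exp_Lp0_continuous[OF u(1)])
    fix t assume t: "t \<in> {0..T}"
    then have t': "0 \<le> t" "t \<le> T" by auto
    have r: "AE x in lborel. u s x = u s x" for s by simp
    show "AE x in lebesgue. (\<lambda>s. heat (t - s) (\<lambda>y. f (u s y)) x) absolutely_integrable_on {0..t} \<and>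
        u t x = heat t u0 x + (LINT s:{0..t}|lebesgue. heat (t - s) (\<lambda>y. f (u s y)) x)"
      using AE_completion[OF S[OF t'(1)]]
    proof eventually_elim
      case (elim x)
      then show ?case
        using duh_eq_set_integral[OF u(1) t' r, of x] u(2) t by simp
    qed
  qed
  moreover have "AE x in lebesgue. v t x = u t x" if v: "mild_solution p \<beta> f u0 T v" and t: "t \<in> {0..T}" for v t
  proof -
    have vc: "exp_Lp0_continuous p T v" using v by (simp add: mild_solution_def)
    obtain v' where v': "exp_cont T v'" "\<And>t. t \<in> {0..T} \<Longrightarrow> AE x in lborel. v t x = v' t x"
      using exp_Lp0_continuous_borel[OF vc] by blast
    have ev: "AE x in lborel. v' t x = heat t w x + duh v' t x" if t: "t \<in> {0..T}" for t
    proof -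
      have t': "0 \<le> t" "t \<le> T" using t by auto
      have "AE x in lebesgue. v t x = heat t u0 x + (LINT s:{0..t}|lebesgue. heat (t - s) (\<lambda>y. f (v s y)) x)"
        using v t unfolding mild_solution_def by (auto elim: eventually_mono)
      moreover have "(LINT s:{0..t}|lebesgue. heat (t - s) (\<lambda>y. f (v s y)) x) = duh v' t x" for x
        by (rule duh_eq_set_integral(2)[OF v'(1) t']) (rule v'(2))
      ultimately have "AE x in lborel. v t x = heat t u0 x + duh v' t x"
        by (simp add: AE_completion_iff)
      then show ?thesis using v'(2)[OF t] S[OF t'(1)] by eventually_elim simp
    qed
    have "AE x in lborel. u t x = v' t x"
      by (rule mild_unique[OF u(1) v'(1) _ ev t]) (use u(2) in auto)
    then have "AE x in lborel. v t x = u t x" using v'(2)[OF t] by eventually_elim simp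
    then show ?thesis by (rule AE_completion)
  qed
  ultimately show ?thesis using T by blast
qed

end

theorem theorem1:
  fixes p \<beta> C lam :: real
    and f :: "real \<Rightarrow> real"
    and u0 :: "real ^ 'n \<Rightarrow> real"
  assumes "1 < p" and "0 < \<beta>" and "\<beta> < 2"
    and "f 0 = 0"
    and "0 < C" and "0 < lam"
    and "\<And>u v. \<bar>f u - f v\<bar> \<le>
           C * \<bar>u - v\<bar> * (exp (lam * \<bar>u\<bar> powr p) + exp (lam * \<bar>v\<bar> powr p))"
    and "u0 \<in> exp_Lp0 p"
  shows "\<exists>T>0. \<exists>u. mild_solution p \<beta> f u0 T u \<and>
           (\<forall>v. mild_solution p \<beta> f u0 T v \<longrightarrow>
              (\<forall>t\<in>{0..T}. AE x in lebesgue. v t x = u t x))"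
proof -
  \<comment> \<open>This is p k > n / \<beta>, obtained with an exponent that is a multiple of p and
    hence a moment controlled by the modular.\<close>
  obtain k :: nat where k: "real DIM(real ^ 'n) / (\<beta> * p) < real k" using reals_Archimedean2 by blast
  have "0 < real DIM(real ^ 'n) / (\<beta> * p)" using assms by simp
  then have "0 < k" using k by (metis less_trans of_nat_0_less_iff)
  moreover have "real DIM(real ^ 'n) < \<beta> * (p * real k)" using k assms by (simp add: field_simps)
  ultimately interpret frac_heat_nonlinear \<beta> p C lam f k "TYPE(real ^ 'n)"
    by unfold_locales (use assms in auto)
  show ?thesis by (rule mild_solution_exists_unique[OF assms(8)])
qed

end
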